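(* Let $c_0$ be a sufficiently large constant. (a) If $c_0\leq r=r(n)=o(n^{1/4})$, there are constants $c_1,c_2>0$ such that with probability $1-o(1)$ as $n\to\infty$ the random regular graph $G_{n,r}$ satisfies $$c_1n/\sqrt r\leq\vartheta_{1/2}(G_{n,r})\leq\vartheta(G_{n,r})\leq\vartheta_2(G_{n,r})\leq c_2n/\sqrt r.$$ (b) There is a constant $c_3>0$ such that if $c_0\leq r=o(n^{1/2})$ then $$\Pr\big(c_3\sqrt r\leq\bar\vartheta_{1/2}(G_{n,r})\leq\bar\vartheta(G_{n,r})\leq\bar\vartheta_2(G_{n,r})\big)\geq 1-\exp(-n).$$
   Context: $G_{n,r}$ denotes an $r$-regular graph on $\{1,\dots,n\}$ chosen uniformly at random ($rn$ even). For a graph $G=(V,E)$ and a real $k>1$, an $n$-tuple $(v_1,\dots,v_n)$ of unit vectors in $\mathbb R^n$ is a vector $k$-coloring if $\langle v_i,v_j\rangle\leq-1/(k-1)$ for all $\{i,j\}\in E$; strict if $\langle v_i,v_j\rangle=-1/(k-1)$ for all $\{i,j\}\in E$; rigid if equality holds on all edges and $\langle v_i,v_j\rangle\geq-1/(k-1)$ for all non-adjacent $i\neq j$. $\bar\vartheta_{1/2}(G)$ (vector chromatic number), $\bar\vartheta(G)$, $\bar\vartheta_2(G)$ are the infima of $k>1$ such that $G$ admits a vector, strict vector, resp. rigid vector $k$-coloring; with $\bar G$ the complement, $\vartheta_{1/2}(G)=\bar\vartheta_{1/2}(\bar G)$, $\vartheta(G)=\bar\vartheta(\bar G)$ (Lovász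 number), $\vartheta_2(G)=\bar\vartheta_2(\bar G)$. *)

theory Defs
  imports Complex_Main
begin

text \<open>Simple graphs on the vertex set {1..n}: a set of edges, each edge a 2-element set.\<close>

definition all_pairs :: "nat \<Rightarrow> nat set set" where
  "all_pairs n = {{i, j} | i j. i \<in> {1..n} \<and> j \<in> {1..n} \<and> i \<noteq> j}"

definition reg_graphs :: "nat \<Rightarrow> nat \<Rightarrow> nat set set set" where
  "reg_graphs n r = {E. E \<subseteq> all_pairs n \<and> (\<forall>i\<in>{1..n}. card {e \<in> E. i \<in> e} = r)}"

definition prob_reg :: "nat \<Rightarrow> nat \<Rightarrow> (nat set set \<Rightarrow> bool) \<Rightarrow> real" where
  "prob_reg n r P = real (card {E \<in> reg_graphs n r. P E}) / real (card (reg_graphs n r))"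

definition compl_graph :: "nat \<Rightarrow> nat set set \<Rightarrow> nat set set" where
  "compl_graph n E = all_pairs n - E"

text \<open>Vectors in R^n as functions nat => real, coordinates indexed by {1..n}.\<close>
definition ip :: "nat \<Rightarrow> (nat \<Rightarrow> real) \<Rightarrow> (nat \<Rightarrow> real) \<Rightarrow> real" where
  "ip n x y = (\<Sum>l\<in>{1..n}. x l * y l)"

definition unit_vecs :: "nat \<Rightarrow> (nat \<Rightarrow> nat \<Rightarrow> real) \<Rightarrow> bool" where
  "unit_vecs n v = (\<forall>i\<in>{1..n}. ip n (v i) (v i) = 1)"

definition vector_coloring :: "nat \<Rightarrow> nat set set \<Rightarrow> real \<Rightarrow> (nat \<Rightarrow> nat \<Rightarrow> real) \<Rightarrow> bool" where
  "vector_coloring n E k v = (unit_vecs n v \<and>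
     (\<forall>i\<in>{1..n}. \<forall>j\<in>{1..n}. {i, j} \<in> E \<longrightarrow> ip n (v i) (v j) \<le> - 1 / (k - 1)))"

definition strict_vector_coloring :: "nat \<Rightarrow> nat set set \<Rightarrow> real \<Rightarrow> (nat \<Rightarrow> nat \<Rightarrow> real) \<Rightarrow> bool" where
  "strict_vector_coloring n E k v = (unit_vecs n v \<and>
     (\<forall>i\<in>{1..n}. \<forall>j\<in>{1..n}. {i, j} \<in> E \<longrightarrow> ip n (v i) (v j) = - 1 / (k - 1)))"

definition rigid_vector_coloring :: "nat \<Rightarrow> nat set set \<Rightarrow> real \<Rightarrow> (nat \<Rightarrow> nat \<Rightarrow> real) \<Rightarrow> bool" where
  "rigid_vector_coloring n E k v = (unit_vecs n v \<and>
     (\<forall>i\<in>{1..n}. \<forall>j\<in>{1..n}. {i, j} \<in> E \<longrightarrow> ip n (v i) (v j) = - 1 / (k - 1)) \<and>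
     (\<forall>i\<in>{1..n}. \<forall>j\<in>{1..n}. i \<noteq> j \<longrightarrow> {i, j} \<notin> E \<longrightarrow> ip n (v i) (v j) \<ge> - 1 / (k - 1)))"

definition theta_bar_half :: "nat \<Rightarrow> nat set set \<Rightarrow> real" where
  "theta_bar_half n E = Inf {k. k > 1 \<and> (\<exists>v. vector_coloring n E k v)}"

definition theta_bar :: "nat \<Rightarrow> nat set set \<Rightarrow> real" where
  "theta_bar n E = Inf {k. k > 1 \<and> (\<exists>v. strict_vector_coloring n E k v)}"

definition theta_bar_2 :: "nat \<Rightarrow> nat set set \<Rightarrow> real" where
  "theta_bar_2 n E = Inf {k. k > 1 \<and> (\<exists>v. rigid_vector_coloring n E k v)}"

definition theta_half :: "nat \<Rightarrow> nat set set \<Rightarrow> real" where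
  "theta_half n E = theta_bar_half n (compl_graph n E)"

definition theta :: "nat \<Rightarrow> nat set set \<Rightarrow> real" where
  "theta n E = theta_bar n (compl_graph n E)"

definition theta_2 :: "nat \<Rightarrow> nat set set \<Rightarrow> real" where
  "theta_2 n E = theta_bar_2 n (compl_graph n E)"

end

theory Submission
  imports Defs "HOL-Analysis.Analysis"
begin

text \<open>
  Let \<open>M = A - (r / n) J\<close>, where \<open>A\<close> is the adjacency matrix and \<open>J\<close> the all-one matrix. Everything
  follows from one discrepancy event: \<open>\<bar>x\<^sup>T M x\<bar> \<le> C n \<surd>r\<close> for all \<open>x\<close> with \<open>\<bar>x\<bar>\<^sup>2 \<le> n\<close> and
  \<open>x\<^sub>i\<^sup>2 \<le> \<surd>r\<close>. For nonnegative \<open>x\<close>, exponential moments of \<open>x\<^sup>T A x\<close> are bounded in both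
  directions by comparing a uniform regular graph with its switchings (two edges \<open>ij, kl\<close> replaced by
  \<open>il, jk\<close>), with no detour through the configuration model. A union bound over lattice
  points gives the event with probability \<open>1 - exp (- n)\<close>, already for \<open>r\<^sup>2 \<le> n\<close>; Grothendieck's
  inequality carries it over from scalars to vectors \<open>b\<^sub>i\<close> with \<open>\<bar>b\<^sub>i\<bar> = x\<^sub>i\<close>.

  Applied to the Gram matrix of a vector colouring of the graph or of its complement, the event yields the
  two lower bounds. For the upper bound on \<open>\<vartheta>\<^sub>2\<close>, semidefinite duality reduces the task to bounding
  \<open>\<bar>\<Sum> b\<^sub>i\<bar>\<^sup>2\<close> when \<open>\<Sum> \<bar>b\<^sub>i\<bar>\<^sup>2 = 1\<close> and \<open>\<langle>b\<^sub>i, b\<^sub>j\<rangle> \<le> 0\<close> on edges. After projecting to the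
  direction of the sum all vectors are short enough for the discrepancy bound, so that no spectral gap,
  which would fail with too large a probability, is needed.
\<close>

section \<open>Positive semidefinite matrices\<close>

text \<open>The cap \<open>\<surd>r\<close> on squared entries is where two demands meet. A
  switching can move the quadratic form by the order of the cap, so exponential moments are
  controlled only up to a parameter of order \<open>1 / \<surd>r\<close>; a deviation of order
  \<open>n \<surd>r\<close> then costs \<open>exp (- c n)\<close> with \<open>c\<close> large enough
  to beat the \<open>exp (17 n)\<close> lattice points, whereas a larger cap would weaken the tail.
  On the dual side, vectors of norm at most one are rescaled by \<open>t = n / P\<close>, and since
  \<open>P \<le> n / \<surd>r\<close> is already good enough, \<open>t\<close> never exceeds that
  same cap.

  Switchings that would create a loop or a double edge are forbidden. They shift the mean by order
  \<open>r\<^sup>2\<close>, which \<open>r\<^sup>2 \<le> n\<close> keeps below the target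
  \<open>n \<surd>r\<close>.

  The moment estimates discard the removed edges and therefore need nonnegative weights. Rounding is
  done in a bilinear form with two separate arguments, because a quadratic form need not attain its
  maximum over a box at a vertex.\<close>

definition psd :: "nat \<Rightarrow> (nat \<Rightarrow> nat \<Rightarrow> real) \<Rightarrow> bool" where
  "psd n G \<longleftrightarrow> (\<forall>i\<in>{1..n}. \<forall>j\<in>{1..n}. G i j = G j i) \<and>
     (\<forall>x. 0 \<le> (\<Sum>i\<in>{1..n}. \<Sum>j\<in>{1..n}. G i j * x i * x j))"

lemma psd_nonneg: "psd n G \<Longrightarrow> 0 \<le> (\<Sum>i\<in>{1..n}. \<Sum>j\<in>{1..n}. G i j * x i * x j)"
  by (simp add: psd_def)

lemma psd_sym: "psd n G \<Longrightarrow> i \<in> {1..n} \<Longrightarrow> j \<in> {1..n} \<Longrightarrow> G i j = G j i"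
  by (simp add: psd_def)

lemma psd_minor:
  assumes "psd n G" "i \<in> {1..n}" "j \<in> {1..n}" "i \<noteq> j"
  shows "0 \<le> G i i * s\<^sup>2 + 2 * G i j * s * t + G j j * t\<^sup>2"
proof -
  define x where "x = (\<lambda>l. if l = i then s else if l = j then t else 0)"
  have in_sum: "(\<Sum>l\<in>{1..n}. G k l * x k * x l) = x k * (G k i * s + G k j * t)" for k
  proof -
    have "(\<Sum>l\<in>{1..n}. G k l * x k * x l) = (\<Sum>l\<in>{i,j}. G k l * x k * x l)"
      by (rule sum.mono_neutral_right) (use assms in \<open>auto simp: x_def\<close>)
    then show ?thesis using assms by (simp add: x_def algebra_simps)
  qed
  have "(\<Sum>k\<in>{1..n}. x k * (G k i * s + G k j * t)) = (\<Sum>k\<in>{i,j}. x k * (G k i * s + G k j * t))"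
    by (rule sum.mono_neutral_right) (use assms in \<open>auto simp: x_def\<close>)
  also have "\<dots> = s * (G i i * s + G i j * t) + t * (G j i * s + G j j * t)"
    using assms by (simp add: x_def)
  also have "\<dots> = G i i * s\<^sup>2 + 2 * G i j * s * t + G j j * t\<^sup>2"
    using assms by (simp add: psd_def power2_eq_square algebra_simps)
  finally have "(\<Sum>k\<in>{1..n}. \<Sum>l\<in>{1..n}. G k l * x k * x l) = G i i * s\<^sup>2 + 2 * G i j * s * t + G j j * t\<^sup>2"
    by (simp only: in_sum)
  then show ?thesis using psd_nonneg[OF assms(1), of x] by (simp only:)
qed

lemma psd_diag:
  assumes "psd n G" "i \<in> {1..n}"
  shows "0 \<le> G i i"
proof -
  define x :: "nat \<Rightarrow> real" where "x = (\<lambda>l. if l = i then 1 else 0)"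
  have "(\<Sum>k\<in>{1..n}. \<Sum>l\<in>{1..n}. G k l * x k * x l) = (\<Sum>k\<in>{i}. \<Sum>l\<in>{1..n}. G k l * x k * x l)"
    by (rule sum.mono_neutral_right) (use assms in \<open>auto simp: x_def\<close>)
  also have "\<dots> = (\<Sum>k\<in>{i}. \<Sum>l\<in>{i}. G k l * x k * x l)"
    by (intro sum.cong refl sum.mono_neutral_right) (use assms in \<open>auto simp: x_def\<close>)
  also have "\<dots> = G i i" by (simp add: x_def)
  finally show ?thesis using psd_nonneg[OF assms(1), of x] by (simp only:)
qed

lemma psd_entry_sq_le:
  assumes "psd n G" "i \<in> {1..n}" "j \<in> {1..n}"
  shows "(G i j)\<^sup>2 \<le> G i i * G j j"
proof (cases "i = j")
  case False
  note m = psd_minor[OF assms False]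
  have d: "0 \<le> G i i" "0 \<le> G j j" using psd_diag assms by auto
  show ?thesis
  proof (cases "G j j = 0")
    case True
    \<comment> \<open>With a zero pivot the form is affine in \<open>t\<close>; the value of
      \<open>t\<close> inserted below makes it \<open>- (G i j)\<^sup>2\<close>.\<close>
    have "0 \<le> G i i * (G i j)\<^sup>2 + 2 * G i j * G i j * t" for t
      using m[of "G i j" t] True by (simp add: algebra_simps)
    moreover have "G i i * (G i j)\<^sup>2 + 2 * G i j * G i j * (- (G i i + 1) / 2) = - ((G i j)\<^sup>2)"
      by (simp add: power2_eq_square field_simps)
    ultimately have "0 \<le> - ((G i j)\<^sup>2)" by metis
    then show ?thesis using d by simp
  next
    case False
    then have "0 < G j j" using d by simp
    have "0 \<le> G i i * (G j j)\<^sup>2 - 2 * G i j * G j j * G i j + G j j * (G i j)\<^sup>2"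
      using m[of "G j j" "- G i j"] by simp
    also have "\<dots> = G j j * (G i i * G j j - (G i j)\<^sup>2)"
      by (simp add: power2_eq_square algebra_simps)
    finally show ?thesis using \<open>0 < G j j\<close> by (simp add: zero_le_mult_iff)
  qed
qed (simp add: power2_eq_square)

text \<open>Cholesky: the last row is split off by a Schur complement. When the pivot vanishes so does
  its row, and division by zero leaves the complement equal to the original matrix.\<close>
lemma psd_gram:
  assumes "psd n G"
  shows "\<exists>b. \<forall>i\<in>{1..n}. \<forall>j\<in>{1..n}. G i j = ip n (b i) (b j)"
  using assms
proof (induction n arbitrary: G)
  case 0
  then show ?case by simp
next
  case (Suc n)
  define g where "g = G (Suc n) (Suc n)"
  define c where "c = (\<lambda>i. G i (Suc n))"
  have g0: "0 \<le> g" using psd_diag[OF Suc.prems] by (simp add: g_def)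
  have c0: "c i = 0" if "g = 0" "i \<in> {1..Suc n}" for i
    using psd_entry_sq_le[OF Suc.prems, of i "Suc n"] that by (simp add: g_def c_def)
  have sym: "G i j = G j i" if "i \<in> {1..Suc n}" "j \<in> {1..Suc n}" for i j
    using psd_sym[OF Suc.prems] that by blast
  define H where "H = (\<lambda>i j. G i j - c i * c j / g)"
  have "psd n H"
    unfolding psd_def
  proof (intro conjI ballI allI)
    fix i j assume "i \<in> {1..n}" "j \<in> {1..n}"
    then show "H i j = H j i" using sym[of i j] by (simp add: H_def)
  next
    fix x :: "nat \<Rightarrow> real"
    define s where "s = (\<Sum>i\<in>{1..n}. c i * x i)"
    \<comment> \<open>The last coordinate \<open>- s / g\<close> minimises the enlarged form for
      given \<open>x\<close>; the minimum is the form of the Schur complement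
      \<open>H\<close>.\<close>
    define y where "y = (\<lambda>i. if i = Suc n then - s / g else x i)"
    have "(\<Sum>i\<in>{1..n}. \<Sum>j\<in>{1..n}. H i j * x i * x j)
        = (\<Sum>i\<in>{1..n}. \<Sum>j\<in>{1..n}. G i j * x i * x j) - (\<Sum>i\<in>{1..n}. \<Sum>j\<in>{1..n}. (c i * x i) * (c j * x j)) / g"
      by (simp add: H_def sum_subtractf sum_divide_distrib algebra_simps)
    also have "(\<Sum>i\<in>{1..n}. \<Sum>j\<in>{1..n}. (c i * x i) * (c j * x j)) = s * s"
      by (simp add: s_def sum_product)
    finally have H_eq: "(\<Sum>i\<in>{1..n}. \<Sum>j\<in>{1..n}. H i j * x i * x j)
        = (\<Sum>i\<in>{1..n}. \<Sum>j\<in>{1..n}. G i j * x i * x j) - s * s / g" .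
    have "(\<Sum>i\<in>{1..Suc n}. \<Sum>j\<in>{1..Suc n}. G i j * y i * y j)
       = (\<Sum>i\<in>{1..n}. (\<Sum>j\<in>{1..n}. G i j * x i * x j) + c i * x i * (- s / g))
         + ((\<Sum>j\<in>{1..n}. G (Suc n) j * (- s / g) * x j) + g * (- s / g) * (- s / g))"
      by (simp add: y_def c_def g_def)
    also have "(\<Sum>j\<in>{1..n}. G (Suc n) j * (- s / g) * x j) = (- s / g) * s"
      unfolding s_def c_def sum_distrib_left
      by (intro sum.cong) (auto simp: sym[of "Suc n"])
    also have "(\<Sum>i\<in>{1..n}. (\<Sum>j\<in>{1..n}. G i j * x i * x j) + c i * x i * (- s / g))
       = (\<Sum>i\<in>{1..n}. \<Sum>j\<in>{1..n}. G i j * x i * x j) + s * (- s / g)"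
      unfolding s_def by (simp only: sum.distrib sum_distrib_right)
    also have "(\<Sum>i\<in>{1..n}. \<Sum>j\<in>{1..n}. G i j * x i * x j) + s * (- s / g)
         + (- s / g * s + g * (- s / g) * (- s / g)) = (\<Sum>i\<in>{1..n}. \<Sum>j\<in>{1..n}. H i j * x i * x j)"
      unfolding H_eq by (cases "g = 0") simp_all
    finally have "(\<Sum>i\<in>{1..Suc n}. \<Sum>j\<in>{1..Suc n}. G i j * y i * y j)
       = (\<Sum>i\<in>{1..n}. \<Sum>j\<in>{1..n}. H i j * x i * x j)" .
    then show "0 \<le> (\<Sum>i\<in>{1..n}. \<Sum>j\<in>{1..n}. H i j * x i * x j)"
      using psd_nonneg[OF Suc.prems, of y] by (simp only:)
  qed
  then obtain b where b: "\<And>i j. i \<in> {1..n} \<Longrightarrow> j \<in> {1..n} \<Longrightarrow> H i j = ip n (b i) (b j)"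
    using Suc.IH by blast
  define d where "d = (\<lambda>i l. if l = Suc n then c i / sqrt g else if i = Suc n then 0 else b i l)"
  have d_old: "ip n (d i) (d j) = (if i = Suc n \<or> j = Suc n then 0 else ip n (b i) (b j))" for i j
    by (simp add: ip_def d_def)
  have d_ip: "ip (Suc n) (d i) (d j) = ip n (d i) (d j) + c i * c j / g" for i j
  proof -
    have "(c i / sqrt g) * (c j / sqrt g) = c i * c j / g"
      using g0 by (simp add: real_sqrt_mult[symmetric])
    then show ?thesis by (simp add: ip_def d_def)
  qed
  have "G i j = ip (Suc n) (d i) (d j)" if ij: "i \<in> {1..Suc n}" "j \<in> {1..Suc n}" for i j
  proof (cases "i = Suc n \<or> j = Suc n")
    case True
    have "G i j = c i * c j / g"
    proof (cases "g = 0")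
      case g: True
      then show ?thesis using True c0[OF g] ij sym[of "Suc n" j] by (auto simp: c_def)
    next
      case g: False
      then show ?thesis using True ij sym[of "Suc n" j] by (auto simp: c_def g_def)
    qed
    then show ?thesis using True by (simp add: d_ip d_old)
  next
    case False
    then have "G i j = H i j + c i * c j / g" "i \<in> {1..n}" "j \<in> {1..n}"
      using ij by (auto simp: H_def)
    then show ?thesis using False b by (simp add: d_ip d_old)
  qed
  then show ?case by blast
qed

section \<open>Grothendieck's inequality\<close>

text \<open>A Rademacher sum, the signs being encoded by the set \<open>S\<close> of positive ones;
  \<open>sign_avg\<close> is the expectation over uniform signs. These finite averages replace the
  Gaussian variables customary in Grothendieck's inequality.\<close>

definition signed_sum :: "nat \<Rightarrow> (nat \<Rightarrow> real) \<Rightarrow> nat set \<Rightarrow> real" where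
  "signed_sum n b S = (\<Sum>l\<in>{1..n}. b l * (if l \<in> S then 1 else - 1))"

definition sign_avg :: "nat \<Rightarrow> (nat set \<Rightarrow> real) \<Rightarrow> real" where
  "sign_avg n F = (\<Sum>S\<in>Pow {1..n}. F S) / 2 ^ n"

lemma sign_avg_Suc:
  "sign_avg (Suc n) F = (sign_avg n F + sign_avg n (\<lambda>S. F (insert (Suc n) S))) / 2"
proof -
  have iv: "{1..Suc n} = insert (Suc n) {1..n}" by auto
  have "inj_on (insert (Suc n)) (Pow {1..n})"
  proof (rule inj_onI)
    fix S T assume "S \<in> Pow {1..n}" "T \<in> Pow {1..n}"
    then have "Suc n \<notin> S" "Suc n \<notin> T" by auto
    then show "insert (Suc n) S = insert (Suc n) T \<Longrightarrow> S = T" by (simp add: insert_ident)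
  qed
  then have "(\<Sum>S\<in>insert (Suc n) ` Pow {1..n}. F S) = (\<Sum>S\<in>Pow {1..n}. F (insert (Suc n) S))"
    by (simp add: sum.reindex)
  moreover have "(\<Sum>S\<in>Pow {1..Suc n}. F S)
      = (\<Sum>S\<in>Pow {1..n}. F S) + (\<Sum>S\<in>insert (Suc n) ` Pow {1..n}. F S)"
    unfolding iv Pow_insert by (rule sum.union_disjoint) auto
  ultimately show ?thesis by (simp add: sign_avg_def field_simps)
qed

lemma sign_avg_cong: "(\<And>S. S \<subseteq> {1..n} \<Longrightarrow> F S = F' S) \<Longrightarrow> sign_avg n F = sign_avg n F'"
  unfolding sign_avg_def by (intro arg_cong2[where f = "(/)"] sum.cong) auto

lemma sign_avg_mono: "(\<And>S. F S \<le> F' S) \<Longrightarrow> sign_avg n F \<le> sign_avg n F'"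
  unfolding sign_avg_def by (intro divide_right_mono sum_mono) auto

lemma sign_avg_add: "sign_avg n (\<lambda>S. F S + F' S) = sign_avg n F + sign_avg n F'"
  by (simp add: sign_avg_def sum.distrib add_divide_distrib)

lemma sign_avg_cmult: "sign_avg n (\<lambda>S. c * F S) = c * sign_avg n F"
  by (simp add: sign_avg_def sum_distrib_left)

lemma sign_avg_const: "sign_avg n (\<lambda>S. c) = c"
  by (simp add: sign_avg_def card_Pow)

lemma sign_avg_sum: "finite I \<Longrightarrow> sign_avg n (\<lambda>S. \<Sum>i\<in>I. F i S) = (\<Sum>i\<in>I. sign_avg n (F i))"
  by (simp add: sign_avg_def sum_divide_distrib sum.swap[of _ I])

lemma signed_sum_Suc:
  assumes "S \<subseteq> {1..n}"
  shows "signed_sum (Suc n) b S = signed_sum n b S - b (Suc n)"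
    and "signed_sum (Suc n) b (insert (Suc n) S) = signed_sum n b S + b (Suc n)"
proof -
  have "Suc n \<notin> S" using assms by auto
  then show "signed_sum (Suc n) b S = signed_sum n b S - b (Suc n)"
    by (simp add: signed_sum_def)
  have "(\<Sum>l\<in>{1..n}. b l * (if l \<in> insert (Suc n) S then 1 else - 1))
      = (\<Sum>l\<in>{1..n}. b l * (if l \<in> S then 1 else - 1))"
    by (intro sum.cong) auto
  then show "signed_sum (Suc n) b (insert (Suc n) S) = signed_sum n b S + b (Suc n)"
    by (simp add: signed_sum_def)
qed

text \<open>Cross terms with the newest sign cancel. Together with \<open>psd_gram\<close> this
  turns every positive semidefinite matrix into a covariance matrix.\<close>

lemma sign_avg_prod: "sign_avg n (\<lambda>S. signed_sum n b S * signed_sum n c S) = ip n b c"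
proof (induction n)
  case 0
  then show ?case by (simp add: sign_avg_def signed_sum_def ip_def)
next
  case (Suc n)
  let ?X = "signed_sum n b" and ?Y = "signed_sum n c"
  have "sign_avg (Suc n) (\<lambda>S. signed_sum (Suc n) b S * signed_sum (Suc n) c S)
     = (sign_avg n (\<lambda>S. (?X S - b (Suc n)) * (?Y S - c (Suc n)))
      + sign_avg n (\<lambda>S. (?X S + b (Suc n)) * (?Y S + c (Suc n)))) / 2"
    unfolding sign_avg_Suc
    by (intro arg_cong2[where f = "(/)"] arg_cong2[where f = "(+)"] sign_avg_cong refl)
       (simp_all add: signed_sum_Suc)
  also have "\<dots> = sign_avg n (\<lambda>S. 2 * (?X S * ?Y S) + 2 * (b (Suc n) * c (Suc n))) / 2"
    unfolding sign_avg_add[symmetric]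
    by (intro arg_cong2[where f = "(/)"] sign_avg_cong refl) (simp add: algebra_simps)
  also have "\<dots> = ip (Suc n) b c"
    unfolding sign_avg_add sign_avg_cmult sign_avg_const Suc.IH by (simp add: ip_def)
  finally show ?case .
qed

text \<open>Khinchin's inequality for the fourth moment. Averaging over the last sign leaves
  \<open>X ^ 4 + 6 * b\<^sup>2 * X\<^sup>2 + b ^ 4\<close>; weakening the last term to
  \<open>3 * b ^ 4\<close> completes the square.\<close>

lemma sign_avg_pow4: "sign_avg n (\<lambda>S. signed_sum n b S ^ 4) \<le> 3 * (ip n b b)\<^sup>2"
proof (induction n)
  case 0
  then show ?case by (simp add: sign_avg_def signed_sum_def ip_def)
next
  case (Suc n)
  let ?X = "signed_sum n b" and ?b = "b (Suc n)"
  have "sign_avg (Suc n) (\<lambda>S. signed_sum (Suc n) b S ^ 4)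
     = (sign_avg n (\<lambda>S. (?X S - ?b) ^ 4) + sign_avg n (\<lambda>S. (?X S + ?b) ^ 4)) / 2"
    unfolding sign_avg_Suc
    by (intro arg_cong2[where f = "(/)"] arg_cong2[where f = "(+)"] sign_avg_cong refl)
       (simp_all add: signed_sum_Suc)
  also have "\<dots> = sign_avg n (\<lambda>S. 2 * ?X S ^ 4 + ((12 * ?b\<^sup>2) * (?X S * ?X S) + 2 * ?b ^ 4)) / 2"
    unfolding sign_avg_add[symmetric]
    by (intro arg_cong2[where f = "(/)"] sign_avg_cong refl)
       (simp add: algebra_simps power4_eq_xxxx power2_eq_square)
  also have "\<dots> = sign_avg n (\<lambda>S. ?X S ^ 4) + 6 * ?b\<^sup>2 * ip n b b + ?b ^ 4"
    unfolding sign_avg_add sign_avg_cmult sign_avg_const sign_avg_prod by simp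
  also have "\<dots> \<le> 3 * (ip n b b)\<^sup>2 + 6 * ?b\<^sup>2 * ip n b b + 3 * ?b ^ 4"
  proof -
    have "0 \<le> ?b ^ 4" by simp
    then show ?thesis using Suc.IH by linarith
  qed
  also have "\<dots> = 3 * (ip (Suc n) b b)\<^sup>2"
    by (simp add: ip_def algebra_simps power4_eq_xxxx power2_eq_square)
  finally show ?case .
qed

lemma psd_sign_avg: "psd n (\<lambda>i j. sign_avg m (\<lambda>S. F S i * F S j))"
proof -
  have "(\<Sum>i\<in>{1..n}. \<Sum>j\<in>{1..n}. sign_avg m (\<lambda>S. F S i * F S j) * x i * x j)
      = sign_avg m (\<lambda>S. (\<Sum>i\<in>{1..n}. F S i * x i)\<^sup>2)" for x
  proof -
    have "(\<Sum>i\<in>{1..n}. \<Sum>j\<in>{1..n}. sign_avg m (\<lambda>S. F S i * F S j) * x i * x j)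
      = (\<Sum>i\<in>{1..n}. \<Sum>j\<in>{1..n}. sign_avg m (\<lambda>S. (x i * x j) * (F S i * F S j)))"
      by (simp add: sign_avg_cmult mult_ac)
    also have "\<dots> = sign_avg m (\<lambda>S. \<Sum>i\<in>{1..n}. \<Sum>j\<in>{1..n}. (x i * x j) * (F S i * F S j))"
      by (simp add: sign_avg_sum)
    also have "\<dots> = sign_avg m (\<lambda>S. (\<Sum>i\<in>{1..n}. F S i * x i)\<^sup>2)"
      by (intro sign_avg_cong) (simp add: power2_eq_square sum_product mult_ac)
    finally show ?thesis .
  qed
  moreover have "0 \<le> sign_avg m (\<lambda>S. (\<Sum>i\<in>{1..n}. F S i * x i)\<^sup>2)" for x
    by (simp add: sign_avg_def sum_nonneg)
  ultimately show ?thesis by (simp add: psd_def mult.commute)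
qed

text \<open>Grothendieck's inequality, by the truncation argument: if \<open>\<kappa>\<close> is the optimal bound, then
  writing \<open>G\<close> as the covariance of Rademacher sums \<open>X\<close> and clipping them, \<open>X = Y + R\<close>, the clipped
  part contributes \<open>16 C\<close>, while everything involving the remainder \<open>R\<close>, small in mean square by the
  fourth moment bound, contributes at most \<open>33/64 * \<kappa>\<close>.\<close>
lemma grothendieck:
  fixes M :: "nat \<Rightarrow> nat \<Rightarrow> real"
  assumes p: "\<And>i. i \<in> {1..n} \<Longrightarrow> 0 \<le> p i"
    and C: "\<And>y. (\<And>i. i \<in> {1..n} \<Longrightarrow> \<bar>y i\<bar> \<le> p i) \<Longrightarrow>
              \<bar>\<Sum>i\<in>{1..n}. \<Sum>j\<in>{1..n}. M i j * (y i * y j)\<bar> \<le> C"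
    and G: "psd n G" "\<And>i. i \<in> {1..n} \<Longrightarrow> G i i \<le> (p i)\<^sup>2"
  shows "\<bar>\<Sum>i\<in>{1..n}. \<Sum>j\<in>{1..n}. M i j * G i j\<bar> \<le> 34 * C"
proof -
  define Q where "Q = (\<lambda>G. \<Sum>i\<in>{1..n}. \<Sum>j\<in>{1..n}. M i j * G i j)"
  define K where "K = {\<bar>Q G\<bar> | G. psd n G \<and> (\<forall>i\<in>{1..n}. G i i \<le> (p i)\<^sup>2)}"
  define \<kappa> where "\<kappa> = Sup K"
  have Q_add: "Q (\<lambda>i j. A i j + B i j) = Q A + Q B" for A B
    by (simp add: Q_def sum.distrib algebra_simps)
  have Q_cmult: "Q (\<lambda>i j. c * A i j) = c * Q A" for c A
    by (simp add: Q_def sum_distrib_left mult_ac)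
  have Q_avg: "Q (\<lambda>i j. sign_avg n (\<lambda>S. F S i j)) = sign_avg n (\<lambda>S. Q (F S))" for F
    by (simp add: Q_def sign_avg_sum sign_avg_cmult)
  \<comment> \<open>Finiteness of the supremum is what later allows \<open>\<kappa>\<close> to be
    absorbed into the left-hand side.\<close>
  have "bdd_above K"
  proof (rule bdd_aboveI)
    fix q assume "q \<in> K"
    then obtain H where H: "psd n H" "\<And>i. i \<in> {1..n} \<Longrightarrow> H i i \<le> (p i)\<^sup>2" and q: "q = \<bar>Q H\<bar>"
      by (auto simp: K_def)
    have "\<bar>H i j\<bar> \<le> p i * p j" if "i \<in> {1..n}" "j \<in> {1..n}" for i j
    proof -
      have "(H i j)\<^sup>2 \<le> H i i * H j j" using psd_entry_sq_le[OF H(1)] that by auto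
      also have "\<dots> \<le> (p i)\<^sup>2 * (p j)\<^sup>2"
        using H that psd_diag[OF H(1)] by (intro mult_mono) auto
      finally have "(H i j)\<^sup>2 \<le> (p i * p j)\<^sup>2" by (simp add: power_mult_distrib)
      then have "\<bar>H i j\<bar> \<le> \<bar>p i * p j\<bar>" by (simp only: abs_le_square_iff)
      moreover have "0 \<le> p i * p j" using p that by simp
      ultimately show ?thesis by linarith
    qed
    then show "q \<le> (\<Sum>i\<in>{1..n}. \<Sum>j\<in>{1..n}. \<bar>M i j\<bar> * (p i * p j))"
      unfolding q Q_def
      by (intro order.trans[OF sum_abs] sum_mono) (auto simp: abs_mult intro!: mult_left_mono)
  qed
  have in_K: "\<bar>Q H\<bar> \<le> \<kappa>" if "psd n H" "\<And>i. i \<in> {1..n} \<Longrightarrow> H i i \<le> (p i)\<^sup>2" for H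
    unfolding \<kappa>_def by (rule cSup_upper[OF _ \<open>bdd_above K\<close>]) (use that in \<open>unfold K_def, blast\<close>)
  have scaled: "\<bar>Q (\<lambda>i j. sign_avg n (\<lambda>S. F S i * F S j))\<bar> \<le> t * \<kappa>"
    if "0 < t" "\<And>i. i \<in> {1..n} \<Longrightarrow> sign_avg n (\<lambda>S. F S i * F S i) \<le> t * (p i)\<^sup>2" for t F
  proof -
    let ?H = "\<lambda>i j. sign_avg n (\<lambda>S. F S i * F S j)"
    have "psd n (\<lambda>i j. (1 / t) * ?H i j)"
    proof -
      have "(\<Sum>i\<in>{1..n}. \<Sum>j\<in>{1..n}. (1 / t) * ?H i j * x i * x j)
          = (1 / t) * (\<Sum>i\<in>{1..n}. \<Sum>j\<in>{1..n}. ?H i j * x i * x j)" for x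
        by (simp only: sum_distrib_left mult.assoc)
      then show ?thesis using psd_sign_avg[of n n F] that(1) by (simp add: psd_def)
    qed
    then have "\<bar>Q (\<lambda>i j. (1 / t) * ?H i j)\<bar> \<le> \<kappa>"
      by (rule in_K) (use that in \<open>auto simp: field_simps\<close>)
    then show ?thesis using that(1) unfolding Q_cmult by (simp add: abs_mult field_simps)
  qed
  have bound: "\<bar>Q H\<bar> \<le> 16 * C + 33 / 64 * \<kappa>"
    if H: "psd n H" "\<And>i. i \<in> {1..n} \<Longrightarrow> H i i \<le> (p i)\<^sup>2" for H
  proof -
    obtain b where b: "\<And>i j. i \<in> {1..n} \<Longrightarrow> j \<in> {1..n} \<Longrightarrow> H i j = ip n (b i) (b j)"
      using psd_gram[OF H(1)] by blast
    define X where "X = (\<lambda>S i. signed_sum n (b i) S)"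
    define Y where "Y = (\<lambda>S i. max (- (4 * p i)) (min (4 * p i) (X S i)))"
    define R where "R = (\<lambda>S i. X S i - Y S i)"
    have XX: "sign_avg n (\<lambda>S. X S i * X S i) \<le> (p i)\<^sup>2" if "i \<in> {1..n}" for i
      using H(2)[OF that] that by (simp add: X_def sign_avg_prod b)
    have RR: "64 * sign_avg n (\<lambda>S. R S i * R S i) \<le> (p i)\<^sup>2" if i: "i \<in> {1..n}" for i
    proof (cases "p i = 0")
      case True
      then have "R S i = X S i" for S by (simp add: R_def Y_def)
      then show ?thesis using XX[OF i] True by simp
    next
      case False
      then have pi: "0 < p i" using p[OF i] by simp
      have "256 * (p i)\<^sup>2 * (R S i * R S i) \<le> X S i ^ 4" for S
      proof -
        \<comment> \<open>The parabola \<open>X\<^sup>2\<close> lies above its tangent at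
          \<open>8 * p i\<close>, which vanishes exactly at the clipping level
          \<open>4 * p i\<close>; hence the remainder is at most
          \<open>X\<^sup>2 / (16 * p i)\<close>.\<close>
        have "0 \<le> (\<bar>X S i\<bar> - 8 * p i)\<^sup>2" by simp
        then have "16 * p i * (\<bar>X S i\<bar> - 4 * p i) \<le> (X S i)\<^sup>2"
          by (simp add: power2_eq_square algebra_simps)
        moreover have "\<bar>R S i\<bar> \<le> max 0 (\<bar>X S i\<bar> - 4 * p i)"
          using pi by (auto simp: R_def Y_def)
        moreover have "16 * p i * \<bar>R S i\<bar> \<le> 16 * p i * max 0 (\<bar>X S i\<bar> - 4 * p i)"
          using pi calculation(2) by (intro mult_left_mono) auto
        ultimately have "16 * p i * \<bar>R S i\<bar> \<le> (X S i)\<^sup>2"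
          by (cases "0 \<le> \<bar>X S i\<bar> - 4 * p i") (auto simp: max_def intro: order.trans)
        then have "(16 * p i * \<bar>R S i\<bar>)\<^sup>2 \<le> ((X S i)\<^sup>2)\<^sup>2"
          using pi by (intro power_mono) auto
        then show ?thesis by (simp add: power_mult_distrib power2_eq_square power4_eq_xxxx mult_ac)
      qed
      from sign_avg_mono[of "\<lambda>S. 256 * (p i)\<^sup>2 * (R S i * R S i)", OF this]
      have "256 * (p i)\<^sup>2 * sign_avg n (\<lambda>S. R S i * R S i) \<le> sign_avg n (\<lambda>S. X S i ^ 4)"
        by (simp only: sign_avg_cmult)
      also have "\<dots> \<le> 3 * (H i i)\<^sup>2"
        using sign_avg_pow4[of n "b i"] b[OF i i] by (simp add: X_def)
      also have "\<dots> \<le> 3 * ((p i)\<^sup>2)\<^sup>2"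
        using H(2)[OF i] psd_diag[OF H(1) i] by (intro mult_left_mono power_mono) auto
      also have "\<dots> = (p i)\<^sup>2 * (3 * (p i)\<^sup>2)"
        by (simp add: power2_eq_square)
      finally have "(p i)\<^sup>2 * (256 * sign_avg n (\<lambda>S. R S i * R S i)) \<le> (p i)\<^sup>2 * (3 * (p i)\<^sup>2)"
        by (simp add: mult_ac)
      then have "256 * sign_avg n (\<lambda>S. R S i * R S i) \<le> 3 * (p i)\<^sup>2"
        using pi by simp
      moreover have "0 \<le> (p i)\<^sup>2" by simp
      ultimately show ?thesis by linarith
    qed
    \<comment> \<open>\<open>R\<close> has root mean square at most \<open>p i / 8\<close>, so the
      factor 8 (or -8) balances it against \<open>X\<close>:
      \<open>2 + 2 * 64 / 64 = 4\<close>.\<close>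
    have mixed: "sign_avg n (\<lambda>S. (X S i + c * R S i) * (X S i + c * R S i)) \<le> 4 * (p i)\<^sup>2"
      if i: "i \<in> {1..n}" and c: "c\<^sup>2 = 64" for i c
    proof -
      have "(X S i + c * R S i) * (X S i + c * R S i) \<le> 2 * (X S i * X S i) + 2 * 64 * (R S i * R S i)" for S
      proof -
        have "0 \<le> (X S i - c * R S i)\<^sup>2" by simp
        then have "(X S i + c * R S i)\<^sup>2 \<le> 2 * (X S i)\<^sup>2 + 2 * (c * R S i)\<^sup>2"
          by (simp add: power2_eq_square algebra_simps)
        then show ?thesis unfolding power_mult_distrib c by (simp add: power2_eq_square)
      qed
      from sign_avg_mono[OF this]
      have "sign_avg n (\<lambda>S. (X S i + c * R S i) * (X S i + c * R S i))
          \<le> 2 * sign_avg n (\<lambda>S. X S i * X S i) + 2 * 64 * sign_avg n (\<lambda>S. R S i * R S i)"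
        by (simp only: sign_avg_add sign_avg_cmult)
      then show ?thesis using XX[OF i] RR[OF i] by linarith
    qed
    let ?A = "\<lambda>F. Q (\<lambda>i j. sign_avg n (\<lambda>S. F S i * F S j))"
    \<comment> \<open>Substituting \<open>Y = X - R\<close> leaves the mixed terms
      \<open>X R' + R X'\<close>, which are not a covariance; polarisation writes them as a
      difference of two covariances, divided by \<open>2 * 8\<close>.\<close>
    have "H i j = sign_avg n (\<lambda>S. Y S i * Y S j) + ((1 / 16) * sign_avg n (\<lambda>S. (X S i + 8 * R S i) * (X S j + 8 * R S j))
      + ((- 1 / 16) * sign_avg n (\<lambda>S. (X S i + - 8 * R S i) * (X S j + - 8 * R S j))
      + (- 1) * sign_avg n (\<lambda>S. R S i * R S j)))"
      if ij: "i \<in> {1..n}" "j \<in> {1..n}" for i j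
    proof -
      have "H i j = sign_avg n (\<lambda>S. X S i * X S j)"
        using b[OF ij] by (simp add: X_def sign_avg_prod)
      also have "\<dots> = sign_avg n (\<lambda>S. Y S i * Y S j + ((1 / 16) * ((X S i + 8 * R S i) * (X S j + 8 * R S j))
      + ((- 1 / 16) * ((X S i + - 8 * R S i) * (X S j + - 8 * R S j))
      + (- 1) * (R S i * R S j))))"
        by (intro sign_avg_cong) (simp add: R_def algebra_simps)
      finally show ?thesis by (simp only: sign_avg_add sign_avg_cmult)
    qed
    then have "Q H = Q (\<lambda>i j. sign_avg n (\<lambda>S. Y S i * Y S j) + ((1 / 16) * sign_avg n (\<lambda>S. (X S i + 8 * R S i) * (X S j + 8 * R S j))
      + ((- 1 / 16) * sign_avg n (\<lambda>S. (X S i + - 8 * R S i) * (X S j + - 8 * R S j))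
      + (- 1) * sign_avg n (\<lambda>S. R S i * R S j))))"
      unfolding Q_def by (intro sum.cong refl) (simp only:)
    then have Q_eq: "Q H = ?A Y + ((1 / 16) * ?A (\<lambda>S i. X S i + 8 * R S i)
       + ((- 1 / 16) * ?A (\<lambda>S i. X S i + - 8 * R S i) + (- 1) * ?A R))"
      by (simp only: Q_add Q_cmult)
    have "\<bar>?A (\<lambda>S i. X S i + 8 * R S i)\<bar> \<le> 4 * \<kappa>"
      by (rule scaled) (use mixed[where c = 8] in auto)
    moreover have "\<bar>?A (\<lambda>S i. X S i + - 8 * R S i)\<bar> \<le> 4 * \<kappa>"
      by (rule scaled) (use mixed[where c = "- 8"] in auto)
    moreover have "\<bar>?A R\<bar> \<le> 1 / 64 * \<kappa>"
    proof (rule scaled)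
      fix i assume "i \<in> {1..n}"
      from RR[OF this] show "sign_avg n (\<lambda>S. R S i * R S i) \<le> 1 / 64 * (p i)\<^sup>2" by simp
    qed simp
    moreover have "\<bar>?A Y\<bar> \<le> 16 * C"
    proof -
      have "\<bar>Q (\<lambda>i j. Y S i * Y S j)\<bar> \<le> 16 * C" for S
      proof -
        \<comment> \<open>For each fixed choice of signs \<open>Y / 4\<close> is an admissible
          scalar vector.\<close>
        have "\<bar>Q (\<lambda>i j. (Y S i / 4) * (Y S j / 4))\<bar> \<le> C"
          unfolding Q_def
        proof (rule C)
          fix i assume "i \<in> {1..n}"
          with p[OF this] show "\<bar>Y S i / 4\<bar> \<le> p i" by (auto simp: Y_def max_def min_def)
        qed
        moreover have "Q (\<lambda>i j. (Y S i / 4) * (Y S j / 4)) = (1 / 16) * Q (\<lambda>i j. Y S i * Y S j)"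
          unfolding Q_cmult[symmetric] by (simp add: Q_def)
        ultimately show ?thesis by (simp add: abs_mult)
      qed
      then have "- (16 * C) \<le> Q (\<lambda>i j. Y S i * Y S j)" "Q (\<lambda>i j. Y S i * Y S j) \<le> 16 * C" for S
        unfolding abs_le_iff by (simp_all add: minus_le_iff)
      then have "sign_avg n (\<lambda>S. - (16 * C)) \<le> sign_avg n (\<lambda>S. Q (\<lambda>i j. Y S i * Y S j))"
          "sign_avg n (\<lambda>S. Q (\<lambda>i j. Y S i * Y S j)) \<le> sign_avg n (\<lambda>S. 16 * C)"
        by (auto intro!: sign_avg_mono)
      then show ?thesis unfolding Q_avg sign_avg_const by linarith
    qed
    ultimately show ?thesis unfolding Q_eq by linarith
  qed
  have "K \<noteq> {}" unfolding K_def using G by blast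
  moreover have "q \<le> 16 * C + 33 / 64 * \<kappa>" if "q \<in> K" for q
  proof -
    obtain H where "psd n H" "\<forall>i\<in>{1..n}. H i i \<le> (p i)\<^sup>2" "q = \<bar>Q H\<bar>"
      using \<open>q \<in> K\<close> unfolding K_def by blast
    then show ?thesis using bound[of H] by blast
  qed
  \<comment> \<open>The coefficient is \<open>4 / 16 + 4 / 16 + 1 / 64\<close>. Solving gives
    \<open>\<kappa> \<le> 1024 / 31 * C\<close>, rounded up to 34.\<close>
  ultimately have "\<kappa> \<le> 16 * C + 33 / 64 * \<kappa>"
    unfolding \<kappa>_def by (rule cSup_least)
  moreover have "\<bar>Q G\<bar> \<le> \<kappa>" by (rule in_K) (fact G)+
  moreover have "0 \<le> C" using C[of "\<lambda>_. 0"] p by auto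
  ultimately show ?thesis unfolding Q_def by linarith
qed

section \<open>Sums over pairs of edges\<close>

text \<open>The indices stand for two oriented edges \<open>ij\<close>, \<open>kl\<close>, to be
  switched to \<open>il\<close>, \<open>jk\<close>; \<open>il\<close> is the outer pair and
  \<open>jk\<close> the inner one.\<close>

definition sum4 :: "nat \<Rightarrow> (nat \<Rightarrow> nat \<Rightarrow> nat \<Rightarrow> nat \<Rightarrow> real) \<Rightarrow> real" where
  "sum4 n F = (\<Sum>i\<in>{1..n}. \<Sum>j\<in>{1..n}. \<Sum>k\<in>{1..n}. \<Sum>l\<in>{1..n}. F i j k l)"

lemma sum4_swap12: "sum4 n F = sum4 n (\<lambda>i j k l. F j i k l)"
  unfolding sum4_def by (rule sum.swap)

lemma sum4_swap23: "sum4 n F = sum4 n (\<lambda>i j k l. F i k j l)"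
  unfolding sum4_def by (intro sum.cong refl sum.swap)

lemma sum4_swap34: "sum4 n F = sum4 n (\<lambda>i j k l. F i j l k)"
  unfolding sum4_def by (intro sum.cong refl sum.swap)

lemma sum4_mono:
  "(\<And>i j k l. i \<in> {1..n} \<Longrightarrow> j \<in> {1..n} \<Longrightarrow> k \<in> {1..n} \<Longrightarrow> l \<in> {1..n} \<Longrightarrow> F i j k l \<le> G i j k l)
    \<Longrightarrow> sum4 n F \<le> sum4 n G"
  unfolding sum4_def by (intro sum_mono)

lemma sum4_add: "sum4 n (\<lambda>i j k l. F i j k l + G i j k l) = sum4 n F + sum4 n G"
  by (simp add: sum4_def sum.distrib)

lemma sum4_diff: "sum4 n (\<lambda>i j k l. F i j k l - G i j k l) = sum4 n F - sum4 n G"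
  by (simp add: sum4_def sum_subtractf)

lemma sum4_cmult: "sum4 n (\<lambda>i j k l. c * F i j k l) = c * sum4 n F"
  by (simp add: sum4_def sum_distrib_left)

locale regular_matrix =
  fixes n :: nat and r :: real and a :: "nat \<Rightarrow> nat \<Rightarrow> real"
  assumes a_sym: "i \<in> {1..n} \<Longrightarrow> j \<in> {1..n} \<Longrightarrow> a i j = a j i"
    and a_cases: "i \<in> {1..n} \<Longrightarrow> j \<in> {1..n} \<Longrightarrow> a i j = 0 \<or> a i j = 1 \<and> i \<noteq> j"
    and row_sum: "i \<in> {1..n} \<Longrightarrow> (\<Sum>j\<in>{1..n}. a i j) = r"
    and r_ge_1: "1 \<le> r"
begin

text \<open>Closed neighbourhoods record both obstructions to a new edge: it would be a loop, or it
  is present already.\<close>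

definition closed where "closed i j = a i j + of_bool (i = j)"

definition valid where "valid i j k l = a i j * a k l * (1 - closed i l) * (1 - closed j k)"

definition quad where "quad x = (\<Sum>i\<in>{1..n}. \<Sum>j\<in>{1..n}. a i j * (x i * x j))"

lemma col_sum: "j \<in> {1..n} \<Longrightarrow> (\<Sum>i\<in>{1..n}. a i j) = r"
  using row_sum[of j] a_sym[of j] by (metis (no_types, lifting) sum.cong)

lemma closed_sym: "i \<in> {1..n} \<Longrightarrow> j \<in> {1..n} \<Longrightarrow> closed i j = closed j i"
  using a_sym[of i j] by (auto simp: closed_def)

lemma closed_row_sum:
  assumes "i \<in> {1..n}" shows "(\<Sum>j\<in>{1..n}. closed i j) = r + 1"
proof -
  have "(\<Sum>j\<in>{1..n}. closed i j) = (\<Sum>j\<in>{1..n}. a i j) + (\<Sum>j\<in>{1..n}. if i = j then 1 else 0)"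
    unfolding closed_def sum.distrib[symmetric] by (intro sum.cong) auto
  then show ?thesis using assms row_sum by simp
qed

lemma closed_col_sum: "j \<in> {1..n} \<Longrightarrow> (\<Sum>i\<in>{1..n}. closed i j) = r + 1"
  using closed_row_sum[of j] closed_sym[of j] by (metis (no_types, lifting) sum.cong)

lemma a_bounds: "i \<in> {1..n} \<Longrightarrow> j \<in> {1..n} \<Longrightarrow> 0 \<le> a i j \<and> a i j \<le> 1"
  using a_cases by fastforce

lemma closed_bounds: "i \<in> {1..n} \<Longrightarrow> j \<in> {1..n} \<Longrightarrow> 0 \<le> closed i j \<and> closed i j \<le> 1"
  using a_cases[of i j] by (auto simp: closed_def)

text \<open>The third bound is Bonferroni's \<open>(1 - p) * (1 - q) \<ge> 1 - p - q\<close>. It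
  replaces the switchability condition by correction terms whose sums can be evaluated
  exactly.\<close>

lemma valid_bounds:
  assumes "i \<in> {1..n}" "j \<in> {1..n}" "k \<in> {1..n}" "l \<in> {1..n}"
  shows "0 \<le> valid i j k l" "valid i j k l \<le> a i j * a k l"
    "a i j * a k l * (1 - closed i l - closed j k) \<le> valid i j k l"
proof -
  have b: "0 \<le> a i j * a k l" using assms a_bounds by simp
  have c: "0 \<le> 1 - closed i l" "0 \<le> 1 - closed j k" "1 - closed i l \<le> 1" "1 - closed j k \<le> 1"
    using assms closed_bounds[of i l] closed_bounds[of j k] by auto
  show "0 \<le> valid i j k l" unfolding valid_def using b c by simp
  have "(1 - closed i l) * (1 - closed j k) \<le> 1" using c mult_le_one by blast
  then have "a i j * a k l * ((1 - closed i l) * (1 - closed j k)) \<le> a i j * a k l * 1"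
    using b by (intro mult_left_mono)
  then show "valid i j k l \<le> a i j * a k l" by (simp add: valid_def mult.assoc)
  have "0 \<le> closed i l * closed j k" using assms closed_bounds by simp
  then have "1 - closed i l - closed j k \<le> (1 - closed i l) * (1 - closed j k)"
    by (simp add: algebra_simps)
  then have "a i j * a k l * (1 - closed i l - closed j k) \<le> a i j * a k l * ((1 - closed i l) * (1 - closed j k))"
    using b by (intro mult_left_mono)
  then show "a i j * a k l * (1 - closed i l - closed j k) \<le> valid i j k l"
    by (simp add: valid_def mult.assoc)
qed

section \<open>Exact evaluations from constant row sums\<close>

lemma sum4_outer: "sum4 n (\<lambda>i j k l. a i j * a k l * \<phi> i l) = r\<^sup>2 * (\<Sum>i\<in>{1..n}. \<Sum>l\<in>{1..n}. \<phi> i l)"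
proof -
  have "sum4 n (\<lambda>i j k l. a i j * a k l * \<phi> i l)
      = (\<Sum>i\<in>{1..n}. \<Sum>j\<in>{1..n}. a i j * (\<Sum>k\<in>{1..n}. \<Sum>l\<in>{1..n}. a k l * \<phi> i l))"
    by (simp add: sum4_def sum_distrib_left mult.assoc)
  also have "\<dots> = (\<Sum>i\<in>{1..n}. r * (\<Sum>k\<in>{1..n}. \<Sum>l\<in>{1..n}. a k l * \<phi> i l))"
    by (intro sum.cong refl) (simp add: sum_distrib_right[symmetric] row_sum del: One_nat_def)
  also have "\<dots> = (\<Sum>i\<in>{1..n}. r * (\<Sum>l\<in>{1..n}. r * \<phi> i l))"
  proof -
    have "(\<Sum>k\<in>{1..n}. \<Sum>l\<in>{1..n}. a k l * \<phi> i l) = (\<Sum>l\<in>{1..n}. r * \<phi> i l)" for i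
    proof -
    have "(\<Sum>k\<in>{1..n}. \<Sum>l\<in>{1..n}. a k l * \<phi> i l) = (\<Sum>l\<in>{1..n}. \<Sum>k\<in>{1..n}. a k l * \<phi> i l)"
      by (rule sum.swap)
    also have "\<dots> = (\<Sum>l\<in>{1..n}. r * \<phi> i l)"
      by (intro sum.cong refl) (simp add: sum_distrib_right[symmetric] col_sum del: One_nat_def)
    finally show ?thesis .
    qed
    then show ?thesis by simp
  qed
  finally show ?thesis by (simp add: sum_distrib_left power2_eq_square mult.assoc)
qed

lemma sum4_inner: "sum4 n (\<lambda>i j k l. a i j * a k l * \<phi> j k) = r\<^sup>2 * (\<Sum>j\<in>{1..n}. \<Sum>k\<in>{1..n}. \<phi> j k)"
proof -
  have "sum4 n (\<lambda>i j k l. a i j * a k l * \<phi> j k) = sum4 n (\<lambda>j i l k. a i j * a k l * \<phi> j k)"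
    by (rule trans[OF sum4_swap12 sum4_swap34])
  also have "\<dots> = sum4 n (\<lambda>j i l k. a j i * a l k * \<phi> j k)"
    unfolding sum4_def by (intro sum.cong refl) (simp add: a_sym)
  finally show ?thesis by (simp add: sum4_outer)
qed

lemma sum4_edge: "sum4 n (\<lambda>i j k l. a i j * a k l * \<phi> i j) = r * real n * (\<Sum>i\<in>{1..n}. \<Sum>j\<in>{1..n}. a i j * \<phi> i j)"
proof -
  have "sum4 n (\<lambda>i j k l. a i j * a k l * \<phi> i j)
      = (\<Sum>i\<in>{1..n}. \<Sum>j\<in>{1..n}. (a i j * \<phi> i j) * (\<Sum>k\<in>{1..n}. \<Sum>l\<in>{1..n}. a k l))"
    by (simp add: sum4_def sum_distrib_left mult_ac)
  also have "\<dots> = (\<Sum>i\<in>{1..n}. \<Sum>j\<in>{1..n}. (a i j * \<phi> i j) * (r * real n))"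
    by (simp add: row_sum mult.commute del: One_nat_def)
  finally show ?thesis by (simp add: sum_distrib_left mult_ac)
qed

text \<open>For a given edge \<open>ij\<close> there are \<open>r + 1\<close> choices of
  \<open>l\<close> in the closed neighbourhood of \<open>i\<close>, then \<open>r\<close> choices of
  \<open>k\<close> next to \<open>l\<close>.\<close>

lemma sum4_edge_closed1:
  "sum4 n (\<lambda>i j k l. a i j * a k l * (\<phi> i j * closed i l))
     = r * (r + 1) * (\<Sum>i\<in>{1..n}. \<Sum>j\<in>{1..n}. a i j * \<phi> i j)"
proof -
  have "sum4 n (\<lambda>i j k l. a i j * a k l * (\<phi> i j * closed i l))
      = sum4 n (\<lambda>i j l k. a i j * a k l * (\<phi> i j * closed i l))"
    by (rule sum4_swap34)
  also have "\<dots> = (\<Sum>i\<in>{1..n}. \<Sum>j\<in>{1..n}. (a i j * \<phi> i j) * (\<Sum>l\<in>{1..n}. closed i l * (\<Sum>k\<in>{1..n}. a k l)))"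
    by (simp add: sum4_def sum_distrib_left mult_ac)
  also have "\<dots> = (\<Sum>i\<in>{1..n}. \<Sum>j\<in>{1..n}. (a i j * \<phi> i j) * (r * (r + 1)))"
  proof -
    have "(\<Sum>l\<in>{1..n}. closed i l * (\<Sum>k\<in>{1..n}. a k l)) = r * (r + 1)" if "i \<in> {1..n}" for i
    proof -
      have "(\<Sum>l\<in>{1..n}. closed i l * (\<Sum>k\<in>{1..n}. a k l)) = (\<Sum>l\<in>{1..n}. closed i l * r)"
        by (intro sum.cong refl) (simp only: col_sum)
      also have "\<dots> = (r + 1) * r"
        using closed_row_sum[OF that] by (simp only: sum_distrib_right[symmetric])
      finally show ?thesis by (simp only: mult.commute)
    qed
    then show ?thesis by (intro sum.cong refl arg_cong2[where f = "(*)"]) auto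
  qed
  finally show ?thesis by (simp add: sum_distrib_left mult_ac)
qed

lemma sum4_edge_closed2:
  "sum4 n (\<lambda>i j k l. a i j * a k l * (\<phi> i j * closed j k))
     = r * (r + 1) * (\<Sum>i\<in>{1..n}. \<Sum>j\<in>{1..n}. a i j * \<phi> i j)"
proof -
  have "sum4 n (\<lambda>i j k l. a i j * a k l * (\<phi> i j * closed j k))
      = (\<Sum>i\<in>{1..n}. \<Sum>j\<in>{1..n}. (a i j * \<phi> i j) * (\<Sum>k\<in>{1..n}. closed j k * (\<Sum>l\<in>{1..n}. a k l)))"
    by (simp add: sum4_def sum_distrib_left mult_ac)
  also have "\<dots> = (\<Sum>i\<in>{1..n}. \<Sum>j\<in>{1..n}. (a i j * \<phi> i j) * (r * (r + 1)))"
  proof -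
    have "(\<Sum>k\<in>{1..n}. closed j k * (\<Sum>l\<in>{1..n}. a k l)) = r * (r + 1)" if "j \<in> {1..n}" for j
    proof -
      have "(\<Sum>k\<in>{1..n}. closed j k * (\<Sum>l\<in>{1..n}. a k l)) = (\<Sum>k\<in>{1..n}. closed j k * r)"
        by (intro sum.cong refl) (simp only: row_sum)
      also have "\<dots> = (r + 1) * r"
        using closed_row_sum[OF that] by (simp only: sum_distrib_right[symmetric])
      finally show ?thesis by (simp only: mult.commute)
    qed
    then show ?thesis by (intro sum.cong refl arg_cong2[where f = "(*)"]) auto
  qed
  finally show ?thesis by (simp add: sum_distrib_left mult_ac)
qed

lemma sum4_path: "sum4 n (\<lambda>i j k l. a i j * a k l * (\<phi> i * closed j k)) = r\<^sup>2 * (r + 1) * (\<Sum>i\<in>{1..n}. \<phi> i)"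
proof -
  have "sum4 n (\<lambda>i j k l. a i j * a k l * (\<phi> i * closed j k))
      = r * (r + 1) * (\<Sum>i\<in>{1..n}. \<Sum>j\<in>{1..n}. a i j * \<phi> i)"
    by (rule sum4_edge_closed2)
  also have "(\<Sum>i\<in>{1..n}. \<Sum>j\<in>{1..n}. a i j * \<phi> i) = r * (\<Sum>i\<in>{1..n}. \<phi> i)"
    by (simp add: sum_distrib_right[symmetric] row_sum sum_distrib_left del: One_nat_def)
  finally show ?thesis by (simp add: power2_eq_square mult_ac)
qed

lemma sum4_path': "sum4 n (\<lambda>i j k l. a i j * a k l * (\<phi> l * closed j k)) = r\<^sup>2 * (r + 1) * (\<Sum>i\<in>{1..n}. \<phi> i)"
proof -
  \<comment> \<open>Six adjacent transpositions compose to the reversal of the four indices, which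
    exchanges the two ends of the path.\<close>
  have "sum4 n (\<lambda>i j k l. a i j * a k l * (\<phi> l * closed j k))
      = sum4 n (\<lambda>l k j i. a i j * a k l * (\<phi> l * closed j k))"
    by (rule trans[OF sum4_swap12 trans[OF sum4_swap23 trans[OF sum4_swap34
        trans[OF sum4_swap12 trans[OF sum4_swap23 sum4_swap12]]]]])
  also have "\<dots> = sum4 n (\<lambda>l k j i. a l k * a j i * (\<phi> l * closed k j))"
    unfolding sum4_def by (intro sum.cong refl) (simp add: a_sym closed_sym mult_ac)
  finally show ?thesis by (simp add: sum4_path)
qed

section \<open>Estimates for nonnegative vertex weights\<close>

context
  fixes x :: "nat \<Rightarrow> real" and S :: real
  assumes x_nonneg: "\<And>i. i \<in> {1..n} \<Longrightarrow> 0 \<le> x i"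
    and S_def: "S = (\<Sum>i\<in>{1..n}. (x i)\<^sup>2)"
begin

lemma am_gm: "x i * x j \<le> ((x i)\<^sup>2 + (x j)\<^sup>2) / 2"
  using sum_squares_bound[of "x i" "x j"] by (simp add: power2_eq_square)

lemma quad_nonneg: "0 \<le> quad x"
  unfolding quad_def using x_nonneg a_bounds by (intro sum_nonneg mult_nonneg_nonneg) auto

text \<open>Of the \<open>r * n\<close> oriented partners \<open>kl\<close> of an edge
  \<open>ij\<close>, at most \<open>2 * r * (r + 1) \<le> 4 * r\<^sup>2\<close> are blocked.\<close>

lemma sum4_valid_edge_ge: "(r * real n - 4 * r\<^sup>2) * quad x \<le> sum4 n (\<lambda>i j k l. valid i j k l * (x i * x j))"
proof -
  have "sum4 n (\<lambda>i j k l. (a i j * a k l * (x i * x j) - a i j * a k l * ((x i * x j) * closed i l))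
         - a i j * a k l * ((x i * x j) * closed j k))
      \<le> sum4 n (\<lambda>i j k l. valid i j k l * (x i * x j))"
  proof (rule sum4_mono)
    fix i j k l assume "i \<in> {1..n}" "j \<in> {1..n}" "k \<in> {1..n}" "l \<in> {1..n}"
    then have "(a i j * a k l * (1 - closed i l - closed j k)) * (x i * x j) \<le> valid i j k l * (x i * x j)"
      using x_nonneg by (intro mult_right_mono valid_bounds) auto
    then show "(a i j * a k l * (x i * x j) - a i j * a k l * ((x i * x j) * closed i l))
         - a i j * a k l * ((x i * x j) * closed j k) \<le> valid i j k l * (x i * x j)"
      by (simp add: algebra_simps)
  qed
  then have "r * real n * quad x - r * (r + 1) * quad x - r * (r + 1) * quad x
      \<le> sum4 n (\<lambda>i j k l. valid i j k l * (x i * x j))"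
    unfolding sum4_diff sum4_edge sum4_edge_closed1 sum4_edge_closed2 quad_def .
  moreover have "2 * (r * (r + 1)) * quad x \<le> 4 * r\<^sup>2 * quad x"
  proof (rule mult_right_mono[OF _ quad_nonneg])
    have "r * (r + 1) \<le> r * (2 * r)" using r_ge_1 by (intro mult_left_mono) auto
    then show "2 * (r * (r + 1)) \<le> 4 * r\<^sup>2" by (simp add: power2_eq_square)
  qed
  ultimately show ?thesis by (simp add: algebra_simps)
qed

lemma sum4_valid_edge_le: "sum4 n (\<lambda>i j k l. valid i j k l * (x i * x j)) \<le> r * real n * quad x"
proof -
  have "sum4 n (\<lambda>i j k l. valid i j k l * (x i * x j)) \<le> sum4 n (\<lambda>i j k l. a i j * a k l * (x i * x j))"
    using x_nonneg by (intro sum4_mono mult_right_mono valid_bounds) auto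
  then show ?thesis unfolding sum4_edge quad_def .
qed

lemma sum_sq_prod: "(\<Sum>i\<in>{1..n}. \<Sum>l\<in>{1..n}. (x i * x l)\<^sup>2) = S\<^sup>2"
  by (simp add: S_def power2_eq_square sum_product mult_ac)

lemma sum_prod: "(\<Sum>i\<in>{1..n}. \<Sum>l\<in>{1..n}. x i * x l) = (\<Sum>i\<in>{1..n}. x i)\<^sup>2"
  by (simp add: power2_eq_square sum_product)

text \<open>Separates the outer from the inner pair, so that \<open>sum4_outer\<close> and
  \<open>sum4_inner\<close> evaluate the resulting sum.\<close>

lemma cross_le: "x i * x l * (x i * x l + x j * x k) \<le> 3 / 2 * (x i * x l)\<^sup>2 + 1 / 2 * (x j * x k)\<^sup>2"
  using sum_squares_bound[of "x i * x l" "x j * x k"] by (simp add: power2_eq_square algebra_simps)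

lemma sum4_cross: "sum4 n (\<lambda>i j k l. a i j * a k l * (3 / 2 * (x i * x l)\<^sup>2 + 1 / 2 * (x j * x k)\<^sup>2)) = 2 * r\<^sup>2 * S\<^sup>2"
proof -
  have "sum4 n (\<lambda>i j k l. a i j * a k l * (3 / 2 * (x i * x l)\<^sup>2 + 1 / 2 * (x j * x k)\<^sup>2))
     = sum4 n (\<lambda>i j k l. 3 / 2 * (a i j * a k l * (x i * x l)\<^sup>2) + 1 / 2 * (a i j * a k l * (x j * x k)\<^sup>2))"
    by (simp add: algebra_simps)
  also have "\<dots> = 3 / 2 * (r\<^sup>2 * S\<^sup>2) + 1 / 2 * (r\<^sup>2 * S\<^sup>2)"
    unfolding sum4_add sum4_cmult sum4_outer sum4_inner sum_sq_prod ..
  finally show ?thesis by simp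
qed

text \<open>The bound on \<open>\<mu>\<close> keeps the exponent \<open>u\<close> in
  \<open>[0, 1]\<close>, where \<open>exp u \<le> 1 + 2 * u\<close>. The constant term yields the
  square of the sum of weights, the linear term the error in \<open>S\<^sup>2\<close>.\<close>

lemma sum4_valid_exp_le:
  assumes "0 \<le> \<mu>" and u: "\<And>i j. i \<in> {1..n} \<Longrightarrow> j \<in> {1..n} \<Longrightarrow> 4 * \<mu> * (x i * x j) \<le> 1"
  shows "sum4 n (\<lambda>i j k l. valid i j k l * (x i * x l * exp (2 * \<mu> * (x i * x l + x j * x k))))
    \<le> r\<^sup>2 * (\<Sum>i\<in>{1..n}. x i)\<^sup>2 + 8 * \<mu> * r\<^sup>2 * S\<^sup>2"
proof -
  have "sum4 n (\<lambda>i j k l. valid i j k l * (x i * x l * exp (2 * \<mu> * (x i * x l + x j * x k))))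
    \<le> sum4 n (\<lambda>i j k l. a i j * a k l * (x i * x l)
        + 4 * \<mu> * (a i j * a k l * (3 / 2 * (x i * x l)\<^sup>2 + 1 / 2 * (x j * x k)\<^sup>2)))"
  proof (rule sum4_mono)
    fix i j k l assume V: "i \<in> {1..n}" "j \<in> {1..n}" "k \<in> {1..n}" "l \<in> {1..n}"
    let ?u = "2 * \<mu> * (x i * x l + x j * x k)"
    have xx: "0 \<le> x i * x l" "0 \<le> x j * x k" using V x_nonneg by auto
    have u0: "0 \<le> ?u" using assms(1) xx by simp
    have u1: "?u \<le> 1" using u[OF V(1,4)] u[OF V(2,3)] by (simp add: algebra_simps)
    have "exp ?u \<le> 1 + ?u + ?u\<^sup>2" using exp_bound u0 u1 by blast
    also have "?u\<^sup>2 \<le> ?u" using mult_left_le_one_le[OF u0 u0 u1] by (simp add: power2_eq_square)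
    finally have e: "exp ?u \<le> 1 + 2 * ?u" by simp
    have "valid i j k l * (x i * x l * exp ?u) \<le> a i j * a k l * (x i * x l * exp ?u)"
      using V xx by (intro mult_right_mono valid_bounds) auto
    also have "\<dots> \<le> a i j * a k l * (x i * x l * (1 + 2 * ?u))"
      using V xx e a_bounds by (intro mult_left_mono) auto
    also have "\<dots> = a i j * a k l * (x i * x l) + 4 * \<mu> * (a i j * a k l * (x i * x l * (x i * x l + x j * x k)))"
      by (simp add: algebra_simps)
    also have "\<dots> \<le> a i j * a k l * (x i * x l) + 4 * \<mu> * (a i j * a k l * (3 / 2 * (x i * x l)\<^sup>2 + 1 / 2 * (x j * x k)\<^sup>2))"
      using V assms(1) a_bounds by (intro add_left_mono mult_left_mono cross_le) auto
    finally show "valid i j k l * (x i * x l * exp ?u) \<le> a i j * a k l * (x i * x l)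
        + 4 * \<mu> * (a i j * a k l * (3 / 2 * (x i * x l)\<^sup>2 + 1 / 2 * (x j * x k)\<^sup>2))" .
  qed
  also have "\<dots> = r\<^sup>2 * (\<Sum>i\<in>{1..n}. x i)\<^sup>2 + 8 * \<mu> * r\<^sup>2 * S\<^sup>2"
    unfolding sum4_add sum4_cmult sum4_cross sum4_outer sum_prod by simp
  finally show ?thesis .
qed

text \<open>Uses \<open>exp (- u) \<ge> 1 - u\<close>. Each of the two blocking conditions costs at
  most \<open>r\<^sup>2 * (r + 1) * S\<close>, after the weight of a blocked pair is split by the
  arithmetic-geometric mean; together at most \<open>4 * r ^ 3 * S\<close>.\<close>

lemma sum4_valid_exp_ge:
  assumes "0 \<le> \<mu>"
  shows "r\<^sup>2 * (\<Sum>i\<in>{1..n}. x i)\<^sup>2 - 4 * r ^ 3 * S - 4 * \<mu> * r\<^sup>2 * S\<^sup>2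
    \<le> sum4 n (\<lambda>i j k l. valid i j k l * (x i * x l * exp (- (2 * \<mu> * (x i * x l + x j * x k)))))"
proof -
  have S0: "0 \<le> S" by (simp add: S_def sum_nonneg)
  have "r\<^sup>2 * (\<Sum>i\<in>{1..n}. x i)\<^sup>2 - 4 * r ^ 3 * S - 4 * \<mu> * r\<^sup>2 * S\<^sup>2
     \<le> ((r\<^sup>2 * (\<Sum>i\<in>{1..n}. x i)\<^sup>2 - r\<^sup>2 * ((r + 1) * S)) - (1 / 2 * (r\<^sup>2 * (r + 1) * S) + 1 / 2 * (r\<^sup>2 * (r + 1) * S)))
       - 2 * \<mu> * (2 * r\<^sup>2 * S\<^sup>2)"
  proof -
    have "r\<^sup>2 * (r + 1) * S \<le> r\<^sup>2 * (2 * r) * S"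
      using r_ge_1 S0 by (intro mult_left_mono mult_right_mono) auto
    then show ?thesis by (simp add: algebra_simps power3_eq_cube power2_eq_square)
  qed
  also have "\<dots> \<le> ((r\<^sup>2 * (\<Sum>i\<in>{1..n}. x i)\<^sup>2 - r\<^sup>2 * (\<Sum>i\<in>{1..n}. \<Sum>l\<in>{1..n}. (x i * x l) * closed i l))
       - (1 / 2 * (r\<^sup>2 * (r + 1) * S) + 1 / 2 * (r\<^sup>2 * (r + 1) * S))) - 2 * \<mu> * (2 * r\<^sup>2 * S\<^sup>2)"
  proof -
    have "(\<Sum>i\<in>{1..n}. \<Sum>l\<in>{1..n}. (x i * x l) * closed i l)
        \<le> (\<Sum>i\<in>{1..n}. \<Sum>l\<in>{1..n}. (((x i)\<^sup>2 + (x l)\<^sup>2) / 2) * closed i l)"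
      using closed_bounds by (intro sum_mono mult_right_mono am_gm) auto
    also have "\<dots> = (\<Sum>i\<in>{1..n}. \<Sum>l\<in>{1..n}. (x i)\<^sup>2 / 2 * closed i l) + (\<Sum>i\<in>{1..n}. \<Sum>l\<in>{1..n}. (x l)\<^sup>2 / 2 * closed i l)"
      by (simp add: sum.distrib[symmetric] algebra_simps add_divide_distrib)
    also have "(\<Sum>i\<in>{1..n}. \<Sum>l\<in>{1..n}. (x l)\<^sup>2 / 2 * closed i l) = (\<Sum>l\<in>{1..n}. \<Sum>i\<in>{1..n}. (x l)\<^sup>2 / 2 * closed i l)"
      by (rule sum.swap)
    also have "(\<Sum>i\<in>{1..n}. \<Sum>l\<in>{1..n}. (x i)\<^sup>2 / 2 * closed i l) + \<dots> = (r + 1) * S"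
      by (simp add: sum_distrib_left[symmetric] sum_distrib_right[symmetric] sum_divide_distrib[symmetric]
          closed_row_sum closed_col_sum S_def del: One_nat_def)
    finally have "r\<^sup>2 * (\<Sum>i\<in>{1..n}. \<Sum>l\<in>{1..n}. (x i * x l) * closed i l) \<le> r\<^sup>2 * ((r + 1) * S)"
      by (intro mult_left_mono) auto
    then show ?thesis by linarith
  qed
  also have "\<dots> = sum4 n (\<lambda>i j k l. ((a i j * a k l * (x i * x l) - a i j * a k l * ((x i * x l) * closed i l))
       - (1 / 2 * (a i j * a k l * ((x i)\<^sup>2 * closed j k)) + 1 / 2 * (a i j * a k l * ((x l)\<^sup>2 * closed j k))))
       - 2 * \<mu> * (a i j * a k l * (3 / 2 * (x i * x l)\<^sup>2 + 1 / 2 * (x j * x k)\<^sup>2)))"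
    unfolding sum4_diff sum4_add sum4_cmult sum4_cross sum4_outer sum4_path sum4_path' sum_prod S_def ..
  also have "\<dots> \<le> sum4 n (\<lambda>i j k l. valid i j k l * (x i * x l * exp (- (2 * \<mu> * (x i * x l + x j * x k)))))"
  proof (rule sum4_mono)
    fix i j k l assume V: "i \<in> {1..n}" "j \<in> {1..n}" "k \<in> {1..n}" "l \<in> {1..n}"
    let ?u = "2 * \<mu> * (x i * x l + x j * x k)"
    have xx: "0 \<le> x i * x l" "0 \<le> x j * x k" using V x_nonneg by auto
    have aa: "0 \<le> a i j * a k l" using V a_bounds by simp
    have "a i j * a k l * ((x i * x l) * closed j k) \<le> a i j * a k l * ((((x i)\<^sup>2 + (x l)\<^sup>2) / 2) * closed j k)"
      using aa V closed_bounds by (intro mult_left_mono mult_right_mono am_gm) auto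
    then have 1: "a i j * a k l * ((x i * x l) * closed j k)
      \<le> 1 / 2 * (a i j * a k l * ((x i)\<^sup>2 * closed j k)) + 1 / 2 * (a i j * a k l * ((x l)\<^sup>2 * closed j k))"
      by (simp add: algebra_simps add_divide_distrib)
    have "(a i j * a k l * (1 - closed i l - closed j k)) * (x i * x l) \<le> valid i j k l * (x i * x l)"
      using V xx by (intro mult_right_mono valid_bounds) auto
    then have 2: "a i j * a k l * (x i * x l) - a i j * a k l * ((x i * x l) * closed i l)
        - a i j * a k l * ((x i * x l) * closed j k) \<le> valid i j k l * (x i * x l)"
      by (simp add: algebra_simps)
    have "valid i j k l * (x i * x l * ?u) \<le> a i j * a k l * (x i * x l * ?u)"
      using V xx assms by (intro mult_right_mono valid_bounds) auto
    also have "\<dots> = 2 * \<mu> * (a i j * a k l * (x i * x l * (x i * x l + x j * x k)))"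
      by (simp add: algebra_simps)
    also have "\<dots> \<le> 2 * \<mu> * (a i j * a k l * (3 / 2 * (x i * x l)\<^sup>2 + 1 / 2 * (x j * x k)\<^sup>2))"
      using aa assms by (intro mult_left_mono cross_le) auto
    finally have 3: "valid i j k l * (x i * x l * ?u)
        \<le> 2 * \<mu> * (a i j * a k l * (3 / 2 * (x i * x l)\<^sup>2 + 1 / 2 * (x j * x k)\<^sup>2))" .
    have "valid i j k l * (x i * x l * (1 - ?u)) \<le> valid i j k l * (x i * x l * exp (- ?u))"
      using V xx valid_bounds(1)[OF V] exp_ge_add_one_self[of "- ?u"] by (intro mult_left_mono) auto
    then have "valid i j k l * (x i * x l) - valid i j k l * (x i * x l * ?u) \<le> valid i j k l * (x i * x l * exp (- ?u))"
      by (simp only: right_diff_distrib mult_1_right)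
    with 1 2 3 show "((a i j * a k l * (x i * x l) - a i j * a k l * ((x i * x l) * closed i l))
       - (1 / 2 * (a i j * a k l * ((x i)\<^sup>2 * closed j k)) + 1 / 2 * (a i j * a k l * ((x l)\<^sup>2 * closed j k))))
       - 2 * \<mu> * (a i j * a k l * (3 / 2 * (x i * x l)\<^sup>2 + 1 / 2 * (x j * x k)\<^sup>2))
       \<le> valid i j k l * (x i * x l * exp (- ?u))" by linarith
  qed
  finally show ?thesis .
qed

end

end

section \<open>Switchings\<close>

definition adj :: "nat set set \<Rightarrow> nat \<Rightarrow> nat \<Rightarrow> real" where
  "adj E i j = of_bool ({i, j} \<in> E)"

definition edge_sum :: "nat \<Rightarrow> nat set set \<Rightarrow> (nat \<Rightarrow> real) \<Rightarrow> real" where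
  "edge_sum n E x = (\<Sum>i\<in>{1..n}. \<Sum>j\<in>{1..n}. adj E i j * (x i * x j))"

lemma finite_all_pairs: "finite (all_pairs n)"
proof (rule finite_subset)
  show "all_pairs n \<subseteq> Pow {1..n}" by (auto simp: all_pairs_def)
qed simp

lemma pair_in_all_pairs: "{i, j} \<in> all_pairs n \<longleftrightarrow> i \<in> {1..n} \<and> j \<in> {1..n} \<and> i \<noteq> j"
proof
  assume "{i, j} \<in> all_pairs n"
  then obtain a b where "{i, j} = {a, b}" "a \<in> {1..n}" "b \<in> {1..n}" "a \<noteq> b"
    unfolding all_pairs_def mem_Collect_eq by (elim exE conjE)
  then show "i \<in> {1..n} \<and> j \<in> {1..n} \<and> i \<noteq> j"
    unfolding doubleton_eq_iff by (elim disjE conjE) simp_all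
next
  assume "i \<in> {1..n} \<and> j \<in> {1..n} \<and> i \<noteq> j"
  then show "{i, j} \<in> all_pairs n"
    unfolding all_pairs_def mem_Collect_eq by (intro exI[of _ i] exI[of _ j]) simp
qed

lemma finite_reg_graphs: "finite (reg_graphs n r)"
  by (rule finite_subset[of _ "Pow (all_pairs n)"]) (auto simp: reg_graphs_def finite_all_pairs)

lemma reg_graph_edge:
  "E \<in> reg_graphs n r \<Longrightarrow> {i, j} \<in> E \<Longrightarrow> i \<in> {1..n} \<and> j \<in> {1..n} \<and> i \<noteq> j"
  using pair_in_all_pairs[of i j] by (auto simp: reg_graphs_def)

lemma reg_graph_finite: "E \<in> reg_graphs n r \<Longrightarrow> finite E"
  using finite_subset[OF _ finite_all_pairs, of E n] by (simp add: reg_graphs_def)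

lemma degree_eq_row_sum:
  assumes "E \<subseteq> all_pairs n" "i \<in> {1..n}"
  shows "real (card {e \<in> E. i \<in> e}) = (\<Sum>j\<in>{1..n}. adj E i j)"
proof -
  have "bij_betw (\<lambda>j. {i, j}) {j \<in> {1..n}. {i, j} \<in> E} {e \<in> E. i \<in> e}"
  proof (rule bij_betw_imageI)
    show "inj_on (\<lambda>j. {i, j}) {j \<in> {1..n}. {i, j} \<in> E}"
      by (rule inj_onI) (auto simp: doubleton_eq_iff)
    show "(\<lambda>j. {i, j}) ` {j \<in> {1..n}. {i, j} \<in> E} = {e \<in> E. i \<in> e}"
    proof (intro equalityI subsetI)
      fix e assume e: "e \<in> {e \<in> E. i \<in> e}"
      then have "e \<in> all_pairs n" using assms(1) by auto
      then obtain a b where ab: "e = {a, b}" "a \<in> {1..n}" "b \<in> {1..n}"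
        unfolding all_pairs_def mem_Collect_eq by (elim exE conjE)
      obtain j where "e = {i, j}" "j \<in> {1..n}"
      proof (cases "i = a")
        case True
        then show thesis using ab that by simp
      next
        case False
        then have "i = b" using e ab by simp
        then show thesis using ab that[of a] by (simp add: insert_commute)
      qed
      then show "e \<in> (\<lambda>j. {i, j}) ` {j \<in> {1..n}. {i, j} \<in> E}"
        using e by simp
    qed auto
  qed
  then have "card {e \<in> E. i \<in> e} = card {j \<in> {1..n}. {i, j} \<in> E}"
    using bij_betw_same_card by fastforce
  also have "real \<dots> = (\<Sum>j\<in>{1..n}. adj E i j)"
  proof -
    have "real (card {j \<in> {1..n}. {i, j} \<in> E}) = (\<Sum>j\<in>{j \<in> {1..n}. {i, j} \<in> E}. 1)" by simp
    also have "\<dots> = (\<Sum>j\<in>{1..n}. if {i, j} \<in> E then 1 else 0)" by (rule sum.inter_filter) simp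
    also have "\<dots> = (\<Sum>j\<in>{1..n}. adj E i j)" by (intro sum.cong) (auto simp: adj_def)
    finally show ?thesis .
  qed
  finally show ?thesis .
qed

lemma adj_sym: "adj E i j = adj E j i"
  by (simp add: adj_def insert_commute)

lemma regular_matrix_adj:
  assumes "E \<in> reg_graphs n r" "1 \<le> r"
  shows "regular_matrix n (real r) (adj E)"
proof
  fix i j assume "i \<in> {1..n}" "j \<in> {1..n}"
  show "adj E i j = adj E j i" by (rule adj_sym)
  show "adj E i j = 0 \<or> adj E i j = 1 \<and> i \<noteq> j"
    using reg_graph_edge[OF assms(1), of i j] by (auto simp: adj_def)
next
  fix i assume i: "i \<in> {1..n}"
  have "E \<subseteq> all_pairs n" "card {e \<in> E. i \<in> e} = r" using assms(1) i by (auto simp: reg_graphs_def)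
  then show "(\<Sum>j\<in>{1..n}. adj E i j) = real r" using degree_eq_row_sum[OF _ i, of E] by simp
qed (use assms(2) in simp)

lemma sum_pairs_eq_two:
  fixes p q n :: nat
  assumes "p \<in> {1..n}" "q \<in> {1..n}" "p \<noteq> q"
  shows "(\<Sum>i\<in>{1..n}. \<Sum>j\<in>{1..n}. of_bool ({i, j} = {p, q})) = (2::real)"
proof -
  have "(\<Sum>i\<in>{1..n}. \<Sum>j\<in>{1..n}. of_bool ({i, j} = {p, q}) :: real)
      = (\<Sum>i\<in>{1..n}. \<Sum>j\<in>{1..n}. (if i = p then 1 else 0) * (if j = q then 1 else 0)
          + (if i = q then 1 else 0) * (if j = p then 1 else 0))"
    using assms(3) unfolding doubleton_eq_iff by (intro sum.cong refl) auto
  also have "\<dots> = 2"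
    unfolding sum.distrib sum_distrib_left[symmetric] sum_distrib_right[symmetric] using assms by simp
  finally show ?thesis .
qed

text \<open>Every edge comes from two ordered pairs. In this form a switching alters just four
  summands.\<close>

lemma edge_sum_eq:
  assumes "E \<subseteq> all_pairs n"
  shows "edge_sum n E x = 2 * (\<Sum>e\<in>E. \<Prod>v\<in>e. x v)"
proof -
  have fin: "finite E" by (rule finite_subset[OF assms finite_all_pairs])
  have "adj E i j * (x i * x j) = (\<Sum>e\<in>E. of_bool ({i, j} = e) * (\<Prod>v\<in>e. x v))"
    if "i \<in> {1..n}" "j \<in> {1..n}" for i j
  proof (cases "{i, j} \<in> E")
    case True
    then have "i \<noteq> j" using assms pair_in_all_pairs[of i j] by auto
    have "(\<Sum>e\<in>E. of_bool ({i, j} = e) * (\<Prod>v\<in>e. x v)) = (\<Sum>e\<in>{{i, j}}. of_bool ({i, j} = e) * (\<Prod>v\<in>e. x v))"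
      by (rule sum.mono_neutral_right) (use fin True in auto)
    then show ?thesis using True \<open>i \<noteq> j\<close> by (simp add: adj_def)
  next
    case False
    then have "(\<Sum>e\<in>E. of_bool ({i, j} = e) * (\<Prod>v\<in>e. x v)) = 0" by (intro sum.neutral) auto
    then show ?thesis using False by (simp add: adj_def)
  qed
  then have "edge_sum n E x = (\<Sum>i\<in>{1..n}. \<Sum>j\<in>{1..n}. \<Sum>e\<in>E. of_bool ({i, j} = e) * (\<Prod>v\<in>e. x v))"
    unfolding edge_sum_def by (intro sum.cong refl)
  also have "\<dots> = (\<Sum>i\<in>{1..n}. \<Sum>e\<in>E. \<Sum>j\<in>{1..n}. of_bool ({i, j} = e) * (\<Prod>v\<in>e. x v))"
    by (intro sum.cong refl sum.swap)
  also have "\<dots> = (\<Sum>e\<in>E. \<Sum>i\<in>{1..n}. \<Sum>j\<in>{1..n}. of_bool ({i, j} = e) * (\<Prod>v\<in>e. x v))"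
    by (rule sum.swap)
  also have "\<dots> = (\<Sum>e\<in>E. 2 * (\<Prod>v\<in>e. x v))"
  proof (rule sum.cong[OF refl])
    fix e assume "e \<in> E"
    then have "e \<in> all_pairs n" using assms by auto
    then obtain p q where pq: "e = {p, q}" "p \<in> {1..n}" "q \<in> {1..n}" "p \<noteq> q"
      unfolding all_pairs_def mem_Collect_eq by (elim exE conjE)
    show "(\<Sum>i\<in>{1..n}. \<Sum>j\<in>{1..n}. of_bool ({i, j} = e) * (\<Prod>v\<in>e. x v)) = 2 * (\<Prod>v\<in>e. x v)"
      unfolding sum_distrib_right[symmetric] pq(1) sum_pairs_eq_two[OF pq(2-4)] ..
  qed
  finally show ?thesis by (simp add: sum_distrib_left)
qed

text \<open>The vertices are then all distinct: \<open>i = k\<close> would make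
  \<open>{k, l}\<close> and \<open>{i, l}\<close> the same pair, and \<open>j = l\<close> likewise
  \<open>{i, j}\<close> and \<open>{i, l}\<close>, of which one lies in \<open>E\<close> and the
  other does not.\<close>

definition switchable :: "nat set set \<Rightarrow> nat \<Rightarrow> nat \<Rightarrow> nat \<Rightarrow> nat \<Rightarrow> bool" where
  "switchable E i j k l \<longleftrightarrow>
     {i, j} \<in> E \<and> {k, l} \<in> E \<and> {i, l} \<notin> E \<and> {j, k} \<notin> E
     \<and> i \<noteq> j \<and> k \<noteq> l \<and> i \<noteq> l \<and> j \<noteq> k"

definition switch :: "nat set set \<Rightarrow> nat \<Rightarrow> nat \<Rightarrow> nat \<Rightarrow> nat \<Rightarrow> nat set set" where
  "switch E i j k l = (E - {{i, j}, {k, l}}) \<union> {{i, l}, {j, k}}"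

lemma switchable_distinct:
  assumes "switchable E i j k l"
  shows "{i, j} \<noteq> {k, l}" "{i, l} \<noteq> {j, k}" "{i, j} \<noteq> {i, l}" "{i, j} \<noteq> {j, k}" "{k, l} \<noteq> {i, l}" "{k, l} \<noteq> {j, k}"
  using assms unfolding switchable_def by (auto simp: doubleton_eq_iff insert_commute)

lemma sum_switch:
  fixes \<phi> :: "nat set \<Rightarrow> real"
  assumes "finite E" "switchable E i j k l"
  shows "(\<Sum>e\<in>switch E i j k l. \<phi> e) = (\<Sum>e\<in>E. \<phi> e) - \<phi> {i, j} - \<phi> {k, l} + \<phi> {i, l} + \<phi> {j, k}"
proof -
  note d = switchable_distinct[OF assms(2)]
  have s: "{i, j} \<in> E" "{k, l} \<in> E" "{i, l} \<notin> E" "{j, k} \<notin> E" using assms(2) by (auto simp: switchable_def)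
  have "(\<Sum>e\<in>switch E i j k l. \<phi> e) = (\<Sum>e\<in>E - {{i, j}, {k, l}}. \<phi> e) + (\<Sum>e\<in>{{i, l}, {j, k}}. \<phi> e)"
    unfolding switch_def by (rule sum.union_disjoint) (use assms(1) s in auto)
  also have "(\<Sum>e\<in>E - {{i, j}, {k, l}}. \<phi> e) = (\<Sum>e\<in>E. \<phi> e) - (\<Sum>e\<in>{{i, j}, {k, l}}. \<phi> e)"
    by (rule sum_diff) (use assms(1) s in auto)
  finally show ?thesis using d by simp
qed

text \<open>Each of the four vertices loses one edge and gains one; \<open>sum_switch\<close>
  applied to the indicator of \<open>v \<in> e\<close> counts this.\<close>

lemma switch_reg:
  assumes E: "E \<in> reg_graphs n r" and s: "switchable E i j k l"
  shows "switch E i j k l \<in> reg_graphs n r"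
proof -
  have ij: "i \<in> {1..n} \<and> j \<in> {1..n} \<and> i \<noteq> j" and kl: "k \<in> {1..n} \<and> l \<in> {1..n} \<and> k \<noteq> l"
    using reg_graph_edge[OF E, of i j] reg_graph_edge[OF E, of k l] s by (auto simp: switchable_def)
  have sub: "E \<subseteq> all_pairs n" and fin: "finite E"
    using E reg_graph_finite[OF E] by (auto simp: reg_graphs_def)
  have il: "i \<noteq> l" "j \<noteq> k" using s by (auto simp: switchable_def)
  have sub': "switch E i j k l \<subseteq> all_pairs n"
    using sub ij kl il by (auto simp: switch_def pair_in_all_pairs)
  then have fin': "finite (switch E i j k l)" by (rule finite_subset[OF _ finite_all_pairs])
  have "card {e \<in> switch E i j k l. v \<in> e} = card {e \<in> E. v \<in> e}" for v
  proof -
    have c: "real (card {e \<in> F. v \<in> e}) = (\<Sum>e\<in>F. of_bool (v \<in> e))" if "finite F" for F :: "nat set set"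
    proof -
      have "real (card {e \<in> F. v \<in> e}) = (\<Sum>e\<in>{e \<in> F. v \<in> e}. 1)" by simp
      also have "\<dots> = (\<Sum>e\<in>F. if v \<in> e then 1 else 0)" by (rule sum.inter_filter[OF that])
      finally show ?thesis by (simp add: of_bool_def)
    qed
    have "real (card {e \<in> switch E i j k l. v \<in> e}) = real (card {e \<in> E. v \<in> e})"
      unfolding c[OF fin] c[OF fin'] sum_switch[OF fin s] using ij kl il by auto
    then show ?thesis by simp
  qed
  then show ?thesis using E sub' by (simp add: reg_graphs_def)
qed

lemma switch_switchable:
  assumes "switchable E i j k l"
  shows "switchable (switch E i j k l) i l k j"
proof -
  note d = switchable_distinct[OF assms]
  have e: "{l, k} = {k, l}" "{k, j} = {j, k}" by auto
  show ?thesis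
    unfolding switchable_def switch_def e
    by (intro conjI) (use assms d in \<open>simp_all add: switchable_def\<close>)
qed

lemma switch_switch:
  assumes "switchable E i j k l"
  shows "switch (switch E i j k l) i l k j = E"
proof -
  have gen: "((E - {A, B}) \<union> {C, D}) - {C, D} \<union> {A, B} = E" if "A \<in> E" "B \<in> E" "C \<notin> E" "D \<notin> E" for A B C D
    using that by blast
  have e: "{l, k} = {k, l}" "{k, j} = {j, k}" by auto
  show ?thesis
    unfolding switch_def e by (rule gen) (use assms in \<open>simp_all add: switchable_def\<close>)
qed

lemma edge_sum_switch:
  assumes E: "E \<in> reg_graphs n r" and s: "switchable E i j k l"
  shows "edge_sum n (switch E i j k l) x
    = edge_sum n E x + 2 * (x i * x l + x j * x k) - 2 * (x i * x j + x k * x l)"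
proof -
  have "i \<noteq> j" "k \<noteq> l" "i \<noteq> l" "j \<noteq> k"
    using s by (auto simp: switchable_def)
  moreover have "E \<subseteq> all_pairs n" "switch E i j k l \<subseteq> all_pairs n"
    using E switch_reg[OF E s] by (auto simp: reg_graphs_def)
  ultimately show ?thesis
    using sum_switch[OF reg_graph_finite[OF E] s, of "\<lambda>e. \<Prod>v\<in>e. x v"] by (simp add: edge_sum_eq)
qed

abbreviation weight where "weight E \<equiv> regular_matrix.valid (adj E)"

lemma weight_eq:
  assumes "E \<in> reg_graphs n r" "1 \<le> r"
  shows "weight E i j k l = of_bool (switchable E i j k l)"
proof -
  interpret regular_matrix n "real r" "adj E" using assms by (rule regular_matrix_adj)
  have "{p} \<notin> E" for p using reg_graph_edge[OF assms(1), of p p] by auto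
  then show ?thesis unfolding valid_def closed_def adj_def switchable_def by auto
qed

text \<open>The switching is an involution exchanging the roles of the quadruples \<open>(i, j, k, l)\<close> and
  \<open>(i, l, k, j)\<close>, so it is a change of variables in sums over all regular graphs and switchable
  quadruples.\<close>
lemma sum_switch_involution:
  assumes r: "1 \<le> r"
  shows "(\<Sum>E\<in>reg_graphs n r. sum4 n (\<lambda>i j k l. weight E i j k l * \<Phi> E i j k l))
       = (\<Sum>E\<in>reg_graphs n r. sum4 n (\<lambda>i j k l. weight E i j k l * \<Phi> (switch E i j k l) i l k j))"
proof -
  define A where "A = reg_graphs n r \<times> {1..n} \<times> {1..n} \<times> {1..n} \<times> {1..n}"
  define T where "T = {(E, i, j, k, l). E \<in> reg_graphs n r \<and> switchable E i j k l}"
  have inV: "i \<in> {1..n} \<and> j \<in> {1..n} \<and> k \<in> {1..n} \<and> l \<in> {1..n} \<and> i \<noteq> j \<and> k \<noteq> l"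
    if "E \<in> reg_graphs n r" "switchable E i j k l" for E i j k l
    using that reg_graph_edge[OF that(1), of i j] reg_graph_edge[OF that(1), of k l]
    by (auto simp: switchable_def)
  have TA: "T \<subseteq> A"
  proof
    fix q assume "q \<in> T"
    then obtain E i j k l where q: "q = (E, i, j, k, l)" "E \<in> reg_graphs n r" "switchable E i j k l"
      by (auto simp: T_def)
    then show "q \<in> A" using inV[OF q(2,3)] by (simp add: A_def)
  qed
  have finA: "finite A" by (simp add: A_def finite_reg_graphs)
  have to_T: "(\<Sum>E\<in>reg_graphs n r. sum4 n (\<lambda>i j k l. weight E i j k l * \<Psi> E i j k l))
      = (\<Sum>(E, i, j, k, l)\<in>T. \<Psi> E i j k l)" for \<Psi>
  proof -
    have "(\<Sum>E\<in>reg_graphs n r. sum4 n (\<lambda>i j k l. weight E i j k l * \<Psi> E i j k l))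
      = (\<Sum>(E, i, j, k, l)\<in>A. weight E i j k l * \<Psi> E i j k l)"
      unfolding sum4_def A_def by (simp add: sum.cartesian_product)
    also have "\<dots> = (\<Sum>(E, i, j, k, l)\<in>T. weight E i j k l * \<Psi> E i j k l)"
    proof (rule sum.mono_neutral_right[OF finA TA], rule ballI)
      fix q assume "q \<in> A - T"
      then obtain E i j k l where q: "q = (E, i, j, k, l)" "E \<in> reg_graphs n r" "\<not> switchable E i j k l"
        by (cases q) (auto simp: A_def T_def)
      then show "(case q of (E, i, j, k, l) \<Rightarrow> weight E i j k l * \<Psi> E i j k l) = 0"
        using weight_eq[OF q(2) r] by simp
    qed
    also have "\<dots> = (\<Sum>(E, i, j, k, l)\<in>T. \<Psi> E i j k l)"
      by (rule sum.cong) (auto simp: T_def weight_eq[OF _ r])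
    finally show ?thesis .
  qed
  let ?h = "\<lambda>(E, i, j, k, l). (switch E i j k l, i, l, k, j)"
  have hT: "?h q \<in> T" "?h (?h q) = q" if "q \<in> T" for q
  proof -
    obtain E i j k l where q: "q = (E, i, j, k, l)" by (cases q)
    then have E: "E \<in> reg_graphs n r" and s: "switchable E i j k l" using that by (auto simp: T_def)
    show "?h q \<in> T"
      using switch_reg[OF E s] switch_switchable[OF s] q by (simp add: T_def)
    show "?h (?h q) = q" using switch_switch[OF s] q by simp
  qed
  have "(\<Sum>(E, i, j, k, l)\<in>T. \<Phi> (switch E i j k l) i l k j) = (\<Sum>(E, i, j, k, l)\<in>T. \<Phi> E i j k l)"
  proof (rule sum.reindex_bij_witness[where i = ?h and j = ?h])
    fix q assume "q \<in> T"
    then show "?h (?h q) = q" "?h (?h q) = q" "?h q \<in> T" "?h q \<in> T" by (fact hT)+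
    show "(case ?h q of (E, i, j, k, l) \<Rightarrow> \<Phi> E i j k l)
        = (case q of (E, i, j, k, l) \<Rightarrow> \<Phi> (switch E i j k l) i l k j)"
      by (cases q) simp
  qed
  then show ?thesis unfolding to_T by (rule sym)
qed

section \<open>Exponential moments and tails\<close>

text \<open>Gronwall's argument: the hypothesis bounds the logarithmic derivative of the moment
  generating function by \<open>A + B * \<mu>\<close>, so dividing by the integrated bound gives a
  nonincreasing function.\<close>

lemma exp_moment_bound:
  fixes f :: "'a \<Rightarrow> real"
  assumes "0 \<le> t" and bound: "\<And>\<mu>. 0 \<le> \<mu> \<Longrightarrow> \<mu> \<le> t \<Longrightarrow>
      (\<Sum>w\<in>R. f w * exp (\<mu> * f w)) \<le> (A + B * \<mu>) * (\<Sum>w\<in>R. exp (\<mu> * f w))"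
  shows "(\<Sum>w\<in>R. exp (t * f w)) \<le> real (card R) * exp (A * t + B * t\<^sup>2 / 2)"
proof -
  define g where "g = (\<lambda>\<mu>. (\<Sum>w\<in>R. exp (\<mu> * f w)) * exp (- (A * \<mu> + B * \<mu>\<^sup>2 / 2)))"
  have "g t \<le> g 0"
  proof (rule DERIV_nonpos_imp_nonincreasing[OF assms(1)])
    fix \<mu> assume \<mu>: "0 \<le> \<mu>" "\<mu> \<le> t"
    let ?e = "exp (- (A * \<mu> + B * \<mu>\<^sup>2 / 2))"
    have "(g has_real_derivative
        (\<Sum>w\<in>R. f w * exp (\<mu> * f w)) * ?e + (- (A + B * \<mu>) * ?e) * (\<Sum>w\<in>R. exp (\<mu> * f w))) (at \<mu>)"
      unfolding g_def
    proof (rule DERIV_mult)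
      show "((\<lambda>\<mu>. \<Sum>w\<in>R. exp (\<mu> * f w)) has_real_derivative (\<Sum>w\<in>R. f w * exp (\<mu> * f w))) (at \<mu>)"
        by (intro DERIV_sum) (auto intro!: derivative_eq_intros)
      show "((\<lambda>\<mu>. exp (- (A * \<mu> + B * \<mu>\<^sup>2 / 2))) has_real_derivative - (A + B * \<mu>) * ?e) (at \<mu>)"
        by (auto intro!: derivative_eq_intros simp: algebra_simps)
    qed
    moreover have "(\<Sum>w\<in>R. f w * exp (\<mu> * f w)) * ?e + (- (A + B * \<mu>) * ?e) * (\<Sum>w\<in>R. exp (\<mu> * f w)) \<le> 0"
      using mult_right_mono[OF bound[OF \<mu>], of ?e] by (simp add: algebra_simps)
    ultimately show "\<exists>y. (g has_real_derivative y) (at \<mu>) \<and> y \<le> 0" by blast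
  qed
  then have "(\<Sum>w\<in>R. exp (t * f w)) * exp (- (A * t + B * t\<^sup>2 / 2)) \<le> real (card R)"
    by (simp add: g_def)
  then show ?thesis by (simp add: exp_minus field_simps)
qed

text \<open>Chernoff's bound. The parameter \<open>t\<close> is kept fixed instead of being
  optimised, since the moment inequality is only available on a bounded range.\<close>

lemma exp_moment_tail:
  fixes f :: "'a \<Rightarrow> real"
  assumes "finite R" "0 \<le> t" and "\<And>\<mu>. 0 \<le> \<mu> \<Longrightarrow> \<mu> \<le> t \<Longrightarrow>
      (\<Sum>w\<in>R. f w * exp (\<mu> * f w)) \<le> (A + B * \<mu>) * (\<Sum>w\<in>R. exp (\<mu> * f w))"
  shows "real (card {w \<in> R. A + s \<le> f w}) \<le> real (card R) * exp (B * t\<^sup>2 / 2 - t * s)"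
proof -
  have "real (card {w \<in> R. A + s \<le> f w}) * exp (t * (A + s)) = (\<Sum>w\<in>{w \<in> R. A + s \<le> f w}. exp (t * (A + s)))"
    by simp
  also have "\<dots> \<le> (\<Sum>w\<in>{w \<in> R. A + s \<le> f w}. exp (t * f w))"
    using assms(2) by (intro sum_mono) (auto intro: mult_left_mono)
  also have "\<dots> \<le> (\<Sum>w\<in>R. exp (t * f w))"
    using assms(1) by (intro sum_mono2) auto
  also have "\<dots> \<le> real (card R) * exp (A * t + B * t\<^sup>2 / 2)"
    by (rule exp_moment_bound[OF assms(2,3)])
  finally have "real (card {w \<in> R. A + s \<le> f w}) \<le> real (card R) * (exp (A * t + B * t\<^sup>2 / 2) / exp (t * (A + s)))"
    by (simp add: field_simps)
  also have "exp (A * t + B * t\<^sup>2 / 2) / exp (t * (A + s)) = exp (B * t\<^sup>2 / 2 - t * s)"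
    by (simp add: exp_diff[symmetric] algebra_simps)
  finally show ?thesis .
qed

section \<open>Concentration of edge sums in a uniform regular graph\<close>

context
  fixes n r :: nat and x :: "nat \<Rightarrow> real" and S :: real
  assumes r: "1 \<le> r" and x: "\<And>i. i \<in> {1..n} \<Longrightarrow> 0 \<le> x i"
    and S: "S = (\<Sum>i\<in>{1..n}. (x i)\<^sup>2)"
begin

text \<open>The form is spread over the switchable partners of its edges, and the involution then
  trades the weight \<open>x i * x j\<close> of an existing edge for \<open>x i * x l\<close>, the
  weight of a pair with no edge. What remains hardly depends on the graph, which reveals the mean
  \<open>r / n * (\<Sum> x i)\<^sup>2\<close>. Discarding the removed edges bounds the exponent, as
  \<open>x\<close> is nonnegative.\<close>

lemma edge_sum_moment_upper:
  assumes \<mu>: "0 \<le> \<mu>" "\<And>i j. i \<in> {1..n} \<Longrightarrow> j \<in> {1..n} \<Longrightarrow> 4 * \<mu> * (x i * x j) \<le> 1"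
  shows "(real r * real n - 4 * (real r)\<^sup>2) * (\<Sum>E\<in>reg_graphs n r. edge_sum n E x * exp (\<mu> * edge_sum n E x))
    \<le> ((real r)\<^sup>2 * (\<Sum>i\<in>{1..n}. x i)\<^sup>2 + 8 * \<mu> * (real r)\<^sup>2 * S\<^sup>2) * (\<Sum>E\<in>reg_graphs n r. exp (\<mu> * edge_sum n E x))"
proof -
  have "(real r * real n - 4 * (real r)\<^sup>2) * (\<Sum>E\<in>reg_graphs n r. edge_sum n E x * exp (\<mu> * edge_sum n E x))
     = (\<Sum>E\<in>reg_graphs n r. exp (\<mu> * edge_sum n E x) * ((real r * real n - 4 * (real r)\<^sup>2) * edge_sum n E x))"
    by (simp add: sum_distrib_left mult_ac)
  also have "\<dots> \<le> (\<Sum>E\<in>reg_graphs n r. exp (\<mu> * edge_sum n E x) * sum4 n (\<lambda>i j k l. weight E i j k l * (x i * x j)))"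
  proof (intro sum_mono mult_left_mono)
    fix E assume E: "E \<in> reg_graphs n r"
    interpret regular_matrix n "real r" "adj E" by (rule regular_matrix_adj[OF E r])
    show "(real r * real n - 4 * (real r)\<^sup>2) * edge_sum n E x \<le> sum4 n (\<lambda>i j k l. weight E i j k l * (x i * x j))"
      using sum4_valid_edge_ge[of x] x by (simp add: quad_def edge_sum_def)
  qed simp
  also have "\<dots> = (\<Sum>E\<in>reg_graphs n r. sum4 n (\<lambda>i j k l. weight E i j k l * (x i * x j * exp (\<mu> * edge_sum n E x))))"
    unfolding sum4_cmult[symmetric] by (simp add: mult_ac)
  also have "\<dots> = (\<Sum>E\<in>reg_graphs n r. sum4 n (\<lambda>i j k l. weight E i j k l * (x i * x l * exp (\<mu> * edge_sum n (switch E i j k l) x))))"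
    by (rule sum_switch_involution[OF r])
  also have "\<dots> \<le> (\<Sum>E\<in>reg_graphs n r. sum4 n (\<lambda>i j k l. weight E i j k l *
       (x i * x l * (exp (2 * \<mu> * (x i * x l + x j * x k)) * exp (\<mu> * edge_sum n E x)))))"
  proof (intro sum_mono sum4_mono)
    fix E i j k l
    assume E: "E \<in> reg_graphs n r" and V: "i \<in> {1..n}" "j \<in> {1..n}" "k \<in> {1..n}" "l \<in> {1..n}"
    show "weight E i j k l * (x i * x l * exp (\<mu> * edge_sum n (switch E i j k l) x))
       \<le> weight E i j k l * (x i * x l * (exp (2 * \<mu> * (x i * x l + x j * x k)) * exp (\<mu> * edge_sum n E x)))"
    proof (cases "switchable E i j k l")
      case True
      have "0 \<le> x i * x j + x k * x l" using V x by simp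
      then have "edge_sum n (switch E i j k l) x \<le> edge_sum n E x + 2 * (x i * x l + x j * x k)"
        unfolding edge_sum_switch[OF E True] by simp
      from mult_left_mono[OF this \<mu>(1)]
      have "exp (\<mu> * edge_sum n (switch E i j k l) x) \<le> exp (2 * \<mu> * (x i * x l + x j * x k)) * exp (\<mu> * edge_sum n E x)"
        unfolding exp_add[symmetric] by (simp add: algebra_simps)
      then show ?thesis using V x by (simp add: weight_eq[OF E r] mult_left_mono)
    qed (simp add: weight_eq[OF E r])
  qed
  also have "\<dots> = (\<Sum>E\<in>reg_graphs n r. exp (\<mu> * edge_sum n E x) * sum4 n (\<lambda>i j k l. weight E i j k l *
       (x i * x l * exp (2 * \<mu> * (x i * x l + x j * x k)))))"
    unfolding sum4_cmult[symmetric] by (simp add: mult_ac)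
  also have "\<dots> \<le> (\<Sum>E\<in>reg_graphs n r. exp (\<mu> * edge_sum n E x) *
       ((real r)\<^sup>2 * (\<Sum>i\<in>{1..n}. x i)\<^sup>2 + 8 * \<mu> * (real r)\<^sup>2 * S\<^sup>2))"
  proof (intro sum_mono mult_left_mono)
    fix E assume E: "E \<in> reg_graphs n r"
    interpret regular_matrix n "real r" "adj E" by (rule regular_matrix_adj[OF E r])
    show "sum4 n (\<lambda>i j k l. weight E i j k l * (x i * x l * exp (2 * \<mu> * (x i * x l + x j * x k))))
      \<le> (real r)\<^sup>2 * (\<Sum>i\<in>{1..n}. x i)\<^sup>2 + 8 * \<mu> * (real r)\<^sup>2 * S\<^sup>2"
      by (rule sum4_valid_exp_le[OF _ S \<mu>]) (use x in auto)
  qed simp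
  finally show ?thesis by (simp add: sum_distrib_right mult.commute)
qed

text \<open>The same exchange read backwards with negative exponents: the upper bound on the form of
  the switched graph now bounds its exponential from below.\<close>

lemma edge_sum_moment_lower:
  assumes \<mu>: "0 \<le> \<mu>"
  shows "((real r)\<^sup>2 * (\<Sum>i\<in>{1..n}. x i)\<^sup>2 - 4 * real r ^ 3 * S - 4 * \<mu> * (real r)\<^sup>2 * S\<^sup>2) * (\<Sum>E\<in>reg_graphs n r. exp (- \<mu> * edge_sum n E x))
    \<le> real r * real n * (\<Sum>E\<in>reg_graphs n r. edge_sum n E x * exp (- \<mu> * edge_sum n E x))"
proof -
  have "((real r)\<^sup>2 * (\<Sum>i\<in>{1..n}. x i)\<^sup>2 - 4 * real r ^ 3 * S - 4 * \<mu> * (real r)\<^sup>2 * S\<^sup>2) * (\<Sum>E\<in>reg_graphs n r. exp (- \<mu> * edge_sum n E x))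
     = (\<Sum>E\<in>reg_graphs n r. exp (- \<mu> * edge_sum n E x) *
       ((real r)\<^sup>2 * (\<Sum>i\<in>{1..n}. x i)\<^sup>2 - 4 * real r ^ 3 * S - 4 * \<mu> * (real r)\<^sup>2 * S\<^sup>2))"
    by (simp add: sum_distrib_right mult.commute)
  also have "\<dots> \<le> (\<Sum>E\<in>reg_graphs n r. exp (- \<mu> * edge_sum n E x) * sum4 n (\<lambda>i j k l. weight E i j k l *
       (x i * x l * exp (- (2 * \<mu> * (x i * x l + x j * x k))))))"
  proof (intro sum_mono mult_left_mono)
    fix E assume E: "E \<in> reg_graphs n r"
    interpret regular_matrix n "real r" "adj E" by (rule regular_matrix_adj[OF E r])
    show "(real r)\<^sup>2 * (\<Sum>i\<in>{1..n}. x i)\<^sup>2 - 4 * real r ^ 3 * S - 4 * \<mu> * (real r)\<^sup>2 * S\<^sup>2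
      \<le> sum4 n (\<lambda>i j k l. weight E i j k l * (x i * x l * exp (- (2 * \<mu> * (x i * x l + x j * x k)))))"
      by (rule sum4_valid_exp_ge[OF _ S \<mu>]) (use x in auto)
  qed simp
  also have "\<dots> = (\<Sum>E\<in>reg_graphs n r. sum4 n (\<lambda>i j k l. weight E i j k l *
       (x i * x l * (exp (- (2 * \<mu> * (x i * x l + x j * x k))) * exp (- \<mu> * edge_sum n E x)))))"
    unfolding sum4_cmult[symmetric] by (simp add: mult_ac)
  also have "\<dots> \<le> (\<Sum>E\<in>reg_graphs n r. sum4 n (\<lambda>i j k l. weight E i j k l * (x i * x l * exp (- \<mu> * edge_sum n (switch E i j k l) x))))"
  proof (intro sum_mono sum4_mono)
    fix E i j k l
    assume E: "E \<in> reg_graphs n r" and V: "i \<in> {1..n}" "j \<in> {1..n}" "k \<in> {1..n}" "l \<in> {1..n}"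
    show "weight E i j k l * (x i * x l * (exp (- (2 * \<mu> * (x i * x l + x j * x k))) * exp (- \<mu> * edge_sum n E x)))
       \<le> weight E i j k l * (x i * x l * exp (- \<mu> * edge_sum n (switch E i j k l) x))"
    proof (cases "switchable E i j k l")
      case True
      have "0 \<le> x i * x j + x k * x l" using V x by simp
      then have "edge_sum n (switch E i j k l) x \<le> edge_sum n E x + 2 * (x i * x l + x j * x k)"
        unfolding edge_sum_switch[OF E True] by simp
      from mult_left_mono[OF this \<mu>]
      have "exp (- (2 * \<mu> * (x i * x l + x j * x k))) * exp (- \<mu> * edge_sum n E x) \<le> exp (- \<mu> * edge_sum n (switch E i j k l) x)"
        unfolding exp_add[symmetric] by (simp add: algebra_simps)
      then show ?thesis using V x by (simp add: weight_eq[OF E r] mult_left_mono)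
    qed (simp add: weight_eq[OF E r])
  qed
  also have "\<dots> = (\<Sum>E\<in>reg_graphs n r. sum4 n (\<lambda>i j k l. weight E i j k l * (x i * x j * exp (- \<mu> * edge_sum n E x))))"
    by (rule sum_switch_involution[OF r, symmetric])
  also have "\<dots> = (\<Sum>E\<in>reg_graphs n r. exp (- \<mu> * edge_sum n E x) * sum4 n (\<lambda>i j k l. weight E i j k l * (x i * x j)))"
    unfolding sum4_cmult[symmetric] by (simp add: mult_ac)
  also have "\<dots> \<le> (\<Sum>E\<in>reg_graphs n r. exp (- \<mu> * edge_sum n E x) * (real r * real n * edge_sum n E x))"
  proof (intro sum_mono mult_left_mono)
    fix E assume E: "E \<in> reg_graphs n r"
    interpret regular_matrix n "real r" "adj E" by (rule regular_matrix_adj[OF E r])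
    show "sum4 n (\<lambda>i j k l. weight E i j k l * (x i * x j)) \<le> real r * real n * edge_sum n E x"
      using sum4_valid_edge_le[of x] x by (simp add: quad_def edge_sum_def)
  qed simp
  finally show ?thesis by (simp add: sum_distrib_left mult_ac)
qed

text \<open>The exponential moments are used at \<open>\<mu> = 1 / (4 s \<surd>r)\<close>, the largest value for which every
  single switching changes the exponent by at most one.\<close>
lemma edge_sum_tail:
  assumes n: "8 * r \<le> n" and s: "0 < s" "S \<le> s * real n"
    and sup: "\<And>i. i \<in> {1..n} \<Longrightarrow> (x i)\<^sup>2 \<le> s * sqrt (real r)"
  defines "m \<equiv> real r / real n * (\<Sum>i\<in>{1..n}. x i)\<^sup>2"
    and "t \<equiv> 1 / (4 * s * sqrt (real r))"
  shows "real (card {E \<in> reg_graphs n r. 8 * (real r)\<^sup>2 * s + D \<le> \<bar>edge_sum n E x - m\<bar>})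
     \<le> 2 * real (card (reg_graphs n r)) * exp (real n / 2 - t * D)"
proof -
  define X where "X = (\<Sum>i\<in>{1..n}. x i)"
  \<comment> \<open>\<open>A\<close> absorbs the shift of the mean due to blocked switchings,
    \<open>4 * r ^ 3 * s * n = (r * n / 2) * A\<close>. \<open>B\<close> comes from \<open>8 * \<mu>
    * r\<^sup>2 * (s * n)\<^sup>2 = (r * n / 2) * B * \<mu>\<close>, and makes
    \<open>B * t\<^sup>2 = n\<close>.\<close>
  define A where "A = 8 * (real r)\<^sup>2 * s"
  define B where "B = 16 * real r * real n * s\<^sup>2"
  have n0: "0 < real n" and r0: "0 < real r" using n r by auto
  have t0: "0 \<le> t" using s r0 by (simp add: t_def)
  have S0: "0 \<le> S" unfolding S by (simp add: sum_nonneg)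
  have S2: "S\<^sup>2 \<le> s\<^sup>2 * real n * real n"
    using power_mono[OF s(2) S0, of 2] by (simp add: power2_eq_square mult_ac)
  have X2: "X\<^sup>2 \<le> s * real n * real n"
  proof -
    have "X\<^sup>2 \<le> (\<Sum>i\<in>{1..n}. 1\<^sup>2) * (\<Sum>i\<in>{1..n}. (x i)\<^sup>2)"
      using Cauchy_Schwarz_ineq_sum[of "\<lambda>_. 1" x "{1..n}"] by (simp add: X_def)
    also have "\<dots> = real n * S" by (simp add: S)
    also have "\<dots> \<le> real n * (s * real n)" using s(2) by (intro mult_left_mono) auto
    finally show ?thesis by (simp add: mult_ac)
  qed
  have Bt: "B * t\<^sup>2 / 2 = real n / 2"
    using s(1) r0 by (simp add: B_def t_def field_simps)
  have m: "m = real r / real n * X\<^sup>2" by (simp add: m_def X_def)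
  have sup2: "4 * \<mu> * (x i * x j) \<le> 1" if "0 \<le> \<mu>" "\<mu> \<le> t" "i \<in> {1..n}" "j \<in> {1..n}" for \<mu> i j
  proof -
    have "x i * x j \<le> ((x i)\<^sup>2 + (x j)\<^sup>2) / 2"
      using sum_squares_bound[of "x i" "x j"] by (simp add: power2_eq_square)
    also have "\<dots> \<le> s * sqrt (real r)" using sup[OF that(3)] sup[OF that(4)] by simp
    finally have "4 * \<mu> * (x i * x j) \<le> 4 * t * (s * sqrt (real r))"
      using that x t0 by (intro mult_mono[of "4 * \<mu>" "4 * t"] mult_nonneg_nonneg) auto
    also have "\<dots> = 1" using s(1) r0 by (simp add: t_def)
    finally show ?thesis .
  qed
  have pos: "0 \<le> (\<Sum>E\<in>reg_graphs n r. exp (\<mu> * edge_sum n E x))" for \<mu> by (simp add: sum_nonneg)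
  have up: "real (card {E \<in> reg_graphs n r. (m + A) + D \<le> edge_sum n E x})
      \<le> real (card (reg_graphs n r)) * exp (B * t\<^sup>2 / 2 - t * D)"
  proof (rule exp_moment_tail[OF finite_reg_graphs t0])
    fix \<mu> assume \<mu>: "0 \<le> \<mu>" "\<mu> \<le> t"
    let ?c = "real r * real n - 4 * (real r)\<^sup>2"
    \<comment> \<open>Since \<open>8 * r \<le> n\<close>, at least half of the \<open>r * n\<close>
      partners stay available.\<close>
    have "4 * real r \<le> real n / 2" using n by simp
    then have c: "real r * real n / 2 \<le> ?c"
      using mult_left_mono[of "4 * real r" "real n / 2" "real r"] by (simp add: power2_eq_square mult_ac)
    then have c0: "0 < ?c" using n0 r0 by (smt (verit) mult_pos_pos half_gt_zero)
    have "(real r)\<^sup>2 * X\<^sup>2 + 8 * \<mu> * (real r)\<^sup>2 * S\<^sup>2 \<le> ?c * ((m + A) + B * \<mu>)"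
    proof -
      have "?c * m = (real r)\<^sup>2 * X\<^sup>2 - 4 * (real r)\<^sup>2 * real r * X\<^sup>2 / real n"
        using n0 by (simp add: m field_simps power2_eq_square)
      moreover have "4 * (real r)\<^sup>2 * real r * X\<^sup>2 / real n \<le> 4 * (real r)\<^sup>2 * real r * (s * real n * real n) / real n"
        using n0 X2 by (intro divide_right_mono mult_left_mono) auto
      moreover have "\<dots> = real r * real n / 2 * A"
        using n0 by (simp add: A_def field_simps power2_eq_square)
      moreover have "real r * real n / 2 * A \<le> ?c * A"
        using c s by (intro mult_right_mono) (auto simp: A_def)
      moreover have "8 * \<mu> * (real r)\<^sup>2 * S\<^sup>2 \<le> 8 * \<mu> * (real r)\<^sup>2 * (s\<^sup>2 * real n * real n)"
        using \<mu> S2 by (intro mult_left_mono) auto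
      moreover have "\<dots> = real r * real n / 2 * (B * \<mu>)"
        by (simp add: B_def field_simps power2_eq_square)
      moreover have "real r * real n / 2 * (B * \<mu>) \<le> ?c * (B * \<mu>)"
        using c s \<mu> by (intro mult_right_mono) (auto simp: B_def)
      ultimately show ?thesis unfolding distrib_left by linarith
    qed
    then have c_le: "((real r)\<^sup>2 * X\<^sup>2 + 8 * \<mu> * (real r)\<^sup>2 * S\<^sup>2) * (\<Sum>E\<in>reg_graphs n r. exp (\<mu> * edge_sum n E x))
       \<le> (?c * ((m + A) + B * \<mu>)) * (\<Sum>E\<in>reg_graphs n r. exp (\<mu> * edge_sum n E x))"
      by (rule mult_right_mono[OF _ pos])
    have "?c * (\<Sum>E\<in>reg_graphs n r. edge_sum n E x * exp (\<mu> * edge_sum n E x))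
       \<le> ((real r)\<^sup>2 * X\<^sup>2 + 8 * \<mu> * (real r)\<^sup>2 * S\<^sup>2) * (\<Sum>E\<in>reg_graphs n r. exp (\<mu> * edge_sum n E x))"
      unfolding X_def by (rule edge_sum_moment_upper[OF \<mu>(1)]) (rule sup2[OF \<mu>])
    from order.trans[OF this c_le]
    have "?c * (\<Sum>E\<in>reg_graphs n r. edge_sum n E x * exp (\<mu> * edge_sum n E x))
       \<le> ?c * (((m + A) + B * \<mu>) * (\<Sum>E\<in>reg_graphs n r. exp (\<mu> * edge_sum n E x)))"
      by (simp only: mult.assoc)
    then show "(\<Sum>E\<in>reg_graphs n r. edge_sum n E x * exp (\<mu> * edge_sum n E x))
       \<le> ((m + A) + B * \<mu>) * (\<Sum>E\<in>reg_graphs n r. exp (\<mu> * edge_sum n E x))"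
      using c0 by (rule mult_left_le_imp_le)
  qed
  have lo: "real (card {E \<in> reg_graphs n r. (- m + A) + D \<le> - edge_sum n E x})
      \<le> real (card (reg_graphs n r)) * exp (B * t\<^sup>2 / 2 - t * D)"
  proof (rule exp_moment_tail[OF finite_reg_graphs t0])
    fix \<mu> assume \<mu>: "0 \<le> \<mu>" "\<mu> \<le> t"
    let ?c = "real r * real n"
    have c0: "0 < ?c" using n0 r0 by simp
    have "?c * (m - A - B * \<mu>) \<le> (real r)\<^sup>2 * X\<^sup>2 - 4 * real r ^ 3 * S - 4 * \<mu> * (real r)\<^sup>2 * S\<^sup>2"
    proof -
      have "?c * m = (real r)\<^sup>2 * X\<^sup>2"
        using n0 by (simp add: m field_simps power2_eq_square)
      moreover have "4 * real r ^ 3 * S \<le> 4 * real r ^ 3 * (s * real n)"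
        using s by (intro mult_left_mono) auto
      moreover have "4 * real r ^ 3 * (s * real n) \<le> ?c * A"
        using s by (simp add: A_def power2_eq_square power3_eq_cube)
      moreover have "4 * \<mu> * (real r)\<^sup>2 * S\<^sup>2 \<le> 4 * \<mu> * (real r)\<^sup>2 * (s\<^sup>2 * real n * real n)"
        using \<mu> S2 by (intro mult_left_mono) auto
      moreover have "4 * \<mu> * (real r)\<^sup>2 * (s\<^sup>2 * real n * real n) = ?c * (B * \<mu>) / 4"
        by (simp add: B_def power2_eq_square)
      moreover have "0 \<le> ?c * (B * \<mu>)"
        using \<mu> by (simp add: B_def)
      ultimately show ?thesis unfolding right_diff_distrib by linarith
    qed
    then have c_ge: "?c * (m - A - B * \<mu>) * (\<Sum>E\<in>reg_graphs n r. exp (- \<mu> * edge_sum n E x))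
       \<le> ((real r)\<^sup>2 * X\<^sup>2 - 4 * real r ^ 3 * S - 4 * \<mu> * (real r)\<^sup>2 * S\<^sup>2) * (\<Sum>E\<in>reg_graphs n r. exp (- \<mu> * edge_sum n E x))"
      by (rule mult_right_mono[OF _ pos])
    from order.trans[OF c_ge edge_sum_moment_lower[OF \<mu>(1), folded X_def]]
    have "?c * ((m - A - B * \<mu>) * (\<Sum>E\<in>reg_graphs n r. exp (- \<mu> * edge_sum n E x)))
       \<le> ?c * (\<Sum>E\<in>reg_graphs n r. edge_sum n E x * exp (- \<mu> * edge_sum n E x))"
      by (simp only: mult.assoc)
    then have "(m - A - B * \<mu>) * (\<Sum>E\<in>reg_graphs n r. exp (- \<mu> * edge_sum n E x)) \<le> (\<Sum>E\<in>reg_graphs n r. edge_sum n E x * exp (- \<mu> * edge_sum n E x))"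
      using c0 by (rule mult_left_le_imp_le)
    then show "(\<Sum>E\<in>reg_graphs n r. - edge_sum n E x * exp (\<mu> * - edge_sum n E x))
       \<le> ((- m + A) + B * \<mu>) * (\<Sum>E\<in>reg_graphs n r. exp (\<mu> * - edge_sum n E x))"
      by (simp add: sum_negf algebra_simps)
  qed
  have "{E \<in> reg_graphs n r. A + D \<le> \<bar>edge_sum n E x - m\<bar>}
     \<subseteq> {E \<in> reg_graphs n r. (m + A) + D \<le> edge_sum n E x} \<union> {E \<in> reg_graphs n r. (- m + A) + D \<le> - edge_sum n E x}"
    by auto
  then have "card {E \<in> reg_graphs n r. A + D \<le> \<bar>edge_sum n E x - m\<bar>}
     \<le> card {E \<in> reg_graphs n r. (m + A) + D \<le> edge_sum n E x} + card {E \<in> reg_graphs n r. (- m + A) + D \<le> - edge_sum n E x}"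
    using finite_reg_graphs by (intro order.trans[OF card_mono card_Un_le]) auto
  with up lo show ?thesis unfolding Bt A_def by simp
qed

end

section \<open>The discrepancy event\<close>

definition bil :: "nat \<Rightarrow> (nat \<Rightarrow> nat \<Rightarrow> real) \<Rightarrow> (nat \<Rightarrow> real) \<Rightarrow> (nat \<Rightarrow> real) \<Rightarrow> real" where
  "bil n M x y = (\<Sum>i\<in>{1..n}. \<Sum>j\<in>{1..n}. M i j * (x i * y j))"

lemma bil_swap:
  assumes "\<And>i j. M i j = M j i"
  shows "bil n M x y = bil n M y x"
  unfolding bil_def by (subst sum.swap, intro sum.cong refl) (metis assms mult.commute)

lemma bil_add_left: "bil n M (\<lambda>i. x i + x' i) y = bil n M x y + bil n M x' y"
  by (simp add: bil_def sum.distrib algebra_simps)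

lemma bil_add_right: "bil n M x (\<lambda>i. y i + y' i) = bil n M x y + bil n M x y'"
  by (simp add: bil_def sum.distrib algebra_simps)

lemma bil_diff_left: "bil n M (\<lambda>i. x i - x' i) y = bil n M x y - bil n M x' y"
  by (simp add: bil_def sum_subtractf algebra_simps)

lemma bil_diff_right: "bil n M x (\<lambda>i. y i - y' i) = bil n M x y - bil n M x y'"
  by (simp add: bil_def sum_subtractf algebra_simps)

text \<open>A linear form on a box attains its maximum at a vertex, so each coordinate can be rounded in
  the direction given by its coefficient.\<close>
lemma bil_round:
  assumes "\<And>i. i \<in> {1..n} \<Longrightarrow> 0 \<le> x i"
  shows "\<exists>z :: nat \<Rightarrow> nat. (\<forall>i\<in>{1..n}. real (z i) \<le> x i + 1) \<and> bil n M x y \<le> bil n M (\<lambda>i. real (z i)) y"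
proof -
  define g where "g = (\<lambda>i. \<Sum>j\<in>{1..n}. M i j * y j)"
  define z where "z = (\<lambda>i. if 0 \<le> g i then nat \<lceil>x i\<rceil> else nat \<lfloor>x i\<rfloor>)"
  have bil_g: "bil n M u y = (\<Sum>i\<in>{1..n}. g i * u i)" for u
    unfolding bil_def g_def by (simp add: sum_distrib_left sum_distrib_right mult_ac)
  have "real (z i) \<le> x i + 1" if "i \<in> {1..n}" for i
  proof -
    have "0 \<le> \<lceil>x i\<rceil>" "0 \<le> \<lfloor>x i\<rfloor>" using assms[OF that] by linarith+
    then have "real (z i) = (if 0 \<le> g i then of_int \<lceil>x i\<rceil> else of_int \<lfloor>x i\<rfloor>)" by (simp add: z_def)
    then show ?thesis by (simp split: if_splits) linarith
  qed
  moreover have "g i * x i \<le> g i * real (z i)" if "i \<in> {1..n}" for i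
  proof (cases "0 \<le> g i")
    case True
    have "x i \<le> real (z i)" using True by (simp add: z_def) linarith
    then show ?thesis using True by (rule mult_left_mono)
  next
    case False
    have "real (z i) \<le> x i" using False assms[OF that] by (simp add: z_def)
    then show ?thesis using False by (intro mult_left_mono_neg) auto
  qed
  then have "bil n M x y \<le> bil n M (\<lambda>i. real (z i)) y" unfolding bil_g by (intro sum_mono)
  ultimately show ?thesis by blast
qed

text \<open>From \<open>(x + 1)\<^sup>2 \<le> 2 * x\<^sup>2 + 2\<close>; the additive 2 is absorbed
  by \<open>n\<close> in the sum and by \<open>q \<ge> 1\<close> in each entry.\<close>

lemma sum_sq_round:
  fixes z :: "nat \<Rightarrow> nat"
  assumes "\<And>i. i \<in> {1..n} \<Longrightarrow> 0 \<le> x i" "\<And>i. i \<in> {1..n} \<Longrightarrow> real (z i) \<le> x i + 1"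
    and "(\<Sum>i\<in>{1..n}. (x i)\<^sup>2) \<le> real n" "\<And>i. i \<in> {1..n} \<Longrightarrow> (x i)\<^sup>2 \<le> q" "1 \<le> q"
  shows "(\<Sum>i\<in>{1..n}. (real (z i))\<^sup>2) \<le> 4 * real n" "i \<in> {1..n} \<Longrightarrow> (real (z i))\<^sup>2 \<le> 4 * q"
proof -
  have z: "(real (z i))\<^sup>2 \<le> 2 * (x i)\<^sup>2 + 2" if "i \<in> {1..n}" for i
  proof -
    have "(real (z i))\<^sup>2 \<le> (x i + 1)\<^sup>2" using assms(2)[OF that] by (intro power_mono) auto
    also have "\<dots> \<le> 2 * (x i)\<^sup>2 + 2"
      using zero_le_power2[of "x i - 1"] by (simp add: power2_eq_square algebra_simps)
    finally show ?thesis .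
  qed
  have "(\<Sum>i\<in>{1..n}. (real (z i))\<^sup>2) \<le> (\<Sum>i\<in>{1..n}. 2 * (x i)\<^sup>2 + 2)" using z by (intro sum_mono)
  also have "\<dots> = 2 * (\<Sum>i\<in>{1..n}. (x i)\<^sup>2) + 2 * real n" by (simp add: sum.distrib sum_distrib_left)
  finally show "(\<Sum>i\<in>{1..n}. (real (z i))\<^sup>2) \<le> 4 * real n" using assms(3) by linarith
  show "(real (z i))\<^sup>2 \<le> 4 * q" if "i \<in> {1..n}"
    using z[OF that] assms(4)[OF that] assms(5) by linarith
qed

definition small_vec :: "nat \<Rightarrow> real \<Rightarrow> (nat \<Rightarrow> real) \<Rightarrow> bool" where
  "small_vec n q x \<longleftrightarrow> (\<Sum>i\<in>{1..n}. (x i)\<^sup>2) \<le> real n \<and> (\<forall>i\<in>{1..n}. (x i)\<^sup>2 \<le> q)"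

text \<open>Natural-number points suit both the union bound and the nonnegativity demanded by the
  tail estimate. The 16 allows for rounding, which multiplies squares by up to 4, and for adding two
  rounded vectors, another factor 4.\<close>

definition lattice_bound :: "nat \<Rightarrow> real \<Rightarrow> (nat \<Rightarrow> nat \<Rightarrow> real) \<Rightarrow> real \<Rightarrow> bool" where
  "lattice_bound n q M D \<longleftrightarrow> (\<forall>z :: nat \<Rightarrow> nat.
     (\<Sum>i\<in>{1..n}. (real (z i))\<^sup>2) \<le> 16 * real n \<longrightarrow> (\<forall>i\<in>{1..n}. (real (z i))\<^sup>2 \<le> 16 * q) \<longrightarrow>
     \<bar>bil n M (\<lambda>i. real (z i)) (\<lambda>i. real (z i))\<bar> \<le> D)"

text \<open>The two arguments are rounded one after the other, the form being linear in each.
  Polarisation, \<open>2 w M z = (w + z) M (w + z) - w M w - z M z\<close>, returns to lattice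
  points and yields \<open>3 / 2 * D\<close>.\<close>

lemma bil_le_nonneg:
  assumes sym: "\<And>i j. M i j = M j i" and q: "1 \<le> q" and M: "lattice_bound n q M D"
    and x: "\<And>i. i \<in> {1..n} \<Longrightarrow> 0 \<le> x i" "small_vec n q x"
    and y: "\<And>i. i \<in> {1..n} \<Longrightarrow> 0 \<le> y i" "small_vec n q y"
  shows "bil n M x y \<le> 3 / 2 * D"
proof -
  obtain z :: "nat \<Rightarrow> nat" where z: "\<And>i. i \<in> {1..n} \<Longrightarrow> real (z i) \<le> x i + 1"
    "bil n M x y \<le> bil n M (\<lambda>i. real (z i)) y"
    using bil_round[of n x M y] x(1) by blast
  obtain w :: "nat \<Rightarrow> nat" where w: "\<And>i. i \<in> {1..n} \<Longrightarrow> real (w i) \<le> y i + 1"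
    "bil n M y (\<lambda>i. real (z i)) \<le> bil n M (\<lambda>i. real (w i)) (\<lambda>i. real (z i))"
    using bil_round[of n y M "\<lambda>i. real (z i)"] y(1) by blast
  let ?z = "\<lambda>i. real (z i)" and ?w = "\<lambda>i. real (w i)"
  have z2: "(\<Sum>i\<in>{1..n}. (?z i)\<^sup>2) \<le> 4 * real n" "\<And>i. i \<in> {1..n} \<Longrightarrow> (?z i)\<^sup>2 \<le> 4 * q"
    using sum_sq_round[of n x z q] x z(1) q unfolding small_vec_def by blast+
  have w2: "(\<Sum>i\<in>{1..n}. (?w i)\<^sup>2) \<le> 4 * real n" "\<And>i. i \<in> {1..n} \<Longrightarrow> (?w i)\<^sup>2 \<le> 4 * q"
    using sum_sq_round[of n y w q] y w(1) q unfolding small_vec_def by blast+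
  have p: "(real (w i + z i))\<^sup>2 \<le> 2 * (?w i)\<^sup>2 + 2 * (?z i)\<^sup>2" for i
    using zero_le_power2[of "?w i - ?z i"] by (simp add: power2_eq_square algebra_simps)
  have wz: "(\<Sum>i\<in>{1..n}. (real (w i + z i))\<^sup>2) \<le> 16 * real n"
  proof -
    have "(\<Sum>i\<in>{1..n}. (real (w i + z i))\<^sup>2) \<le> (\<Sum>i\<in>{1..n}. 2 * (?w i)\<^sup>2 + 2 * (?z i)\<^sup>2)"
      by (rule sum_mono) (rule p)
    then show ?thesis using z2(1) w2(1) by (simp add: sum.distrib sum_distrib_left[symmetric])
  qed
  have wz2: "(real (w i + z i))\<^sup>2 \<le> 16 * q" if "i \<in> {1..n}" for i
    using p[of i] z2(2)[OF that] w2(2)[OF that] by linarith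
  have "\<bar>bil n M ?z ?z\<bar> \<le> D"
  proof (rule M[unfolded lattice_bound_def, rule_format])
    show "(\<Sum>i\<in>{1..n}. (?z i)\<^sup>2) \<le> 16 * real n" using z2(1) by linarith
    show "(?z i)\<^sup>2 \<le> 16 * q" if "i \<in> {1..n}" for i using z2(2)[OF that] q by linarith
  qed
  moreover have "\<bar>bil n M ?w ?w\<bar> \<le> D"
  proof (rule M[unfolded lattice_bound_def, rule_format])
    show "(\<Sum>i\<in>{1..n}. (?w i)\<^sup>2) \<le> 16 * real n" using w2(1) by linarith
    show "(?w i)\<^sup>2 \<le> 16 * q" if "i \<in> {1..n}" for i using w2(2)[OF that] q by linarith
  qed
  moreover have "\<bar>bil n M (\<lambda>i. real (w i + z i)) (\<lambda>i. real (w i + z i))\<bar> \<le> D"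
    by (rule M[unfolded lattice_bound_def, rule_format]) (use wz wz2 in auto)
  moreover have "bil n M (\<lambda>i. real (w i + z i)) (\<lambda>i. real (w i + z i))
      = bil n M ?w ?w + 2 * bil n M ?w ?z + bil n M ?z ?z"
    unfolding of_nat_add bil_add_left bil_add_right bil_swap[of M n ?z ?w, OF sym] by simp
  ultimately have "bil n M ?w ?z \<le> 3 / 2 * D" by linarith
  with z(2) w(2) show ?thesis unfolding bil_swap[of M n y ?z, OF sym] by linarith
qed

lemma bil_abs_nonneg:
  assumes sym: "\<And>i j. M i j = M j i" and q: "1 \<le> q" and M: "lattice_bound n q M D"
    and x: "\<And>i. i \<in> {1..n} \<Longrightarrow> 0 \<le> x i" "small_vec n q x"
    and y: "\<And>i. i \<in> {1..n} \<Longrightarrow> 0 \<le> y i" "small_vec n q y"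
  shows "\<bar>bil n M x y\<bar> \<le> 3 / 2 * D"
proof -
  have neg: "bil n (\<lambda>i j. - M i j) u v = - bil n M u v" for u v
    by (simp add: bil_def sum_negf)
  have M': "lattice_bound n q (\<lambda>i j. - M i j) D"
    using M by (simp add: lattice_bound_def neg)
  have "bil n (\<lambda>i j. - M i j) x y \<le> 3 / 2 * D"
    by (rule bil_le_nonneg[of "\<lambda>i j. - M i j" q n D x y, OF _ q M' x y]) (simp add: sym)
  with bil_le_nonneg[of M q n D x y, OF sym q M x y] show ?thesis unfolding neg by linarith
qed

text \<open>Positive and negative parts give four terms of size \<open>3 / 2 * D\<close>.\<close>

lemma bil_abs_le:
  assumes sym: "\<And>i j. M i j = M j i" and q: "1 \<le> q" and M: "lattice_bound n q M D"
    and x: "small_vec n q x"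
  shows "\<bar>bil n M x x\<bar> \<le> 6 * D"
proof -
  define u where "u = (\<lambda>i. max 0 (x i))"
  define v where "v = (\<lambda>i. max 0 (- x i))"
  have "(u i)\<^sup>2 \<le> (x i)\<^sup>2" "(v i)\<^sup>2 \<le> (x i)\<^sup>2" for i by (auto simp: u_def v_def max_def)
  then have small: "small_vec n q u" "small_vec n q v"
    using x unfolding small_vec_def by (meson order.trans sum_mono)+
  have nonneg: "0 \<le> u i" "0 \<le> v i" for i by (auto simp: u_def v_def)
  have "x = (\<lambda>i. u i - v i)" by (auto simp: u_def v_def max_def)
  then have "bil n M x x = bil n M u u - bil n M u v - bil n M v u + bil n M v v"
    by (simp add: bil_diff_left bil_diff_right)
  then show ?thesis
    using bil_abs_nonneg[of M q n D u u, OF sym q M nonneg(1) small(1) nonneg(1) small(1)]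
      bil_abs_nonneg[of M q n D u v, OF sym q M nonneg(1) small(1) nonneg(2) small(2)]
      bil_abs_nonneg[of M q n D v u, OF sym q M nonneg(2) small(2) nonneg(1) small(1)]
      bil_abs_nonneg[of M q n D v v, OF sym q M nonneg(2) small(2) nonneg(2) small(2)]
    by linarith
qed

text \<open>Smallness of a vector passes to every vector dominated by it entrywise, which is why
  Grothendieck's inequality was stated for a box with sides \<open>p i\<close>. The constant is
  \<open>34 * 6\<close>.\<close>

lemma psd_bound:
  assumes sym: "\<And>i j. M i j = M j i" and q: "1 \<le> q" and M: "lattice_bound n q M D"
    and G: "psd n G" "\<And>i. i \<in> {1..n} \<Longrightarrow> G i i \<le> (p i)\<^sup>2"
    and p: "\<And>i. i \<in> {1..n} \<Longrightarrow> 0 \<le> p i" "small_vec n q p"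
  shows "\<bar>\<Sum>i\<in>{1..n}. \<Sum>j\<in>{1..n}. M i j * G i j\<bar> \<le> 204 * D"
proof -
  have "\<bar>\<Sum>i\<in>{1..n}. \<Sum>j\<in>{1..n}. M i j * G i j\<bar> \<le> 34 * (6 * D)"
  proof (rule grothendieck[where p = p and G = G and M = M and C = "6 * D"])
    fix y assume y: "\<And>i. i \<in> {1..n} \<Longrightarrow> \<bar>y i\<bar> \<le> p i"
    then have y2: "(y i)\<^sup>2 \<le> (p i)\<^sup>2" if "i \<in> {1..n}" for i
      using power_mono[OF y[OF that], of 2] by simp
    have "(\<Sum>i\<in>{1..n}. (y i)\<^sup>2) \<le> (\<Sum>i\<in>{1..n}. (p i)\<^sup>2)" by (rule sum_mono) (rule y2)
    then have "small_vec n q y"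
      using p(2) y2 unfolding small_vec_def by (meson order.trans)
    then show "\<bar>\<Sum>i\<in>{1..n}. \<Sum>j\<in>{1..n}. M i j * (y i * y j)\<bar> \<le> 6 * D"
      using bil_abs_le[of M q n D y, OF sym q M] by (simp add: bil_def)
  qed (fact p(1) G)+
  then show ?thesis by simp
qed

text \<open>The indicator of the ball is at most \<open>exp (c * n - \<Sum> z\<^sup>2)\<close>,
  whose sum factors over coordinates; each factor is at most
  \<open>\<Sum> 2 ^ (- m) = 2 \<le> exp 1\<close>. The bound does not depend on \<open>N\<close>,
  which only ensures finiteness.\<close>

lemma card_lattice_ball: 
  "real (card {z \<in> PiE {1..n} (\<lambda>_. {..N}). (\<Sum>i\<in>{1..n}. (real (z i))\<^sup>2) \<le> c * real n}) \<le> exp ((c + 1) * real n)"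
proof -
  let ?P = "PiE {1..n} (\<lambda>_. {..N})"
  let ?Z = "{z \<in> ?P. (\<Sum>i\<in>{1..n}. (real (z i))\<^sup>2) \<le> c * real n}"
  have "(\<Sum>m\<in>{..N}. exp (- (real m)\<^sup>2)) \<le> (\<Sum>m\<in>{..N}. (1 / 2) ^ m)"
  proof (rule sum_mono)
    fix m
    have "2 * 2 ^ m \<le> (2 :: real) * exp 1 ^ m"
      using exp_ge_add_one_self[of 1] by (intro mult_left_mono power_mono) auto
    then have "2 ^ m \<le> exp (real m)" by (simp add: exp_of_nat_mult[symmetric])
    also have "\<dots> \<le> exp ((real m)\<^sup>2)"
      by (cases m) (auto simp: power2_eq_square)
    finally show "exp (- (real m)\<^sup>2) \<le> (1 / 2) ^ m"
      by (simp add: exp_minus power_one_over field_simps)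
  qed
  also have "\<dots> \<le> (\<Sum>m. (1 / 2) ^ m)" by (rule sum_le_suminf) (auto simp: summable_geometric)
  also have "\<dots> = 2" by (simp add: suminf_geometric)
  also have "\<dots> \<le> exp 1" using exp_ge_add_one_self[of 1] by simp
  finally have geo: "(\<Sum>m\<in>{..N}. exp (- (real m)\<^sup>2)) \<le> exp 1" .
  have "real (card ?Z) = (\<Sum>z\<in>?Z. 1)" by simp
  also have "\<dots> \<le> (\<Sum>z\<in>?Z. exp (c * real n - (\<Sum>i\<in>{1..n}. (real (z i))\<^sup>2)))"
    by (rule sum_mono) auto
  also have "\<dots> \<le> (\<Sum>z\<in>?P. exp (c * real n - (\<Sum>i\<in>{1..n}. (real (z i))\<^sup>2)))"
    by (rule sum_mono2) (auto intro!: finite_PiE)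
  also have "\<dots> = exp (c * real n) * (\<Sum>z\<in>?P. \<Prod>i\<in>{1..n}. exp (- (real (z i))\<^sup>2))"
    unfolding diff_conv_add_uminus exp_add sum_negf[symmetric] exp_sum[OF finite_atLeastAtMost] sum_distrib_left ..
  also have "(\<Sum>z\<in>?P. \<Prod>i\<in>{1..n}. exp (- (real (z i))\<^sup>2)) = (\<Prod>i\<in>{1..n}. \<Sum>m\<in>{..N}. exp (- (real m)\<^sup>2))"
    by (rule prod_sum_PiE[symmetric]) auto
  also have "\<dots> \<le> exp 1 ^ n"
    using geo by (simp add: power_mono sum_nonneg)
  also have "exp (c * real n) * exp 1 ^ n = exp ((c + 1) * real n)"
    by (simp add: exp_of_nat_mult[symmetric] exp_add[symmetric] algebra_simps)
  finally show ?thesis by simp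
qed

section \<open>Union bound for the centred adjacency matrix\<close>

definition centred :: "nat \<Rightarrow> nat \<Rightarrow> nat set set \<Rightarrow> nat \<Rightarrow> nat \<Rightarrow> real" where
  "centred n r E i j = adj E i j - real r / real n"

lemma centred_sym: "centred n r E i j = centred n r E j i"
  by (simp add: centred_def adj_sym)

lemma bil_centred: "bil n (centred n r E) x x = edge_sum n E x - real r / real n * (\<Sum>i\<in>{1..n}. x i)\<^sup>2"
proof -
  have "bil n (centred n r E) x x
      = edge_sum n E x - (\<Sum>i\<in>{1..n}. \<Sum>j\<in>{1..n}. real r / real n * (x i * x j))"
    unfolding bil_def centred_def edge_sum_def by (simp add: sum_subtractf left_diff_distrib)
  moreover have "real r / real n * (\<Sum>i\<in>{1..n}. x i)\<^sup>2 = (\<Sum>i\<in>{1..n}. \<Sum>j\<in>{1..n}. real r / real n * (x i * x j))"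
    by (simp only: power2_eq_square sum_product) (simp only: sum_distrib_left)
  ultimately show ?thesis by simp
qed

text \<open>With \<open>s = 16\<close> the tail estimate has bias \<open>8 * 16 * r\<^sup>2\<close>,
  at most \<open>128 * n * sqrt r\<close>, and a deviation of \<open>1280 * n * sqrt r\<close>
  produces the exponent \<open>- 20 * n\<close>; hence \<open>1408 = 128 + 1280\<close>.\<close>

abbreviation typical :: "nat \<Rightarrow> nat \<Rightarrow> nat set set \<Rightarrow> bool" where
  "typical n r E \<equiv> lattice_bound n (sqrt (real r)) (centred n r E) (1408 * real n * sqrt (real r))"

text \<open>The exponents in units of \<open>n\<close>: 17 for the lattice points, 1 for the two
  tails, \<open>1 / 2 - 20\<close> from each tail, in total \<open>- 3 / 2\<close>.\<close>

lemma card_not_typical: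
  assumes r: "1 \<le> r" and n: "r\<^sup>2 \<le> n" "8 * r \<le> n"
  shows "real (card {E \<in> reg_graphs n r. \<not> typical n r E}) \<le> real (card (reg_graphs n r)) * exp (- real n)"
proof -
  \<comment> \<open>The box loses nothing: \<open>z\<^sup>2 \<le> 16 * n\<close> forces
    \<open>z \<le> 16 * n\<close> for natural numbers. \<open>Z'\<close> adds the cap that the tail
    estimate requires.\<close>
  define Z where "Z = {z \<in> PiE {1..n} (\<lambda>_. {..16 * n}). (\<Sum>i\<in>{1..n}. (real (z i))\<^sup>2) \<le> 16 * real n}"
  define Z' where "Z' = {z \<in> Z. \<forall>i\<in>{1..n}. (real (z i))\<^sup>2 \<le> 16 * sqrt (real r)}"
  define D where "D = 1280 * real n * sqrt (real r)"
  define bad where "bad = (\<lambda>z :: nat \<Rightarrow> nat. {E \<in> reg_graphs n r.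
     8 * (real r)\<^sup>2 * 16 + D \<le> \<bar>edge_sum n E (\<lambda>i. real (z i)) - real r / real n * (\<Sum>i\<in>{1..n}. real (z i))\<^sup>2\<bar>})"
  have finZ: "finite Z" using finite_PiE[of "{1..n}" "\<lambda>_. {..16 * n}"] by (simp add: Z_def)
  have finZ': "finite Z'" using finZ by (simp add: Z'_def)
  have sr: "1 \<le> sqrt (real r)" using r by simp
  have r2: "8 * (real r)\<^sup>2 * 16 + D \<le> 1408 * real n * sqrt (real r)"
  proof -
    have "(real r)\<^sup>2 \<le> real n" using n(1) by (metis of_nat_le_iff of_nat_power)
    also have "\<dots> \<le> real n * sqrt (real r)" using sr by (simp add: mult_le_cancel_left1)
    finally show ?thesis by (simp add: D_def)
  qed
  have each: "real (card (bad z)) \<le> 2 * real (card (reg_graphs n r)) * exp (real n / 2 - 20 * real n)"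
    if "z \<in> Z'" for z
  proof -
    have "real (card (bad z)) \<le> 2 * real (card (reg_graphs n r))
        * exp (real n / 2 - 1 / (4 * 16 * sqrt (real r)) * D)"
      unfolding bad_def
      by (rule edge_sum_tail[OF r _ refl n(2)]) (use that in \<open>auto simp: Z'_def Z_def\<close>)
    also have "1 / (4 * 16 * sqrt (real r)) * D = 20 * real n"
      using sr by (simp add: D_def)
    finally show ?thesis .
  qed
  have "{E \<in> reg_graphs n r. \<not> typical n r E} \<subseteq> (\<Union>z\<in>Z'. bad z)"
  proof
    fix E assume E: "E \<in> {E \<in> reg_graphs n r. \<not> typical n r E}"
    then obtain z :: "nat \<Rightarrow> nat" where z: "(\<Sum>i\<in>{1..n}. (real (z i))\<^sup>2) \<le> 16 * real n"
      "\<And>i. i \<in> {1..n} \<Longrightarrow> (real (z i))\<^sup>2 \<le> 16 * sqrt (real r)"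
      "1408 * real n * sqrt (real r) < \<bar>bil n (centred n r E) (\<lambda>i. real (z i)) (\<lambda>i. real (z i))\<bar>"
      unfolding lattice_bound_def by (auto simp: not_le)
    \<comment> \<open>Elements of \<open>PiE\<close> are \<open>undefined\<close> off the index set;
      restricting does not affect the form.\<close>
    define w where "w = restrict z {1..n}"
    have wz: "w i = z i" if "i \<in> {1..n}" for i using that by (simp add: w_def)
    have le: "z i \<le> 16 * n" if "i \<in> {1..n}" for i
    proof -
      have "(real (z i))\<^sup>2 \<le> (\<Sum>i\<in>{1..n}. (real (z i))\<^sup>2)"
        using that by (intro member_le_sum) auto
      also have "\<dots> \<le> 16 * real n" by (rule z(1))
      finally have "z i * z i \<le> 16 * n" by (simp add: power2_eq_square flip: of_nat_mult of_nat_le_iff)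
      then show ?thesis by (cases "z i = 0") (auto intro: order.trans[of _ "z i * z i"])
    qed
    have "w \<in> Z'"
      unfolding Z'_def Z_def using z(1,2) le wz
      by (auto simp: w_def restrict_def PiE_def extensional_def)
    moreover have "E \<in> bad w"
    proof -
      have "bil n (centred n r E) (\<lambda>i. real (w i)) (\<lambda>i. real (w i))
          = bil n (centred n r E) (\<lambda>i. real (z i)) (\<lambda>i. real (z i))"
        unfolding bil_def by (intro sum.cong refl) (simp add: wz)
      then show ?thesis using z(3) E r2 unfolding bad_def bil_centred[symmetric] by auto
    qed
    ultimately show "E \<in> (\<Union>z\<in>Z'. bad z)" by blast
  qed
  moreover have "finite (\<Union>z\<in>Z'. bad z)" using finZ' by (auto simp: bad_def finite_reg_graphs)
  ultimately have "card {E \<in> reg_graphs n r. \<not> typical n r E} \<le> card (\<Union>z\<in>Z'. bad z)"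
    by (intro card_mono)
  also have "\<dots> \<le> (\<Sum>z\<in>Z'. card (bad z))" by (rule card_UN_le[OF finZ'])
  finally have "real (card {E \<in> reg_graphs n r. \<not> typical n r E}) \<le> (\<Sum>z\<in>Z'. real (card (bad z)))"
    by (simp flip: of_nat_sum)
  also have "\<dots> \<le> (\<Sum>z\<in>Z'. 2 * real (card (reg_graphs n r)) * exp (real n / 2 - 20 * real n))"
    by (rule sum_mono) (rule each)
  also have "\<dots> = real (card Z') * (2 * real (card (reg_graphs n r)) * exp (real n / 2 - 20 * real n))"
    by simp
  also have "\<dots> \<le> exp ((16 + 1) * real n) * (exp (real n) * real (card (reg_graphs n r)) * exp (real n / 2 - 20 * real n))"
  proof (intro mult_mono)
    have "card Z' \<le> card Z" using finZ by (intro card_mono) (auto simp: Z'_def)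
    then show "real (card Z') \<le> exp ((16 + 1) * real n)"
      using card_lattice_ball[of n "16 * n" 16] unfolding Z_def by linarith
    have "2 \<le> 1 + real n" using r n(2) by simp
    also have "\<dots> \<le> exp (real n)" by (rule exp_ge_add_one_self)
    finally show "2 \<le> exp (real n)" .
  qed auto
  also have "\<dots> = real (card (reg_graphs n r)) * exp (- (3 / 2) * real n)"
    by (simp add: exp_add[symmetric] algebra_simps)
  also have "\<dots> \<le> real (card (reg_graphs n r)) * exp (- real n)"
    by (intro mult_left_mono) auto
  finally show ?thesis .
qed

section \<open>Consequences for vector colourings\<close>

lemma ip_gram_sum:
  "(\<Sum>i\<in>{1..n}. \<Sum>j\<in>{1..n}. ip n (v i) (v j) * x i * x j) = (\<Sum>l\<in>{1..n}. (\<Sum>i\<in>{1..n}. x i * v i l)\<^sup>2)"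
proof -
  have "(\<Sum>i\<in>{1..n}. \<Sum>j\<in>{1..n}. ip n (v i) (v j) * x i * x j)
      = (\<Sum>i\<in>{1..n}. \<Sum>j\<in>{1..n}. \<Sum>l\<in>{1..n}. (x i * v i l) * (x j * v j l))"
    unfolding ip_def sum_distrib_right by (intro sum.cong refl) simp
  also have "\<dots> = (\<Sum>i\<in>{1..n}. \<Sum>l\<in>{1..n}. \<Sum>j\<in>{1..n}. (x i * v i l) * (x j * v j l))"
    by (intro sum.cong refl sum.swap)
  also have "\<dots> = (\<Sum>l\<in>{1..n}. \<Sum>i\<in>{1..n}. \<Sum>j\<in>{1..n}. (x i * v i l) * (x j * v j l))"
    by (rule sum.swap)
  also have "\<dots> = (\<Sum>l\<in>{1..n}. (\<Sum>i\<in>{1..n}. x i * v i l)\<^sup>2)"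
    by (simp only: power2_eq_square sum_product)
  finally show ?thesis .
qed

lemma psd_ip: "psd n (\<lambda>i j. ip n (v i) (v j))"
  unfolding psd_def
proof (intro conjI ballI allI)
  show "ip n (v i) (v j) = ip n (v j) (v i)" for i j by (simp add: ip_def mult.commute)
  show "0 \<le> (\<Sum>i\<in>{1..n}. \<Sum>j\<in>{1..n}. ip n (v i) (v j) * x i * x j)" for x
    unfolding ip_gram_sum by (intro sum_nonneg) simp
qed

lemma psd_sum_nonneg: "psd n G \<Longrightarrow> 0 \<le> (\<Sum>i\<in>{1..n}. \<Sum>j\<in>{1..n}. G i j)"
  using psd_nonneg[of n G "\<lambda>_. 1"] by simp

lemma coloring_chain:
  "rigid_vector_coloring n E k v \<Longrightarrow> strict_vector_coloring n E k v"
  "strict_vector_coloring n E k v \<Longrightarrow> vector_coloring n E k v"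
  by (auto simp: rigid_vector_coloring_def strict_vector_coloring_def vector_coloring_def)

text \<open>The Gram matrix of a regular simplex.\<close>
lemma rigid_vector_coloring_simplex:
  assumes "2 \<le> n" "E \<subseteq> all_pairs n"
  shows "\<exists>v. rigid_vector_coloring n E (real n) v"
proof -
  define G where "G = (\<lambda>i j :: nat. if i = j then 1 else - 1 / (real n - 1))"
  have n1: "0 < real n - 1" using assms by simp
  have G_eq: "G i j = real n / (real n - 1) * of_bool (i = j) - 1 / (real n - 1)" for i j
    using n1 by (auto simp: G_def diff_divide_distrib[symmetric])
  have "psd n G"
    unfolding psd_def
  proof (intro conjI ballI allI)
    fix x :: "nat \<Rightarrow> real"
    have "(\<Sum>j\<in>{1..n}. G i j * x i * x j) = real n / (real n - 1) * (x i)\<^sup>2 - 1 / (real n - 1) * (x i * (\<Sum>j\<in>{1..n}. x j))"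
      if "i \<in> {1..n}" for i
    proof -
      have "(\<Sum>j\<in>{1..n}. G i j * x i * x j) = (\<Sum>j\<in>{1..n}. (if i = j then real n / (real n - 1) * (x i)\<^sup>2 else 0) - 1 / (real n - 1) * (x i * x j))"
        by (intro sum.cong refl) (auto simp: G_eq power2_eq_square algebra_simps)
      then show ?thesis using that by (simp add: sum_subtractf sum_distrib_left)
    qed
    then have "(\<Sum>i\<in>{1..n}. \<Sum>j\<in>{1..n}. G i j * x i * x j)
       = real n / (real n - 1) * (\<Sum>i\<in>{1..n}. (x i)\<^sup>2) - 1 / (real n - 1) * (\<Sum>i\<in>{1..n}. x i)\<^sup>2"
      by (simp only: sum_subtractf sum_distrib_left[symmetric] sum_distrib_right[symmetric] power2_eq_square cong: sum.cong)
    also have "\<dots> = (real n * (\<Sum>i\<in>{1..n}. (x i)\<^sup>2) - (\<Sum>i\<in>{1..n}. x i)\<^sup>2) / (real n - 1)"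
      by (simp add: diff_divide_distrib)
    also have "0 \<le> \<dots>"
      using n1 Cauchy_Schwarz_ineq_sum[of "\<lambda>_. 1" x "{1..n}"] by simp
    finally show "0 \<le> (\<Sum>i\<in>{1..n}. \<Sum>j\<in>{1..n}. G i j * x i * x j)" .
  qed (auto simp: G_def)
  then obtain v where v: "\<And>i j. i \<in> {1..n} \<Longrightarrow> j \<in> {1..n} \<Longrightarrow> G i j = ip n (v i) (v j)"
    using psd_gram[of n G] by blast
  have "i \<noteq> j" if "{i, j} \<in> E" for i j
    using that assms(2) pair_in_all_pairs[of i j n] by auto
  then have "rigid_vector_coloring n E (real n) v"
    unfolding rigid_vector_coloring_def unit_vecs_def
    by (auto simp: v[symmetric] G_def simp del: One_nat_def)
  then show ?thesis by blast
qed

text \<open>The sets of admissible \<open>k\<close> are nested. A real \<open>Inf\<close> respects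
  this only for nonempty sets bounded below; the regular simplex provides the element
  \<open>k = n\<close>, and 1 is a lower bound.\<close>

lemma theta_chain:
  assumes "2 \<le> n" "E \<subseteq> all_pairs n"
  shows "theta_bar_half n E \<le> theta_bar n E" "theta_bar n E \<le> theta_bar_2 n E"
proof -
  let ?V = "{k. k > 1 \<and> (\<exists>v. vector_coloring n E k v)}"
  let ?S = "{k. k > 1 \<and> (\<exists>v. strict_vector_coloring n E k v)}"
  let ?R = "{k. k > 1 \<and> (\<exists>v. rigid_vector_coloring n E k v)}"
  have "real n \<in> ?R" using rigid_vector_coloring_simplex[OF assms] assms(1) by simp
  then have ne: "?R \<noteq> {}" by blast
  have sub: "?R \<subseteq> ?S" "?S \<subseteq> ?V" using coloring_chain by blast+
  have bdd: "bdd_below ?V" "bdd_below ?S" by (rule bdd_belowI[of _ 1]; simp)+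
  show "theta_bar_half n E \<le> theta_bar n E"
    unfolding theta_bar_half_def theta_bar_def
    using ne sub(1) by (intro cInf_superset_mono[OF _ bdd(1) sub(2)]) blast
  show "theta_bar n E \<le> theta_bar_2 n E"
    unfolding theta_bar_def theta_bar_2_def
    by (rule cInf_superset_mono[OF ne bdd(2) sub(1)])
qed

lemma theta_bar_half_ge:
  assumes "2 \<le> n" "E \<subseteq> all_pairs n"
    and "\<And>k v. 1 < k \<Longrightarrow> vector_coloring n E k v \<Longrightarrow> c \<le> k"
  shows "c \<le> theta_bar_half n E"
  unfolding theta_bar_half_def
proof (rule cInf_greatest)
  show "{k. 1 < k \<and> (\<exists>v. vector_coloring n E k v)} \<noteq> {}"
  proof -
    obtain v where "rigid_vector_coloring n E (real n) v"
      using rigid_vector_coloring_simplex[OF assms(1,2)] by blast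
    then have "vector_coloring n E (real n) v" by (intro coloring_chain)
    moreover have "1 < real n" using assms(1) by simp
    ultimately show ?thesis by blast
  qed
qed (use assms(3) in auto)

text \<open>204 from rounding and Grothendieck's inequality, 1408 from the event
  \<open>typical\<close>.\<close>

definition disc_const :: real where "disc_const = 204 * 1408"

section \<open>Deterministic bounds for a typical graph\<close>

context
  fixes n r :: nat and E :: "nat set set"
  assumes r: "1 \<le> r" and E: "E \<in> reg_graphs n r" and ty: "typical n r E" and n: "1 \<le> n"
begin

lemma sqrt_r_ge_1: "1 \<le> sqrt (real r)"
  using r by simp

lemma sum_adj: "(\<Sum>i\<in>{1..n}. \<Sum>j\<in>{1..n}. adj E i j) = real r * real n"
proof -
  interpret regular_matrix n "real r" "adj E" by (rule regular_matrix_adj[OF E r])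
  have "(\<Sum>i\<in>{1..n}. \<Sum>j\<in>{1..n}. adj E i j) = (\<Sum>i\<in>{1..n}. real r)"
    by (intro sum.cong refl row_sum)
  then show ?thesis by simp
qed

lemma centred_psd_bound:
  assumes "psd n G" "\<And>i. i \<in> {1..n} \<Longrightarrow> G i i \<le> (p i)\<^sup>2"
    and "\<And>i. i \<in> {1..n} \<Longrightarrow> 0 \<le> p i" "small_vec n (sqrt (real r)) p"
  shows "\<bar>\<Sum>i\<in>{1..n}. \<Sum>j\<in>{1..n}. centred n r E i j * G i j\<bar> \<le> disc_const * (real n * sqrt (real r))"
  using psd_bound[OF centred_sym sqrt_r_ge_1 ty assms] by (simp add: disc_const_def)

lemma sum_adj_mult:
  "(\<Sum>i\<in>{1..n}. \<Sum>j\<in>{1..n}. adj E i j * G i j)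
    = (\<Sum>i\<in>{1..n}. \<Sum>j\<in>{1..n}. centred n r E i j * G i j) + real r / real n * (\<Sum>i\<in>{1..n}. \<Sum>j\<in>{1..n}. G i j)"
  unfolding sum_distrib_left sum.distrib[symmetric] by (simp add: centred_def algebra_simps)

lemma small_vec_one: "small_vec n (sqrt (real r)) (\<lambda>_. 1)"
  using sqrt_r_ge_1 by (simp add: small_vec_def)

text \<open>The all-one matrix pairs nonnegatively with a Gram matrix, so the adjacency matrix pairs
  with it to at least \<open>- disc_const * n * sqrt r\<close>, whereas the colouring forces at most
  \<open>- r * n / (k - 1)\<close>.\<close>

lemma vector_coloring_ge:
  assumes k: "1 < k" and v: "vector_coloring n E k v"
  shows "1 / disc_const * sqrt (real r) \<le> k"
proof -
  define G where "G = (\<lambda>i j. ip n (v i) (v j))"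
  have G: "psd n G" unfolding G_def by (rule psd_ip)
  have "- (disc_const * (real n * sqrt (real r))) \<le> (\<Sum>i\<in>{1..n}. \<Sum>j\<in>{1..n}. centred n r E i j * G i j)"
    using centred_psd_bound[OF G, of "\<lambda>_. 1"] small_vec_one v
    by (simp add: G_def vector_coloring_def unit_vecs_def abs_le_iff)
  also have "\<dots> \<le> (\<Sum>i\<in>{1..n}. \<Sum>j\<in>{1..n}. adj E i j * G i j)"
    unfolding sum_adj_mult using psd_sum_nonneg[OF G] by simp
  also have "\<dots> \<le> (\<Sum>i\<in>{1..n}. \<Sum>j\<in>{1..n}. adj E i j * (- 1 / (k - 1)))"
  proof (intro sum_mono)
    fix i j assume "i \<in> {1..n}" "j \<in> {1..n}"
    then show "adj E i j * G i j \<le> adj E i j * (- 1 / (k - 1))"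
      using v by (auto simp: adj_def G_def vector_coloring_def)
  qed
  also have "\<dots> = real r * real n * (- 1 / (k - 1))"
    unfolding sum_distrib_right[symmetric] sum_adj ..
  finally have "real r * real n / (k - 1) \<le> disc_const * (real n * sqrt (real r))" by simp
  then have "real r * real n \<le> disc_const * (real n * sqrt (real r)) * (k - 1)"
    using k by (simp add: pos_divide_le_eq)
  also have "\<dots> = (disc_const * (k - 1)) * (sqrt (real r) * real n)" by (simp add: mult_ac)
  also have "real r * real n = sqrt (real r) * (sqrt (real r) * real n)" by simp
  finally have "sqrt (real r) * (sqrt (real r) * real n) \<le> (disc_const * (k - 1)) * (sqrt (real r) * real n)" .
  moreover have "0 < sqrt (real r) * real n" using n sqrt_r_ge_1 by simp
  ultimately have "sqrt (real r) \<le> disc_const * (k - 1)" by (rule mult_right_le_imp_le)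
  then show ?thesis by (simp add: disc_const_def)
qed

text \<open>The entry sum \<open>?T\<close> of the Gram matrix is nonnegative, yet about
  \<open>n\<^sup>2\<close> entries are at most \<open>- c\<close>. Only edges can compensate, and
  they contribute at most \<open>disc_const * n * sqrt r + (r / n) * ?T\<close>; since
  \<open>r < n\<close>, the last term is moved to the left.\<close>

lemma compl_vector_coloring_ge:
  assumes k: "1 < k" and v: "vector_coloring n (compl_graph n E) k v" and rn: "2 * (real r + 1) \<le> real n"
  shows "1 / (2 * (1 + disc_const)) * real n / sqrt (real r) \<le> k"
proof -
  define G where "G = (\<lambda>i j. ip n (v i) (v j))"
  define c where "c = 1 / (k - 1)"
  have c0: "0 < c" using k by (simp add: c_def)
  have G: "psd n G" unfolding G_def by (rule psd_ip)
  have unit: "G i i = 1" if "i \<in> {1..n}" for i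
    using v that by (simp add: G_def vector_coloring_def unit_vecs_def)
  let ?T = "\<Sum>i\<in>{1..n}. \<Sum>j\<in>{1..n}. G i j"
  \<comment> \<open>Entrywise: equality on the diagonal and on edges, and \<open>- c\<close> on the
    remaining pairs.\<close>
  have "?T \<le> (\<Sum>i\<in>{1..n}. \<Sum>j\<in>{1..n}. adj E i j * G i j + (if i = j then 1 + c else 0) - c + c * adj E i j)"
  proof (intro sum_mono)
    fix i j assume ij: "i \<in> {1..n}" "j \<in> {1..n}"
    have "{i} \<notin> E" using reg_graph_edge[OF E, of i i] by auto
    moreover have "G i j \<le> - c" if "i \<noteq> j" "{i, j} \<notin> E"
    proof -
      have "{i, j} \<in> compl_graph n E" using that ij by (simp add: compl_graph_def pair_in_all_pairs)
      then show ?thesis using v ij by (simp add: G_def c_def vector_coloring_def)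
    qed
    ultimately show "G i j \<le> adj E i j * G i j + (if i = j then 1 + c else 0) - c + c * adj E i j"
      using unit[OF ij(1)] by (auto simp: adj_def)
  qed
  also have "\<dots> = (\<Sum>i\<in>{1..n}. \<Sum>j\<in>{1..n}. adj E i j * G i j) + real n * (1 + c) - c * (real n * real n) + c * (real r * real n)"
    unfolding sum_adj[symmetric] by (simp add: sum.distrib sum_subtractf sum_distrib_left)
  also have "\<dots> \<le> disc_const * (real n * sqrt (real r)) + real r / real n * ?T + real n * (1 + c) - c * (real n * real n) + c * (real r * real n)"
    unfolding sum_adj_mult using centred_psd_bound[OF G, of "\<lambda>_. 1"] small_vec_one unit by simp
  finally have "(1 - real r / real n) * ?T
     \<le> real n * (disc_const * sqrt (real r) + 1 - c * (real n - real r - 1))"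
    by (simp add: algebra_simps)
  moreover have "0 \<le> (1 - real r / real n) * ?T"
    using psd_sum_nonneg[OF G] rn n by (intro mult_nonneg_nonneg) auto
  ultimately have "0 \<le> real n * (disc_const * sqrt (real r) + 1 - c * (real n - real r - 1))" by linarith
  then have "c * (real n - real r - 1) \<le> disc_const * sqrt (real r) + 1"
    using n by (simp add: zero_le_mult_iff)
  moreover have "c * (real n / 2) \<le> c * (real n - real r - 1)" using c0 rn by (intro mult_left_mono) auto
  ultimately have "c * (real n / 2) \<le> (1 + disc_const) * sqrt (real r)"
    using sqrt_r_ge_1 unfolding distrib_right by linarith
  then have "(k - 1) * (c * (real n / 2)) \<le> (k - 1) * ((1 + disc_const) * sqrt (real r))"
    using k by (intro mult_left_mono) auto
  moreover have "(k - 1) * (c * (real n / 2)) = real n / 2"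
  proof -
    have "(k - 1) * c = 1" using k by (simp add: c_def)
    then show ?thesis by (simp only: mult.assoc[symmetric])
  qed
  ultimately have "real n / 2 \<le> (1 + disc_const) * sqrt (real r) * (k - 1)"
    by (simp only: mult_ac)
  also have "\<dots> \<le> (1 + disc_const) * sqrt (real r) * k"
    using sqrt_r_ge_1 by (intro mult_left_mono) (auto simp: disc_const_def)
  finally have "real n / 2 \<le> k * ((1 + disc_const) * sqrt (real r))" by (simp add: mult_ac)
  moreover have "0 < (1 + disc_const) * sqrt (real r)" using sqrt_r_ge_1 by (simp add: disc_const_def)
  ultimately have "real n / 2 / ((1 + disc_const) * sqrt (real r)) \<le> k" by (simp only: pos_divide_le_eq)
  then show ?thesis by (simp only: divide_divide_eq_left mult.assoc times_divide_eq_left mult_1_left)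
qed

text \<open>Only the part of each vector \<open>b i\<close> along the direction of the total sum matters. Rescaling
  the vectors accordingly gives vectors of norm \<open>p i \<le> 1\<close>; since all of them are this short, the
  discrepancy bound applies without any control of high-weight pairs.\<close>
lemma psd_edge_nonpos_bound:
  assumes B: "psd n B" "(\<Sum>i\<in>{1..n}. B i i) = 1"
    and nonpos: "\<And>i j. i \<in> {1..n} \<Longrightarrow> j \<in> {1..n} \<Longrightarrow> {i, j} \<in> E \<Longrightarrow> B i j \<le> 0"
  shows "(\<Sum>i\<in>{1..n}. \<Sum>j\<in>{1..n}. B i j) \<le> disc_const * (real n / sqrt (real r))"
proof -
  let ?\<beta> = "\<Sum>i\<in>{1..n}. \<Sum>j\<in>{1..n}. B i j"
  obtain b where b: "\<And>i j. i \<in> {1..n} \<Longrightarrow> j \<in> {1..n} \<Longrightarrow> B i j = ip n (b i) (b j)"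
    using psd_gram[OF B(1)] by blast
  define s where "s = (\<lambda>l. \<Sum>i\<in>{1..n}. b i l)"
  define w where "w = sqrt ?\<beta>"
  define len where "len = (\<lambda>i. sqrt (B i i))"
  \<comment> \<open>The component of \<open>b i\<close> along the unit vector \<open>s / w\<close>.
    Then \<open>p i\<close> is the positive part of the cosine, zero for a zero vector because of
    division by zero, and \<open>q i * b i\<close> has norm \<open>p i\<close>. As \<open>q\<close>
    is nonnegative, entries of \<open>G\<close> on edges remain nonpositive.\<close>
  define c where "c = (\<lambda>i. ip n (b i) s / w)"
  define p where "p = (\<lambda>i. max 0 (c i / len i))"
  define q where "q = (\<lambda>i. p i / len i)"
  define P where "P = (\<Sum>i\<in>{1..n}. (p i)\<^sup>2)"
  define G where "G = (\<lambda>i j. q i * q j * B i j)"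
  have rhs0: "0 \<le> disc_const * (real n / sqrt (real r))" by (simp add: disc_const_def)
  have beta: "?\<beta> = (\<Sum>l\<in>{1..n}. (s l)\<^sup>2)"
  proof -
    have "?\<beta> = (\<Sum>i\<in>{1..n}. \<Sum>j\<in>{1..n}. ip n (b i) (b j) * 1 * 1)"
      by (intro sum.cong refl) (simp add: b)
    also have "\<dots> = (\<Sum>l\<in>{1..n}. (s l)\<^sup>2)" unfolding ip_gram_sum s_def by simp
    finally show ?thesis .
  qed
  show ?thesis
  proof (cases "?\<beta> \<le> 0")
    case True
    then show ?thesis using rhs0 by linarith
  next
    case False
    then have w: "0 < w" "w\<^sup>2 = ?\<beta>" by (auto simp: w_def)
    have len0: "0 \<le> len i" and len2: "(len i)\<^sup>2 = B i i" if "i \<in> {1..n}" for i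
      using psd_diag[OF B(1) that] by (auto simp: len_def)
    have p0: "0 \<le> p i" for i by (simp add: p_def)
    have c_sq: "(c i)\<^sup>2 \<le> (len i)\<^sup>2" if "i \<in> {1..n}" for i
    proof -
      have "(ip n (b i) s)\<^sup>2 \<le> (\<Sum>l\<in>{1..n}. (b i l)\<^sup>2) * (\<Sum>l\<in>{1..n}. (s l)\<^sup>2)"
        unfolding ip_def by (rule Cauchy_Schwarz_ineq_sum)
      also have "\<dots> = (len i)\<^sup>2 * w\<^sup>2"
        using len2[OF that] b[OF that that] w(2) beta by (simp add: ip_def power2_eq_square)
      finally show ?thesis using w(1) by (simp add: c_def power_divide pos_divide_le_eq)
    qed
    have p1: "p i \<le> 1" if "i \<in> {1..n}" for i
    proof -
      have "\<bar>c i\<bar> \<le> len i" using c_sq[OF that] len0[OF that] by (simp add: abs_le_square_iff[symmetric])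
      then have "c i / len i \<le> 1" using len0[OF that] by (cases "len i = 0") (auto simp: divide_le_eq)
      then show ?thesis by (simp add: p_def)
    qed
    have c_le: "c i \<le> len i * p i" if "i \<in> {1..n}" for i
    proof (cases "len i = 0")
      case True
      then show ?thesis using c_sq[OF that] by simp
    next
      case False
      then have "c i = len i * (c i / len i)" by simp
      also have "\<dots> \<le> len i * p i" using len0[OF that] by (intro mult_left_mono) (auto simp: p_def)
      finally show ?thesis .
    qed
    have qc: "q i * c i = (p i)\<^sup>2" for i
      by (auto simp: q_def p_def max_def power2_eq_square)
    have sum_ip: "(\<Sum>i\<in>{1..n}. u i * ip n (b i) s) = (\<Sum>l\<in>{1..n}. (\<Sum>i\<in>{1..n}. u i * b i l) * s l)" for u
    proof -
      have "(\<Sum>i\<in>{1..n}. u i * ip n (b i) s) = (\<Sum>i\<in>{1..n}. \<Sum>l\<in>{1..n}. u i * b i l * s l)"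
        by (simp add: ip_def sum_distrib_left mult.assoc)
      also have "\<dots> = (\<Sum>l\<in>{1..n}. \<Sum>i\<in>{1..n}. u i * b i l * s l)" by (rule sum.swap)
      finally show ?thesis by (simp add: sum_distrib_right)
    qed
    \<comment> \<open>The components along the total sum add up to its length; Cauchy-Schwarz with
      trace one then gives \<open>w\<^sup>2 \<le> P\<close>.\<close>
    have "w = (\<Sum>i\<in>{1..n}. c i)"
    proof -
      have "(\<Sum>i\<in>{1..n}. c i) = (\<Sum>i\<in>{1..n}. 1 * ip n (b i) s) / w"
        by (simp add: c_def sum_divide_distrib)
      also have "\<dots> = w\<^sup>2 / w"
        unfolding sum_ip w(2) beta by (simp add: s_def power2_eq_square)
      finally show ?thesis using w(1) by (simp add: power2_eq_square)
    qed
    also have "\<dots> \<le> (\<Sum>i\<in>{1..n}. len i * p i)" by (rule sum_mono) (rule c_le)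
    finally have "w\<^sup>2 \<le> (\<Sum>i\<in>{1..n}. len i * p i)\<^sup>2" using w(1) by (intro power_mono) auto
    also have "\<dots> \<le> (\<Sum>i\<in>{1..n}. (len i)\<^sup>2) * P" unfolding P_def by (rule Cauchy_Schwarz_ineq_sum)
    also have "(\<Sum>i\<in>{1..n}. (len i)\<^sup>2) = 1" unfolding B(2)[symmetric] by (intro sum.cong refl len2)
    finally have beta_P: "?\<beta> \<le> P" using w(2) by simp
    have G_psd: "psd n G"
      unfolding psd_def
    proof (intro conjI ballI allI)
      fix x
      have "0 \<le> (\<Sum>i\<in>{1..n}. \<Sum>j\<in>{1..n}. B i j * (q i * x i) * (q j * x j))" by (rule psd_nonneg[OF B(1)])
      also have "\<dots> = (\<Sum>i\<in>{1..n}. \<Sum>j\<in>{1..n}. G i j * x i * x j)" by (simp add: G_def mult_ac)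
      finally show "0 \<le> (\<Sum>i\<in>{1..n}. \<Sum>j\<in>{1..n}. G i j * x i * x j)" .
    qed (simp add: G_def psd_sym[OF B(1)])
    have G_diag: "G i i \<le> (p i)\<^sup>2" if "i \<in> {1..n}" for i
      using len2[OF that] by (cases "len i = 0") (auto simp: G_def q_def power2_eq_square)
    \<comment> \<open>The vector \<open>\<Sum> q i * b i\<close> has component
      \<open>\<Sum> q i * c i = P\<close> along \<open>s / w\<close>, so its squared norm is at
      least \<open>P\<^sup>2\<close>.\<close>
    have G_sum: "P\<^sup>2 \<le> (\<Sum>i\<in>{1..n}. \<Sum>j\<in>{1..n}. G i j)"
    proof -
      have "P = (\<Sum>i\<in>{1..n}. q i * ip n (b i) s) / w"
        unfolding P_def qc[symmetric] by (simp add: c_def sum_divide_distrib)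
      then have "w\<^sup>2 * P\<^sup>2 = (\<Sum>l\<in>{1..n}. (\<Sum>i\<in>{1..n}. q i * b i l) * s l)\<^sup>2"
        using w(1) unfolding sum_ip by (simp add: power_divide)
      also have "\<dots> \<le> (\<Sum>l\<in>{1..n}. (\<Sum>i\<in>{1..n}. q i * b i l)\<^sup>2) * (\<Sum>l\<in>{1..n}. (s l)\<^sup>2)"
        by (rule Cauchy_Schwarz_ineq_sum)
      also have "(\<Sum>l\<in>{1..n}. (\<Sum>i\<in>{1..n}. q i * b i l)\<^sup>2) = (\<Sum>i\<in>{1..n}. \<Sum>j\<in>{1..n}. ip n (b i) (b j) * q i * q j)"
        by (rule ip_gram_sum[symmetric])
      also have "\<dots> = (\<Sum>i\<in>{1..n}. \<Sum>j\<in>{1..n}. G i j)"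
        by (intro sum.cong refl) (simp add: G_def b)
      finally have "w\<^sup>2 * P\<^sup>2 \<le> w\<^sup>2 * (\<Sum>i\<in>{1..n}. \<Sum>j\<in>{1..n}. G i j)"
        unfolding w(2) beta by (simp add: mult.commute)
      then show ?thesis using w(1) by simp
    qed
    have adj_le: "(\<Sum>i\<in>{1..n}. \<Sum>j\<in>{1..n}. adj E i j * G i j) \<le> 0"
    proof (intro sum_nonpos)
      fix i j assume ij: "i \<in> {1..n}" "j \<in> {1..n}"
      have "0 \<le> q i * q j" using p0 len0[OF ij(1)] len0[OF ij(2)] by (simp add: q_def)
      then show "adj E i j * G i j \<le> 0"
        using nonpos[OF ij] by (auto simp: adj_def G_def mult_nonneg_nonpos)
    qed
    have "P \<le> disc_const * (real n / sqrt (real r))"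
    \<comment> \<open>A small \<open>P\<close> already satisfies the claim. Otherwise scaling
      \<open>G\<close> by \<open>t = n / P\<close> makes the squared norms sum to at most
      \<open>n\<close>, and the case assumption is exactly the cap
      \<open>t \<le> sqrt r\<close>.\<close>
    proof (cases "P \<le> real n / sqrt (real r)")
      case True
      also have "real n / sqrt (real r) \<le> disc_const * (real n / sqrt (real r))"
        by (simp add: disc_const_def divide_right_mono)
      finally show ?thesis .
    next
      case False
      define t where "t = real n / P"
      have P0: "0 < P" using w beta_P False by (smt (verit) divide_nonneg_nonneg of_nat_0_le_iff real_sqrt_ge_zero)
      have t0: "0 < t" and tP: "t * P = real n" using P0 n by (auto simp: t_def)
      have tq: "t \<le> sqrt (real r)"
        using False P0 sqrt_r_ge_1 by (simp add: t_def field_simps)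
      have "\<bar>\<Sum>i\<in>{1..n}. \<Sum>j\<in>{1..n}. centred n r E i j * (t * G i j)\<bar> \<le> disc_const * (real n * sqrt (real r))"
      proof (rule centred_psd_bound[where p = "\<lambda>i. sqrt t * p i"])
        have "(\<Sum>i\<in>{1..n}. \<Sum>j\<in>{1..n}. t * G i j * x i * x j) = t * (\<Sum>i\<in>{1..n}. \<Sum>j\<in>{1..n}. G i j * x i * x j)" for x
          by (simp add: sum_distrib_left mult.assoc)
        then show "psd n (\<lambda>i j. t * G i j)"
          using G_psd t0 by (simp add: psd_def)
        show "t * G i i \<le> (sqrt t * p i)\<^sup>2" if "i \<in> {1..n}" for i
          using G_diag[OF that] t0 by (simp add: power_mult_distrib)
        show "0 \<le> sqrt t * p i" for i using t0 p0 by simp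
        show "small_vec n (sqrt (real r)) (\<lambda>i. sqrt t * p i)"
          unfolding small_vec_def
        proof (intro conjI ballI)
          show "(\<Sum>i\<in>{1..n}. (sqrt t * p i)\<^sup>2) \<le> real n"
            using t0 tP by (simp add: power_mult_distrib P_def sum_distrib_left)
          fix i assume "i \<in> {1..n}"
          then have "(p i)\<^sup>2 \<le> 1" using p0 p1 by (simp add: power_le_one)
          then have "t * (p i)\<^sup>2 \<le> t * 1" using t0 by (intro mult_left_mono) auto
          also have "\<dots> \<le> sqrt (real r)" using tq by simp
          finally show "(sqrt t * p i)\<^sup>2 \<le> sqrt (real r)" using t0 by (simp add: power_mult_distrib)
        qed
      qed
      moreover have "(\<Sum>i\<in>{1..n}. \<Sum>j\<in>{1..n}. centred n r E i j * (t * G i j))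
         = t * (\<Sum>i\<in>{1..n}. \<Sum>j\<in>{1..n}. centred n r E i j * G i j)"
        by (simp add: sum_distrib_left mult_ac)
      ultimately have "t * (- (\<Sum>i\<in>{1..n}. \<Sum>j\<in>{1..n}. centred n r E i j * G i j)) \<le> disc_const * (real n * sqrt (real r))"
        by (simp add: abs_le_iff)
      \<comment> \<open>The entry sum at least \<open>P\<^sup>2\<close> must be offset by the
        centred part, the edge part being nonpositive. With \<open>t * P = n\<close> this becomes
        \<open>r * P \<le> disc_const * n * sqrt r\<close>.\<close>
      moreover have "real r / real n * P\<^sup>2 \<le> - (\<Sum>i\<in>{1..n}. \<Sum>j\<in>{1..n}. centred n r E i j * G i j)"
        using adj_le mult_left_mono[OF G_sum, of "real r / real n"] unfolding sum_adj_mult by simp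
      then have "t * (real r / real n * P\<^sup>2) \<le> t * (- (\<Sum>i\<in>{1..n}. \<Sum>j\<in>{1..n}. centred n r E i j * G i j))"
        using t0 by (intro mult_left_mono) auto
      moreover have "t * (real r / real n * P\<^sup>2) = sqrt (real r) * (sqrt (real r) * P)"
        using P0 n by (simp add: t_def power2_eq_square)
      ultimately have "sqrt (real r) * (sqrt (real r) * P) \<le> sqrt (real r) * (disc_const * real n)"
        by (simp add: mult_ac)
      then have "sqrt (real r) * P \<le> disc_const * real n" using sqrt_r_ge_1 by simp
      then show ?thesis using sqrt_r_ge_1 by (simp add: pos_le_divide_eq mult.commute)
    qed
    with beta_P show ?thesis by linarith
  qed
qed

end

section \<open>Semidefinite duality\<close>

text \<open>Entries outside the square are fixed at zero so that the set is compact in the product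
  topology on functions.\<close>

definition spectrahedron :: "nat \<Rightarrow> (nat \<Rightarrow> nat \<Rightarrow> real) set" where
  "spectrahedron n = {B. psd n B \<and> (\<Sum>i\<in>{1..n}. B i i) = 1 \<and> (\<forall>i j. i \<notin> {1..n} \<or> j \<notin> {1..n} \<longrightarrow> B i j = 0)}"

lemma continuous_on_entry: "continuous_on S (\<lambda>B :: nat \<Rightarrow> nat \<Rightarrow> real. B i j)"
  by (rule continuous_on_product_then_coordinatewise[OF continuous_on_product_then_coordinatewise[OF continuous_on_id]])

text \<open>Trace one and nonnegative 2 by 2 minors confine all entries to \<open>[-1, 1]\<close>;
  the box is compact by Tychonoff, and the defining conditions are closed.\<close>

lemma compact_spectrahedron: "compact (spectrahedron n)"
proof -
  have "compactin (product_topology (\<lambda>j. euclidean) UNIV) (PiE UNIV (\<lambda>j :: nat. {- 1 .. 1 :: real}))"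
    unfolding compactin_PiE by simp
  then have row: "compact (PiE UNIV (\<lambda>j :: nat. {- 1 .. 1 :: real}))"
    by (simp add: euclidean_product_topology)
  have "compactin (product_topology (\<lambda>i. euclidean) UNIV) (PiE UNIV (\<lambda>i :: nat. PiE UNIV (\<lambda>j :: nat. {- 1 .. 1 :: real})))"
    unfolding compactin_PiE using row by simp
  then have box: "compact (PiE UNIV (\<lambda>i :: nat. PiE UNIV (\<lambda>j :: nat. {- 1 .. 1 :: real})))" (is "compact ?box")
    by (simp add: euclidean_product_topology)
  have "closed (spectrahedron n)"
    unfolding spectrahedron_def psd_def Ball_def
    by (intro closed_Collect_conj closed_Collect_all closed_Collect_imp open_Collect_const
        closed_Collect_eq closed_Collect_le continuous_on_entry continuous_intros)
  moreover have "spectrahedron n \<subseteq> ?box"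
  proof
    fix B assume B: "B \<in> spectrahedron n"
    then have P: "psd n B" "(\<Sum>i\<in>{1..n}. B i i) = 1" by (auto simp: spectrahedron_def)
    have diag: "B i i \<le> 1" if "i \<in> {1..n}" for i
      unfolding P(2)[symmetric] by (rule member_le_sum[OF that]) (use psd_diag[OF P(1)] in auto)
    have "\<bar>B i j\<bar> \<le> 1" for i j
    proof (cases "i \<in> {1..n} \<and> j \<in> {1..n}")
      case True
      then have "(B i j)\<^sup>2 \<le> B i i * B j j" using psd_entry_sq_le[OF P(1)] by blast
      also have "\<dots> \<le> 1 * 1" using True diag psd_diag[OF P(1)] by (intro mult_mono) auto
      finally show ?thesis by (simp add: abs_square_le_1)
    next
      case False
      then show ?thesis using B by (auto simp: spectrahedron_def)
    qed
    then show "B \<in> ?box" by (auto simp: abs_le_iff minus_le_iff)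
  qed
  ultimately have "compact (?box \<inter> spectrahedron n)" "?box \<inter> spectrahedron n = spectrahedron n"
    using compact_Int_closed[OF box] by blast+
  then show ?thesis by simp
qed

lemma spectrahedron_convex:
  assumes "A \<in> spectrahedron n" "B \<in> spectrahedron n" "0 \<le> t" "t \<le> 1"
  shows "(\<lambda>i j. A i j + t * (B i j - A i j)) \<in> spectrahedron n"
proof -
  have "(\<Sum>i\<in>{1..n}. \<Sum>j\<in>{1..n}. (A i j + t * (B i j - A i j)) * x i * x j)
     = (1 - t) * (\<Sum>i\<in>{1..n}. \<Sum>j\<in>{1..n}. A i j * x i * x j) + t * (\<Sum>i\<in>{1..n}. \<Sum>j\<in>{1..n}. B i j * x i * x j)" for x
    unfolding sum_distrib_left sum.distrib[symmetric] by (intro sum.cong refl) (simp add: algebra_simps)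
  moreover have "(\<Sum>i\<in>{1..n}. A i i + t * (B i i - A i i)) = (\<Sum>i\<in>{1..n}. A i i) + t * ((\<Sum>i\<in>{1..n}. B i i) - (\<Sum>i\<in>{1..n}. A i i))"
    by (simp only: sum.distrib sum_distrib_left[symmetric] sum_subtractf)
  ultimately show ?thesis
    using assms by (auto simp: spectrahedron_def psd_def)
qed

text \<open>A one-sided Taylor bound with derivative \<open>2 * max 0 a\<close>; it replaces
  differentiation of the penalty.\<close>

lemma pos_part_sq_le:
  fixes a d :: real
  shows "(max 0 (a + d))\<^sup>2 \<le> (max 0 a)\<^sup>2 + 2 * max 0 a * d + d\<^sup>2"
proof -
  have "(max 0 a + d)\<^sup>2 = (max 0 a)\<^sup>2 + 2 * max 0 a * d + d\<^sup>2"
    by (simp add: power2_eq_square algebra_simps)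
  moreover have "(max 0 (a + d))\<^sup>2 \<le> (max 0 a + d)\<^sup>2"
  proof (cases "a + d \<le> 0")
    case False
    then show ?thesis by (intro power_mono) auto
  qed simp
  ultimately show ?thesis by simp
qed

text \<open>The first-order condition at the start of a segment along which a minimised function
  grows by at most this quadratic.\<close>

lemma slope_nonneg:
  fixes L Q :: real
  assumes "\<And>t. 0 < t \<Longrightarrow> t \<le> 1 \<Longrightarrow> 0 \<le> 2 * t * L + t\<^sup>2 * Q"
  shows "0 \<le> L"
proof (rule ccontr)
  assume "\<not> 0 \<le> L"
  then have L: "L < 0" by simp
  define t where "t = min 1 (- L / (\<bar>Q\<bar> + 1))"
  have "0 < - L / (\<bar>Q\<bar> + 1)" using L by (intro divide_pos_pos) auto
  then have t: "0 < t" "t \<le> 1" by (auto simp: t_def)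
  have "t * (\<bar>Q\<bar> + 1) \<le> - L" using pos_le_divide_eq[of "\<bar>Q\<bar> + 1" t "- L"] by (simp add: t_def)
  then have "t * Q \<le> - L" using t by (smt (verit) abs_ge_self mult_left_mono)
  then have "2 * L + t * Q < 0" using L by linarith
  then have "t * (2 * L + t * Q) < 0" using t by (simp add: mult_pos_neg)
  then show False using assms[OF t] by (simp add: power2_eq_square algebra_simps)
qed

text \<open>Semidefinite duality: if no feasible point of the dual program attains the value \<open>k\<close>, the
  minimiser over the (compact, convex) spectrahedron of the squared constraint violation provides,
  through its first-order optimality condition, the multipliers of the primal program.\<close>
lemma rigid_compl_coloring_exists:
  assumes E: "E \<subseteq> all_pairs n" and n: "1 \<le> n" and k: "1 < k"
    and dual: "\<And>B. psd n B \<Longrightarrow> (\<Sum>i\<in>{1..n}. B i i) = 1 \<Longrightarrow>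
        (\<And>i j. i \<in> {1..n} \<Longrightarrow> j \<in> {1..n} \<Longrightarrow> {i, j} \<in> E \<Longrightarrow> B i j \<le> 0) \<Longrightarrow>
        (\<Sum>i\<in>{1..n}. \<Sum>j\<in>{1..n}. B i j) < k"
  shows "\<exists>v. rigid_vector_coloring n (compl_graph n E) k v"
proof -
  define J where "J = (\<lambda>B :: nat \<Rightarrow> nat \<Rightarrow> real. \<Sum>i\<in>{1..n}. \<Sum>j\<in>{1..n}. B i j)"
  \<comment> \<open>On the spectrahedron this vanishes exactly at dual feasible points of value at
    least \<open>k\<close>, which the hypothesis \<open>dual\<close> excludes.\<close>
  define viol where "viol = (\<lambda>B. (max 0 (k - J B))\<^sup>2 + (\<Sum>i\<in>{1..n}. \<Sum>j\<in>{1..n}. adj E i j * (max 0 (B i j))\<^sup>2))"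
  have rank_one: "(\<lambda>i j. if i \<in> {1..n} \<and> j \<in> {1..n} then x i * x j / (\<Sum>l\<in>{1..n}. (x l)\<^sup>2) else 0) \<in> spectrahedron n"
    if "(\<Sum>l\<in>{1..n}. (x l)\<^sup>2) \<noteq> 0" for x
  proof -
    let ?s = "\<Sum>l\<in>{1..n}. (x l)\<^sup>2"
    have s0: "0 \<le> ?s" by (simp add: sum_nonneg)
    have "(\<Sum>i\<in>{1..n}. \<Sum>j\<in>{1..n}. x i * x j / ?s * y i * y j) = (\<Sum>i\<in>{1..n}. x i * y i)\<^sup>2 / ?s" for y
      by (simp add: power2_eq_square sum_product sum_divide_distrib mult_ac)
    moreover have "(\<Sum>i\<in>{1..n}. x i * x i / ?s) = 1"
      using that by (simp add: sum_divide_distrib[symmetric] power2_eq_square)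
    ultimately show ?thesis using s0 by (simp add: spectrahedron_def psd_def mult.commute)
  qed
  define I where "I = (\<lambda>i j :: nat. if i = j \<and> i \<in> {1..n} then 1 / real n else 0)"
  have I: "I \<in> spectrahedron n"
  proof -
    have "(\<Sum>i\<in>{1..n}. \<Sum>j\<in>{1..n}. I i j * x i * x j) = (\<Sum>i\<in>{1..n}. (x i)\<^sup>2) / real n" for x
    proof -
      have "(\<Sum>j\<in>{1..n}. I i j * x i * x j) = (x i)\<^sup>2 / real n" if "i \<in> {1..n}" for i
      proof -
        have "(\<Sum>j\<in>{1..n}. I i j * x i * x j) = (\<Sum>j\<in>{1..n}. if i = j then (x i)\<^sup>2 / real n else 0)"
          by (intro sum.cong refl) (use that in \<open>auto simp: I_def power2_eq_square\<close>)
        then show ?thesis using that by simp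
      qed
      then show ?thesis by (simp add: sum_divide_distrib)
    qed
    then show ?thesis using n by (auto simp: spectrahedron_def psd_def I_def sum_nonneg)
  qed
  have "continuous_on (spectrahedron n) viol"
    unfolding viol_def J_def by (intro continuous_on_entry continuous_intros)
  then obtain B0 where B0: "B0 \<in> spectrahedron n" and min: "\<And>B. B \<in> spectrahedron n \<Longrightarrow> viol B0 \<le> viol B"
    using continuous_attains_inf[OF compact_spectrahedron] I by blast
  \<comment> \<open>Half the gradient of the penalty at its minimiser: \<open>\<alpha>\<close> is
    the multiplier of the value constraint, \<open>N\<close> that of the edge constraints.\<close>
  define \<alpha> where "\<alpha> = max 0 (k - J B0)"
  define N where "N = (\<lambda>i j. adj E i j * max 0 (B0 i j))"
  have viol0: "viol B0 = \<alpha>\<^sup>2 + (\<Sum>i\<in>{1..n}. \<Sum>j\<in>{1..n}. N i j * B0 i j)"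
  proof -
    have "adj E i j * (max 0 (B0 i j))\<^sup>2 = N i j * B0 i j" for i j
      by (auto simp: N_def max_def power2_eq_square)
    then show ?thesis by (simp add: viol_def \<alpha>_def)
  qed
  have viol_pos: "0 < viol B0"
  proof (rule ccontr)
    assume "\<not> 0 < viol B0"
    moreover have "0 \<le> (\<Sum>i\<in>{1..n}. \<Sum>j\<in>{1..n}. adj E i j * (max 0 (B0 i j))\<^sup>2)"
      by (intro sum_nonneg) (simp add: adj_def)
    ultimately have z: "(max 0 (k - J B0))\<^sup>2 = 0" "(\<Sum>i\<in>{1..n}. \<Sum>j\<in>{1..n}. adj E i j * (max 0 (B0 i j))\<^sup>2) = 0"
      using zero_le_power2[of "max 0 (k - J B0)"] unfolding viol_def by linarith+
    have "B0 i j \<le> 0" if ij: "i \<in> {1..n}" "j \<in> {1..n}" "{i, j} \<in> E" for i j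
    proof -
      have "(\<Sum>j\<in>{1..n}. adj E i j * (max 0 (B0 i j))\<^sup>2) = 0"
        using z(2) ij by (subst (asm) sum_nonneg_eq_0_iff) (auto simp: adj_def intro!: sum_nonneg)
      then have "adj E i j * (max 0 (B0 i j))\<^sup>2 = 0"
        using ij by (subst (asm) sum_nonneg_eq_0_iff) (auto simp: adj_def)
      then show ?thesis using ij by (simp add: adj_def max_def split: if_splits)
    qed
    then have "J B0 < k" unfolding J_def using B0 by (intro dual) (auto simp: spectrahedron_def)
    with z(1) show False by simp
  qed
  \<comment> \<open>First-order optimality along the segment from \<open>B0\<close> to
    \<open>B\<close>: one linear functional separates the whole spectrahedron from the dual
    target.\<close>
  have opt: "\<alpha> * J B - (\<Sum>i\<in>{1..n}. \<Sum>j\<in>{1..n}. N i j * B i j) \<le> \<alpha> * k - viol B0"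
    if B: "B \<in> spectrahedron n" for B
  proof -
    define L where "L = \<alpha> * (J B0 - J B) + (\<Sum>i\<in>{1..n}. \<Sum>j\<in>{1..n}. N i j * (B i j - B0 i j))"
    define Q where "Q = (J B0 - J B)\<^sup>2 + (\<Sum>i\<in>{1..n}. \<Sum>j\<in>{1..n}. adj E i j * (B i j - B0 i j)\<^sup>2)"
    have "0 \<le> L"
    proof (rule slope_nonneg)
      fix t :: real assume t: "0 < t" "t \<le> 1"
      let ?B = "\<lambda>i j. B0 i j + t * (B i j - B0 i j)"
      have J: "J ?B = J B0 + t * (J B - J B0)"
        by (simp only: J_def sum.distrib sum_distrib_left[symmetric] sum_subtractf)
      have "viol B0 \<le> viol ?B" using t by (intro min spectrahedron_convex[OF B0 B]) auto
      also have "\<dots> \<le> ((max 0 (k - J B0))\<^sup>2 + 2 * max 0 (k - J B0) * (t * (J B0 - J B)) + (t * (J B0 - J B))\<^sup>2)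
         + (\<Sum>i\<in>{1..n}. \<Sum>j\<in>{1..n}. adj E i j * ((max 0 (B0 i j))\<^sup>2 + 2 * max 0 (B0 i j) * (t * (B i j - B0 i j)) + (t * (B i j - B0 i j))\<^sup>2))"
      proof -
        have "k - J ?B = (k - J B0) + t * (J B0 - J B)" unfolding J by (simp add: algebra_simps)
        then have "(max 0 (k - J ?B))\<^sup>2
            \<le> (max 0 (k - J B0))\<^sup>2 + 2 * max 0 (k - J B0) * (t * (J B0 - J B)) + (t * (J B0 - J B))\<^sup>2"
          using pos_part_sq_le[of "k - J B0" "t * (J B0 - J B)"] by (simp only:)
        moreover have "(\<Sum>i\<in>{1..n}. \<Sum>j\<in>{1..n}. adj E i j * (max 0 (?B i j))\<^sup>2)
            \<le> (\<Sum>i\<in>{1..n}. \<Sum>j\<in>{1..n}. adj E i j * ((max 0 (B0 i j))\<^sup>2 + 2 * max 0 (B0 i j) * (t * (B i j - B0 i j)) + (t * (B i j - B0 i j))\<^sup>2))"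
          by (intro sum_mono mult_left_mono pos_part_sq_le) (simp add: adj_def)
        ultimately show ?thesis unfolding viol_def by (rule add_mono)
      qed
      also have "\<dots> = viol B0 + (2 * t * L + t\<^sup>2 * Q)"
      proof -
        have "(\<Sum>i\<in>{1..n}. \<Sum>j\<in>{1..n}. adj E i j * ((max 0 (B0 i j))\<^sup>2 + 2 * max 0 (B0 i j) * (t * (B i j - B0 i j)) + (t * (B i j - B0 i j))\<^sup>2))
          = (\<Sum>i\<in>{1..n}. \<Sum>j\<in>{1..n}. adj E i j * (max 0 (B0 i j))\<^sup>2 + 2 * t * (N i j * (B i j - B0 i j)) + t\<^sup>2 * (adj E i j * (B i j - B0 i j)\<^sup>2))"
          unfolding N_def power_mult_distrib by (intro sum.cong refl) (simp add: algebra_simps)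
        then show ?thesis
          unfolding viol_def L_def Q_def \<alpha>_def sum.distrib sum_distrib_left[symmetric] power_mult_distrib[of t]
          by (simp add: distrib_left mult_ac)
      qed
      finally show "0 \<le> 2 * t * L + t\<^sup>2 * Q" by simp
    qed
    moreover have "\<alpha> * J B0 = \<alpha> * k - \<alpha>\<^sup>2"
      by (auto simp: \<alpha>_def max_def power2_eq_square algebra_simps)
    moreover have "(\<Sum>i\<in>{1..n}. \<Sum>j\<in>{1..n}. N i j * (B i j - B0 i j))
        = (\<Sum>i\<in>{1..n}. \<Sum>j\<in>{1..n}. N i j * B i j) - (\<Sum>i\<in>{1..n}. \<Sum>j\<in>{1..n}. N i j * B0 i j)"
      by (simp add: right_diff_distrib sum_subtractf)
    ultimately show ?thesis unfolding L_def viol0 right_diff_distrib by linarith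
  qed
  have noloop: "{i} \<notin> E" for i
    using E pair_in_all_pairs[of i i n] by auto
  \<comment> \<open>Evaluated at the scaled identity \<open>I\<close>, which \<open>N\<close> does
    not see for lack of loops, \<open>\<alpha> = 0\<close> would give
    \<open>viol B0 \<le> 0\<close>.\<close>
  have \<alpha>: "0 < \<alpha>"
  proof (rule ccontr)
    assume "\<not> 0 < \<alpha>"
    then have "\<alpha> = 0" by (simp add: \<alpha>_def)
    moreover have "(\<Sum>i\<in>{1..n}. \<Sum>j\<in>{1..n}. N i j * I i j) = 0"
      using noloop by (intro sum.neutral ballI) (auto simp: N_def I_def adj_def)
    ultimately show False using opt[OF I] viol_pos by simp
  qed
  \<comment> \<open>The matrix \<open>(k I + N / \<alpha> - J) / (k - 1)\<close>, with identity
    \<open>I\<close> and all-one \<open>J\<close>. Testing \<open>opt\<close> on rank-one matrices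
    makes it positive semidefinite; \<open>N\<close>, nonnegative and supported on edges, leaves
    equality on nonedges, that is, on the edges of the complement.\<close>
  define W where "W = (\<lambda>i j. ((if i = j then k else 0) + N i j / \<alpha> - 1) / (k - 1))"
  have W: "psd n W"
    unfolding psd_def
  proof (intro conjI ballI allI)
    fix i j assume "i \<in> {1..n}" "j \<in> {1..n}"
    then have "B0 i j = B0 j i" using B0 by (auto simp: spectrahedron_def psd_def)
    then show "W i j = W j i" by (simp add: W_def N_def adj_sym[of E i j])
  next
    fix x :: "nat \<Rightarrow> real"
    let ?s = "\<Sum>l\<in>{1..n}. (x l)\<^sup>2"
    have s0: "0 \<le> ?s" by (simp add: sum_nonneg)
    let ?N = "\<Sum>i\<in>{1..n}. \<Sum>j\<in>{1..n}. N i j * (x i * x j)"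
    have "\<alpha> * (\<Sum>i\<in>{1..n}. x i)\<^sup>2 - ?N \<le> \<alpha> * k * ?s"
    proof (cases "?s = 0")
      case True
      then have "x l = 0" if "l \<in> {1..n}" for l
        using that by (subst (asm) sum_nonneg_eq_0_iff) auto
      then show ?thesis by simp
    next
      case False
      let ?B = "\<lambda>i j. if i \<in> {1..n} \<and> j \<in> {1..n} then x i * x j / ?s else 0"
      have "J ?B = (\<Sum>i\<in>{1..n}. x i)\<^sup>2 / ?s"
        unfolding J_def by (simp add: power2_eq_square sum_product sum_divide_distrib)
      moreover have "(\<Sum>i\<in>{1..n}. \<Sum>j\<in>{1..n}. N i j * ?B i j) = ?N / ?s"
        by (simp add: sum_divide_distrib)
      ultimately have "\<alpha> * ((\<Sum>i\<in>{1..n}. x i)\<^sup>2 / ?s) - ?N / ?s \<le> \<alpha> * k"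
        using opt[OF rank_one[OF False]] viol_pos by simp
      then have "(\<alpha> * (\<Sum>i\<in>{1..n}. x i)\<^sup>2 - ?N) / ?s \<le> \<alpha> * k" by (simp add: diff_divide_distrib)
      moreover have "0 < ?s" using False s0 by simp
      ultimately show ?thesis by (simp add: pos_divide_le_eq)
    qed
    then have "0 \<le> (\<alpha> * k * ?s + ?N - \<alpha> * (\<Sum>i\<in>{1..n}. x i)\<^sup>2) / (\<alpha> * (k - 1))"
      using \<alpha> k by (intro divide_nonneg_nonneg) auto
    also have "\<dots> = (k * ?s + ?N / \<alpha> - (\<Sum>i\<in>{1..n}. x i)\<^sup>2) / (k - 1)"
    proof -
      have "\<alpha> * k * ?s + ?N - \<alpha> * (\<Sum>i\<in>{1..n}. x i)\<^sup>2 = \<alpha> * (k * ?s + ?N / \<alpha> - (\<Sum>i\<in>{1..n}. x i)\<^sup>2)"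
        using \<alpha> by (simp add: algebra_simps)
      then show ?thesis using \<alpha> by simp
    qed
    also have "\<dots> = (\<Sum>i\<in>{1..n}. \<Sum>j\<in>{1..n}. W i j * x i * x j)"
    proof -
      have "(\<Sum>i\<in>{1..n}. \<Sum>j\<in>{1..n}. W i j * x i * x j)
        = (\<Sum>i\<in>{1..n}. \<Sum>j\<in>{1..n}. (if i = j then k * (x i)\<^sup>2 else 0) + N i j * (x i * x j) / \<alpha> - x i * x j) / (k - 1)"
        unfolding sum_divide_distrib W_def
        by (intro sum.cong refl) (simp add: power2_eq_square algebra_simps diff_divide_distrib add_divide_distrib)
      also have "(\<Sum>i\<in>{1..n}. \<Sum>j\<in>{1..n}. (if i = j then k * (x i)\<^sup>2 else 0) + N i j * (x i * x j) / \<alpha> - x i * x j)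
        = k * ?s + ?N / \<alpha> - (\<Sum>i\<in>{1..n}. x i)\<^sup>2"
        by (simp add: sum.distrib sum_subtractf sum_divide_distrib[symmetric] sum_distrib_left[symmetric]
            power2_eq_square sum_product)
      finally show ?thesis by simp
    qed
    finally show "0 \<le> (\<Sum>i\<in>{1..n}. \<Sum>j\<in>{1..n}. W i j * x i * x j)" .
  qed
  obtain v where v: "\<And>i j. i \<in> {1..n} \<Longrightarrow> j \<in> {1..n} \<Longrightarrow> W i j = ip n (v i) (v j)"
    using psd_gram[OF W] by blast
  have diag: "W i i = 1" for i
    using k noloop[of i] by (simp add: W_def N_def adj_def)
  have nonedge: "W i j = - 1 / (k - 1)" if "i \<noteq> j" "{i, j} \<notin> E" for i j
    using that by (simp add: W_def N_def adj_def)
  have edge: "- 1 / (k - 1) \<le> W i j" if "i \<noteq> j" for i j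
  proof -
    have "0 \<le> N i j / \<alpha>" using \<alpha> by (simp add: N_def adj_def)
    then show ?thesis using that k unfolding W_def by (intro divide_right_mono) auto
  qed
  have "rigid_vector_coloring n (compl_graph n E) k v"
    unfolding rigid_vector_coloring_def unit_vecs_def
  proof (intro conjI ballI impI)
    fix i assume i: "i \<in> {1..n}"
    show "ip n (v i) (v i) = 1" using v[OF i i] diag by simp
    fix j assume j: "j \<in> {1..n}"
    show "ip n (v i) (v j) = - 1 / (k - 1)" if "{i, j} \<in> compl_graph n E"
      using that nonedge[of i j] v[OF i j] by (simp add: compl_graph_def pair_in_all_pairs)
    show "ip n (v i) (v j) \<ge> - 1 / (k - 1)" if "i \<noteq> j"
      using that edge[of i j] v[OF i j] by simp
  qed
  then show ?thesis by blast
qed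

section \<open>Random regular graphs\<close>

text \<open>A circulant graph of degree \<open>r\<close>: join \<open>i\<close> and \<open>j\<close> when their difference modulo \<open>n\<close> is at most
  \<open>r div 2\<close> in absolute value, or, for odd \<open>r\<close>, equal to \<open>n div 2\<close>.\<close>
lemma reg_graphs_nonempty:
  assumes "r < n" "even (r * n)"
  shows "reg_graphs n r \<noteq> {}"
proof -
  define h where "h = r div 2"
  \<comment> \<open>The set is closed under \<open>d\<close> to \<open>n - d\<close>. For odd
    \<open>r\<close> the order \<open>n\<close> is even, and \<open>n div 2\<close> is its own
    mirror image, contributing the one extra neighbour.\<close>
  define D where "D = {d \<in> {1..<n}. d \<le> h \<or> n - d \<le> h \<or> odd r \<and> 2 * d = n}"
  \<comment> \<open>Adding \<open>n\<close> first keeps the natural-number subtraction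
    exact.\<close>
  define df where "df = (\<lambda>i j. (j + n - i) mod n)"
  define E where "E = {{i, j} | i j. i \<in> {1..n} \<and> j \<in> {1..n} \<and> df i j \<in> D}"
  have h: "2 * h < n" "2 * h \<le> r" using assms(1) by (auto simp: h_def)
  have D_sym: "n - d \<in> D" if "d \<in> D" for d using that by (auto simp: D_def)
  have D_card: "card D = r"
  proof -
    have un: "D = ({1..h} \<union> {n - h..<n}) \<union> (if odd r then {n div 2} else {})"
    proof (rule set_eqI)
      fix d
      show "d \<in> D \<longleftrightarrow> d \<in> ({1..h} \<union> {n - h..<n}) \<union> (if odd r then {n div 2} else {})"
        using assms h by (auto simp: D_def; presburger)
    qed
    have c: "card ({1..h} \<union> {n - h..<n}) = 2 * h"
      using h by (subst card_Un_disjoint) auto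
    show ?thesis
    proof (cases "odd r")
      case True
      then have "even n" "r = 2 * h + 1" using assms(2) by (auto simp: h_def)
      then have "n div 2 \<notin> {1..h} \<union> {n - h..<n}" using assms(1) h by auto
      then show ?thesis using c True \<open>r = 2 * h + 1\<close> unfolding un by (simp add: card_insert_if)
    next
      case False
      then show ?thesis using c unfolding un by (simp add: h_def)
    qed
  qed
  have df_swap: "df j i = n - df i j" if "i \<in> {1..n}" "j \<in> {1..n}" "df i j \<noteq> 0" for i j
  proof (cases "j < i")
    case True
    have "i + n - j = (i - j) + n" using True by simp
    then have "df j i = i - j" unfolding df_def using that True by (simp only: mod_add_self2) simp
    moreover have "df i j = j + n - i" unfolding df_def using that True by simp
    ultimately show ?thesis using that True by auto
  next
    case False
    then have "i \<noteq> j" using that by (auto simp: df_def)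
    then have "i < j" using False by simp
    have "j + n - i = (j - i) + n" using False by simp
    then have "df i j = j - i" unfolding df_def using that \<open>i < j\<close> by (simp only: mod_add_self2) simp
    moreover have "df j i = i + n - j" unfolding df_def using that \<open>i < j\<close> by simp
    ultimately show ?thesis using that \<open>i < j\<close> by auto
  qed
  have edge: "{i, j} \<in> E \<longleftrightarrow> df i j \<in> D" if ij: "i \<in> {1..n}" "j \<in> {1..n}" for i j
  proof
    assume "{i, j} \<in> E"
    then obtain a b where ab: "{i, j} = {a, b}" "a \<in> {1..n}" "b \<in> {1..n}" "df a b \<in> D"
      unfolding E_def mem_Collect_eq by (elim exE conjE)
    then have "df a b \<noteq> 0" by (auto simp: D_def)
    from ab(1) consider "i = a" "j = b" | "i = b" "j = a" unfolding doubleton_eq_iff by blast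
    then show "df i j \<in> D"
    proof cases
      case 2
      then show ?thesis using D_sym[OF ab(4)] df_swap[OF ab(2,3) \<open>df a b \<noteq> 0\<close>] by simp
    qed (use ab in simp)
  next
    assume "df i j \<in> D"
    then show "{i, j} \<in> E" unfolding E_def mem_Collect_eq using ij by (intro exI[of _ i] exI[of _ j]) simp
  qed
  have sub: "E \<subseteq> all_pairs n"
  proof
    fix e assume "e \<in> E"
    then obtain i j where e: "e = {i, j}" "i \<in> {1..n}" "j \<in> {1..n}" "df i j \<in> D"
      unfolding E_def mem_Collect_eq by (elim exE conjE)
    moreover have "i \<noteq> j" using e(4) by (auto simp: df_def D_def)
    ultimately show "e \<in> all_pairs n" by (simp add: pair_in_all_pairs)
  qed
  have "card {e \<in> E. i \<in> e} = r" if i: "i \<in> {1..n}" for i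
  proof -
    \<comment> \<open>From each vertex every residue occurs exactly once, so the degree is the size
      of \<open>D\<close>.\<close>
    have inj: "inj_on (df i) {1..n}"
    proof (rule inj_onI)
      fix a b assume ab: "a \<in> {1..n}" "b \<in> {1..n}" "df i a = df i b"
      have *: "x = y" if "x \<in> {1..n}" "y \<in> {1..n}" "df i x = df i y" "x \<le> y" for x y
      proof -
        have "n dvd (y + n - i) - (x + n - i)"
          using that(3,4) unfolding df_def by (subst mod_eq_dvd_iff_nat[symmetric]) auto
        moreover have "(y + n - i) - (x + n - i) = y - x" using i that by auto
        ultimately have "n dvd y - x" by simp
        moreover have "y - x < n" using that by auto
        ultimately have "y - x = 0" using nat_dvd_not_less by blast
        then show ?thesis using that by simp
      qed
      show "a = b" using *[of a b] *[of b a] ab by (cases "a \<le> b") auto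
    qed
    have "df i ` {1..n} \<subseteq> {..<n}" using assms(1) by (auto simp: df_def)
    moreover have "card (df i ` {1..n}) = n" using card_image[OF inj] by simp
    ultimately have img: "df i ` {1..n} = {..<n}"
      by (intro card_subset_eq) simp_all
    have "df i ` {j \<in> {1..n}. {i, j} \<in> E} = D"
    proof -
      have "df i ` {j \<in> {1..n}. {i, j} \<in> E} = df i ` {j \<in> {1..n}. df i j \<in> D}"
        using edge[OF i] by (intro arg_cong[where f = "image (df i)"]) auto
      also have "\<dots> = df i ` {1..n} \<inter> D" by blast
      also have "\<dots> = D" unfolding img by (auto simp: D_def)
      finally show ?thesis .
    qed
    moreover have "card (df i ` {j \<in> {1..n}. {i, j} \<in> E}) = card {j \<in> {1..n}. {i, j} \<in> E}"
      by (rule card_image) (rule inj_on_subset[OF inj], auto)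
    ultimately have "card {j \<in> {1..n}. {i, j} \<in> E} = r" using D_card by simp
    moreover have "(\<Sum>j\<in>{1..n}. adj E i j) = real (card {j \<in> {1..n}. {i, j} \<in> E})"
      unfolding adj_def by (simp add: sum.inter_filter[symmetric] of_bool_def)
    ultimately show ?thesis using degree_eq_row_sum[OF sub i] by simp
  qed
  then show ?thesis using sub by (auto simp: reg_graphs_def)
qed

text \<open>Nonemptiness matters here: with no regular graph the quotient defining
  \<open>prob_reg\<close> would be \<open>0 / 0 = 0\<close>.\<close>

lemma prob_reg_ge:
  assumes r: "1 \<le> r" and n: "r\<^sup>2 \<le> n" "8 * r \<le> n" "even (r * n)"
    and P: "\<And>E. E \<in> reg_graphs n r \<Longrightarrow> typical n r E \<Longrightarrow> P E"
  shows "1 - exp (- real n) \<le> prob_reg n r P"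
proof -
  let ?R = "reg_graphs n r"
  have "?R \<noteq> {}" using r n by (intro reg_graphs_nonempty) auto
  then have R0: "0 < real (card ?R)" using finite_reg_graphs by (simp add: card_gt_0_iff)
  have "?R = {E \<in> ?R. P E} \<union> {E \<in> ?R. \<not> P E}" by blast
  then have "card ?R \<le> card {E \<in> ?R. P E} + card {E \<in> ?R. \<not> P E}" by (metis card_Un_le)
  moreover have "card {E \<in> ?R. \<not> P E} \<le> card {E \<in> ?R. \<not> typical n r E}"
    using P finite_reg_graphs by (intro card_mono) auto
  ultimately have "real (card ?R) \<le> real (card {E \<in> ?R. P E}) + real (card ?R) * exp (- real n)"
    using card_not_typical[OF r n(1,2)] by linarith
  then have "(1 - exp (- real n)) * real (card ?R) \<le> real (card {E \<in> ?R. P E})"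
    by (simp add: algebra_simps)
  then show ?thesis using R0 by (simp add: prob_reg_def pos_le_divide_eq)
qed

lemma typical_theta:
  assumes r: "1 \<le> r" and n: "64 \<le> n" "r\<^sup>2 \<le> n" "8 * r \<le> n"
    and E: "E \<in> reg_graphs n r" and ty: "typical n r E"
  shows "1 / (2 * (1 + disc_const)) * real n / sqrt (real r) \<le> theta_half n E \<and>
         theta_half n E \<le> theta n E \<and> theta n E \<le> theta_2 n E \<and>
         theta_2 n E \<le> (1 + disc_const) * real n / sqrt (real r)"
    and "1 / disc_const * sqrt (real r) \<le> theta_bar_half n E \<and>
         theta_bar_half n E \<le> theta_bar n E \<and> theta_bar n E \<le> theta_bar_2 n E"
proof -
  have sub: "E \<subseteq> all_pairs n" "compl_graph n E \<subseteq> all_pairs n"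
    using E by (auto simp: reg_graphs_def compl_graph_def)
  have n2: "2 \<le> n" "1 \<le> n" using n(1) by auto
  have "real (2 * (r + 1)) \<le> real n" unfolding of_nat_le_iff using n by simp
  then have rn: "2 * (real r + 1) \<le> real n" by simp
  \<comment> \<open>The surplus \<open>n / sqrt r\<close> over the dual bound makes the inequality
    strict and ensures \<open>k > 1\<close>.\<close>
  define k where "k = (1 + disc_const) * real n / sqrt (real r)"
  have nr: "1 < real n / sqrt (real r)"
  proof -
    have "sqrt (real r) * 1 \<le> sqrt (real r) * sqrt (real r)" using r by (intro mult_left_mono) auto
    then have "sqrt (real r) \<le> real r" by simp
    also have "\<dots> < real n" using n r by linarith
    finally show ?thesis using r by simp
  qed
  have dc: "0 < disc_const" by (simp add: disc_const_def)
  have k_eq: "k = real n / sqrt (real r) + disc_const * (real n / sqrt (real r))"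
    by (simp add: k_def distrib_right add_divide_distrib)
  have "0 \<le> disc_const * (real n / sqrt (real r))" using dc nr by (intro mult_nonneg_nonneg) auto
  then have k1: "1 < k" using nr unfolding k_eq by linarith
  have "\<exists>v. rigid_vector_coloring n (compl_graph n E) k v"
  proof (rule rigid_compl_coloring_exists[OF sub(1) n2(2) k1])
    fix B assume "psd n B" "(\<Sum>i\<in>{1..n}. B i i) = 1"
      "\<And>i j. i \<in> {1..n} \<Longrightarrow> j \<in> {1..n} \<Longrightarrow> {i, j} \<in> E \<Longrightarrow> B i j \<le> 0"
    from psd_edge_nonpos_bound[OF r E ty n2(2) this]
    show "(\<Sum>i\<in>{1..n}. \<Sum>j\<in>{1..n}. B i j) < k" using nr unfolding k_eq by linarith
  qed
  then have "theta_2 n E \<le> k"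
    unfolding theta_2_def theta_bar_2_def using k1 by (intro cInf_lower bdd_belowI[of _ 1]) auto
  moreover have "1 / (2 * (1 + disc_const)) * real n / sqrt (real r) \<le> theta_half n E"
    unfolding theta_half_def
    by (rule theta_bar_half_ge[OF n2(1) sub(2)]) (rule compl_vector_coloring_ge[OF r E ty n2(2) _ _ rn])
  ultimately show "1 / (2 * (1 + disc_const)) * real n / sqrt (real r) \<le> theta_half n E \<and>
         theta_half n E \<le> theta n E \<and> theta n E \<le> theta_2 n E \<and>
         theta_2 n E \<le> (1 + disc_const) * real n / sqrt (real r)"
    using theta_chain[OF n2(1) sub(2)] by (simp add: theta_half_def theta_def theta_2_def k_def)
  show "1 / disc_const * sqrt (real r) \<le> theta_bar_half n E \<and>
         theta_bar_half n E \<le> theta_bar n E \<and> theta_bar n E \<le> theta_bar_2 n E"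
    using theta_chain[OF n2(1) sub(1)]
      theta_bar_half_ge[OF n2(1) sub(1) vector_coloring_ge[OF r E ty n2(2)]] by simp
qed

text \<open>Once \<open>r \<le> sqrt n\<close>, the threshold 64 gives \<open>8 \<le> sqrt n\<close>
  and thereby \<open>8 * r \<le> n\<close>.\<close>

lemma eventually_degree_small:
  fixes r :: "nat \<Rightarrow> nat"
  assumes "(\<lambda>n. real (r n) / sqrt (real n)) \<longlonglongrightarrow> 0"
  shows "\<exists>N\<ge>64. \<forall>n\<ge>N. (r n)\<^sup>2 \<le> n \<and> 8 * r n \<le> n"
proof -
  have "eventually (\<lambda>n. real (r n) / sqrt (real n) < 1) sequentially"
    using order_tendstoD(2)[OF assms] by simp
  then obtain N where N: "\<And>n. N \<le> n \<Longrightarrow> real (r n) / sqrt (real n) < 1"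
    by (auto simp: eventually_sequentially)
  have "(r n)\<^sup>2 \<le> n \<and> 8 * r n \<le> n" if "max N 64 \<le> n" for n
  proof -
    have n: "64 \<le> real n" "0 < sqrt (real n)" using that by auto
    have le: "real (r n) \<le> sqrt (real n)" using N[of n] that n(2) by (simp add: pos_divide_less_eq)
    then have "(real (r n))\<^sup>2 \<le> real n" using power_mono[OF le, of 2] by simp
    moreover have "8 * real (r n) \<le> real n"
    proof -
      have "8 = sqrt 64" by (rule real_sqrt_unique[symmetric]) auto
      then have "8 \<le> sqrt (real n)" using n(1) by (metis real_sqrt_le_iff)
      then have "8 * real (r n) \<le> sqrt (real n) * sqrt (real n)" using le by (intro mult_mono) auto
      then show ?thesis by simp
    qed
    ultimately show ?thesis by (metis of_nat_le_iff of_nat_mult of_nat_numeral of_nat_power)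
  qed
  then show ?thesis by (intro exI[of _ "max N 64"]) auto
qed

lemma tendsto_sqrt_if_tendsto_root4:
  fixes r :: "nat \<Rightarrow> nat"
  assumes "(\<lambda>n. real (r n) / real n powr (1 / 4)) \<longlonglongrightarrow> 0"
  shows "(\<lambda>n. real (r n) / sqrt (real n)) \<longlonglongrightarrow> 0"
proof (rule tendsto_sandwich[OF _ _ tendsto_const assms])
  show "eventually (\<lambda>n. 0 \<le> real (r n) / sqrt (real n)) sequentially" by simp
  show "eventually (\<lambda>n. real (r n) / sqrt (real n) \<le> real (r n) / real n powr (1 / 4)) sequentially"
  proof (rule eventually_sequentiallyI[of 1])
    fix n :: nat assume n: "1 \<le> n"
    have "real n powr (1 / 4) \<le> real n powr (1 / 2)" using n by (intro powr_mono) auto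
    also have "\<dots> = sqrt (real n)" by (simp add: powr_half_sqrt)
    finally show "real (r n) / sqrt (real n) \<le> real (r n) / real n powr (1 / 4)"
      using n by (intro divide_left_mono) auto
  qed
qed

theorem theorem5:
  "\<exists>c0::real.
    (\<forall>r::nat \<Rightarrow> nat.
       (\<forall>n. c0 \<le> real (r n)) \<and>
       ((\<lambda>n. real (r n) / real n powr (1/4)) \<longlonglongrightarrow> 0) \<longrightarrow>
       (\<exists>c1>0. \<exists>c2>0. \<forall>\<epsilon>>0. \<exists>N. \<forall>n\<ge>N. even (r n * n) \<longrightarrow>
          prob_reg n (r n) (\<lambda>E.
              c1 * real n / sqrt (real (r n)) \<le> theta_half n E \<and>
              theta_half n E \<le> theta n E \<and>
              theta n E \<le> theta_2 n E \<and>
              theta_2 n E \<le> c2 * real n / sqrt (real (r n))) \<ge> 1 - \<epsilon>)) \<and>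
    (\<exists>c3>0. \<forall>r::nat \<Rightarrow> nat.
       (\<forall>n. c0 \<le> real (r n)) \<and>
       ((\<lambda>n. real (r n) / sqrt (real n)) \<longlonglongrightarrow> 0) \<longrightarrow>
       (\<exists>N. \<forall>n\<ge>N. even (r n * n) \<longrightarrow>
          prob_reg n (r n) (\<lambda>E.
              c3 * sqrt (real (r n)) \<le> theta_bar_half n E \<and>
              theta_bar_half n E \<le> theta_bar n E \<and>
              theta_bar n E \<le> theta_bar_2 n E) \<ge> 1 - exp (- real n)))"
\<comment> \<open>The estimates have absolute constants and hold from degree one on, so
  \<open>c0 = 1\<close> suffices.\<close>
proof (rule exI[of _ "1::real"], intro conjI allI impI)
  fix r :: "nat \<Rightarrow> nat"
  assume r: "(\<forall>n. 1 \<le> real (r n)) \<and> ((\<lambda>n. real (r n) / real n powr (1/4)) \<longlonglongrightarrow> 0)"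
  then have r1: "1 \<le> r n" for n by (simp add: Suc_le_eq flip: of_nat_le_iff)
  obtain N where N: "64 \<le> N" "\<And>n. N \<le> n \<Longrightarrow> (r n)\<^sup>2 \<le> n \<and> 8 * r n \<le> n"
    using eventually_degree_small[OF tendsto_sqrt_if_tendsto_root4] r by blast
  show "\<exists>c1>0. \<exists>c2>0. \<forall>\<epsilon>>0. \<exists>N. \<forall>n\<ge>N. even (r n * n) \<longrightarrow>
          prob_reg n (r n) (\<lambda>E.
              c1 * real n / sqrt (real (r n)) \<le> theta_half n E \<and>
              theta_half n E \<le> theta n E \<and>
              theta n E \<le> theta_2 n E \<and>
              theta_2 n E \<le> c2 * real n / sqrt (real (r n))) \<ge> 1 - \<epsilon>"
  proof (rule exI[of _ "1 / (2 * (1 + disc_const))"], intro exI[of _ "1 + disc_const"] conjI allI impI)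
    show "0 < 1 / (2 * (1 + disc_const))" "0 < 1 + disc_const" by (simp_all add: disc_const_def)
    fix \<epsilon> :: real assume \<epsilon>: "0 < \<epsilon>"
    have "(\<lambda>n. exp (- real n)) \<longlonglongrightarrow> 0"
      by (intro filterlim_compose[OF exp_at_bot] filterlim_compose[OF filterlim_uminus_at_bot_at_top] filterlim_real_sequentially)
    then have "eventually (\<lambda>n. exp (- real n) < \<epsilon>) sequentially"
      using \<epsilon> by (rule order_tendstoD(2))
    then obtain M where M: "\<And>n. M \<le> n \<Longrightarrow> exp (- real n) < \<epsilon>" by (auto simp: eventually_sequentially)
    show "\<exists>N. \<forall>n\<ge>N. even (r n * n) \<longrightarrow>
          prob_reg n (r n) (\<lambda>E.
              1 / (2 * (1 + disc_const)) * real n / sqrt (real (r n)) \<le> theta_half n E \<and>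
              theta_half n E \<le> theta n E \<and>
              theta n E \<le> theta_2 n E \<and>
              theta_2 n E \<le> (1 + disc_const) * real n / sqrt (real (r n))) \<ge> 1 - \<epsilon>"
    proof (intro exI[of _ "max N M"] allI impI)
      fix n assume n: "max N M \<le> n" "even (r n * n)"
      then have s: "64 \<le> n" "(r n)\<^sup>2 \<le> n" "8 * r n \<le> n" using N by auto
      have "1 - \<epsilon> \<le> 1 - exp (- real n)" using M[of n] n by simp
      also have "\<dots> \<le> prob_reg n (r n) (\<lambda>E.
              1 / (2 * (1 + disc_const)) * real n / sqrt (real (r n)) \<le> theta_half n E \<and>
              theta_half n E \<le> theta n E \<and>
              theta n E \<le> theta_2 n E \<and>
              theta_2 n E \<le> (1 + disc_const) * real n / sqrt (real (r n)))"
        by (rule prob_reg_ge[OF r1 s(2,3) n(2)]) (rule typical_theta(1)[OF r1 s])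
      finally show "1 - \<epsilon> \<le> prob_reg n (r n) (\<lambda>E.
              1 / (2 * (1 + disc_const)) * real n / sqrt (real (r n)) \<le> theta_half n E \<and>
              theta_half n E \<le> theta n E \<and>
              theta n E \<le> theta_2 n E \<and>
              theta_2 n E \<le> (1 + disc_const) * real n / sqrt (real (r n)))" .
    qed
  qed
next
  show "\<exists>c3>0. \<forall>r::nat \<Rightarrow> nat.
       (\<forall>n. 1 \<le> real (r n)) \<and>
       ((\<lambda>n. real (r n) / sqrt (real n)) \<longlonglongrightarrow> 0) \<longrightarrow>
       (\<exists>N. \<forall>n\<ge>N. even (r n * n) \<longrightarrow>
          prob_reg n (r n) (\<lambda>E.
              c3 * sqrt (real (r n)) \<le> theta_bar_half n E \<and>
              theta_bar_half n E \<le> theta_bar n E \<and>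
              theta_bar n E \<le> theta_bar_2 n E) \<ge> 1 - exp (- real n))"
  proof (intro exI[of _ "1 / disc_const"] conjI allI impI)
    show "0 < 1 / disc_const" by (simp add: disc_const_def)
    fix r :: "nat \<Rightarrow> nat"
    assume r: "(\<forall>n. 1 \<le> real (r n)) \<and> ((\<lambda>n. real (r n) / sqrt (real n)) \<longlonglongrightarrow> 0)"
    then have r1: "1 \<le> r n" for n by (simp add: Suc_le_eq flip: of_nat_le_iff)
    obtain N where N: "64 \<le> N" "\<And>n. N \<le> n \<Longrightarrow> (r n)\<^sup>2 \<le> n \<and> 8 * r n \<le> n"
      using eventually_degree_small r by blast
    show "\<exists>N. \<forall>n\<ge>N. even (r n * n) \<longrightarrow>
          prob_reg n (r n) (\<lambda>E.
              1 / disc_const * sqrt (real (r n)) \<le> theta_bar_half n E \<and>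
              theta_bar_half n E \<le> theta_bar n E \<and>
              theta_bar n E \<le> theta_bar_2 n E) \<ge> 1 - exp (- real n)"
    proof (intro exI[of _ N] allI impI)
      fix n assume n: "N \<le> n" "even (r n * n)"
      then have s: "64 \<le> n" "(r n)\<^sup>2 \<le> n" "8 * r n \<le> n" using N by auto
      show "1 - exp (- real n) \<le> prob_reg n (r n) (\<lambda>E.
              1 / disc_const * sqrt (real (r n)) \<le> theta_bar_half n E \<and>
              theta_bar_half n E \<le> theta_bar n E \<and>
              theta_bar n E \<le> theta_bar_2 n E)"
        by (rule prob_reg_ge[OF r1 s(2,3) n(2)]) (rule typical_theta(2)[OF r1 s])
    qed
  qed
qed

end
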